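(* Let $p$ be a prime and $F/\mathbb{Q}_p$ a finite extension. Let $\tau_1$ and $\tau_2$ be inertial types defined over $F$ with trivial determinant, each having image isomorphic to one of the following groups: a cyclic group of order $2,3,4$ or $6$; the group $C_3\rtimes C_4$ of order $12$ if $p=3$; the quaternion group $Q_8$ if $p=2$; the group $\mathrm{SL}_2(\mathbb{F}_3)$ if $p=2$. Let $N_i\subset\overline{F}$ be the field fixed by $\ker\tau_i$. Then $N_1=N_2$ if and only if $\tau_1\simeq\tau_2$.
   Context: $\overline F$ is an algebraic closure of $F$, $W_F$ the Weil group of $F$ and $I_F=\mathrm{Gal}(\overline F/F^{un})$ its inertia subgroup ($F^{un}$ the maximal unramified extension). An inertial type defined over $F$ is here a representation $\tau=\rho|_{I_F}$ of $I_F$, up to isomorphism, where $\rho:W_F\to\mathrm{GL}_2(\mathbb{C})$ is a continuous representation (the representation part of a 2-dimensional Weil–Deligne representation; the monodromy operator $N$ is suppressed). $C_3\rtimes C_4$ is the non-abelian semidirect product (dicyclic group of order 12). *)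

theory Defs
  imports
    "HOL-Analysis.Analysis"
    "HOL-Algebra.Algebra"
    "HOL-Algebra.Algebraic_Closure_Type"
    "HOL-Library.Numeral_Type"
begin

section \<open>The field of p-adic numbers\<close>

definition padic_abs :: "nat \<Rightarrow> rat \<Rightarrow> real" where
  "padic_abs p x =
     (if x = 0 then 0
      else real p powi (int (multiplicity (int p) (snd (quotient_of x)))
                        - int (multiplicity (int p) (fst (quotient_of x)))))"

definition padic_cauchy_ring :: "nat \<Rightarrow> (nat \<Rightarrow> rat) ring" where
  "padic_cauchy_ring p =
     \<lparr>carrier = {f. \<forall>e>0. \<exists>M. \<forall>m\<ge>M. \<forall>n\<ge>M. padic_abs p (f m - f n) < e},
      monoid.mult = (\<lambda>f g n. f n * g n),
      one = (\<lambda>n. 1),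
      ring.zero = (\<lambda>n. 0),
      add = (\<lambda>f g n. f n + g n)\<rparr>"

definition padic_null_seqs :: "nat \<Rightarrow> (nat \<Rightarrow> rat) set" where
  "padic_null_seqs p = {f. (\<lambda>n. padic_abs p (f n)) \<longlonglongrightarrow> 0}"

text \<open>\<open>\<rat>\<^sub>p\<close> is the completion of \<open>\<rat>\<close> for the p-adic absolute value.\<close>

definition Qp :: "nat \<Rightarrow> (nat \<Rightarrow> rat) set ring" where
  "Qp p = padic_cauchy_ring p Quot padic_null_seqs p"

text \<open>
  The closed unit ball of \<open>\<rat>\<^sub>p\<close>. The absolute value takes discrete values, so a class of
  absolute value at most 1 has a representative all of whose terms are p-integral.
\<close>

definition Zp :: "nat \<Rightarrow> (nat \<Rightarrow> rat) set set" where
  "Zp p = {x \<in> carrier (Qp p). \<exists>f\<in>x. \<forall>n. padic_abs p (f n) \<le> 1}"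


section \<open>A finite extension of the p-adic numbers inside its algebraic closure\<close>

text \<open>
  The field \<open>F\<close> is the type \<open>'f\<close>, given as an extension of \<open>\<rat>\<^sub>p\<close> by an embedding \<open>\<iota>\<close>.
\<close>

definition finite_extension_of_Qp ::
  "nat \<Rightarrow> ((nat \<Rightarrow> rat) set \<Rightarrow> 'f::field) \<Rightarrow> bool" where
  "finite_extension_of_Qp p \<iota> \<longleftrightarrow>
     \<iota> \<in> ring_hom (Qp p) ring_of_type_algebra \<and>
     ring.finite_dimension ring_of_type_algebra (\<iota> ` carrier (Qp p)) UNIV"

abbreviation Fbar :: "'f::field alg_closure ring" where
  "Fbar \<equiv> ring_of_type_algebra"

definition base_field :: "'f::field alg_closure set" where
  "base_field = range to_ac"

definition finite_subextension :: "'f::field alg_closure set \<Rightarrow> bool" where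
  "finite_subextension E \<longleftrightarrow>
     subfield E Fbar \<and> base_field \<subseteq> E \<and> ring.finite_dimension Fbar base_field E"

text \<open>
  For a field \<open>E\<close> between \<open>F\<close> and its algebraic closure, the valuation ring of \<open>E\<close>
  (for the unique extension of the p-adic valuation) is the integral closure of \<open>\<int>\<^sub>p\<close> in \<open>E\<close>.
\<close>

definition valuation_ring ::
  "nat \<Rightarrow> ((nat \<Rightarrow> rat) set \<Rightarrow> 'f::field) \<Rightarrow> 'f alg_closure set \<Rightarrow> 'f alg_closure ring" where
  "valuation_ring p \<iota> E = Fbar\<lparr>carrier :=
     {x \<in> E. \<exists>q. Polynomial.lead_coeff q = 1 \<and> (\<forall>i. Polynomial.coeff q i \<in> (to_ac \<circ> \<iota>) ` Zp p) \<and>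
             poly q x = 0}\<rparr>"

definition valuation_ideal ::
  "nat \<Rightarrow> ((nat \<Rightarrow> rat) set \<Rightarrow> 'f::field) \<Rightarrow> 'f alg_closure set \<Rightarrow> 'f alg_closure set" where
  "valuation_ideal p \<iota> E = carrier (valuation_ring p \<iota> E) - Units (valuation_ring p \<iota> E)"

definition residue_card :: "nat \<Rightarrow> ((nat \<Rightarrow> rat) set \<Rightarrow> 'f::field) \<Rightarrow> nat" where
  "residue_card p \<iota> =
     card (carrier (valuation_ring p \<iota> base_field Quot valuation_ideal p \<iota> base_field))"

text \<open>
  Unramified means ramification index one; the residue extension is automatically separable
  because the residue fields are finite.
\<close>

definition unramified ::
  "nat \<Rightarrow> ((nat \<Rightarrow> rat) set \<Rightarrow> 'f::field) \<Rightarrow> 'f alg_closure set \<Rightarrow> bool" where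
  "unramified p \<iota> E \<longleftrightarrow>
     genideal (valuation_ring p \<iota> E) (valuation_ideal p \<iota> base_field) = valuation_ideal p \<iota> E"

definition max_unramified ::
  "nat \<Rightarrow> ((nat \<Rightarrow> rat) set \<Rightarrow> 'f::field) \<Rightarrow> 'f alg_closure set" where
  "max_unramified p \<iota> =
     generate_field Fbar (\<Union>{E. finite_subextension E \<and> unramified p \<iota> E})"


section \<open>Galois, inertia and Weil groups\<close>

definition galois_group ::
  "'f::field alg_closure set \<Rightarrow> ('f alg_closure \<Rightarrow> 'f alg_closure) monoid" where
  "galois_group K =
     \<lparr>carrier = {\<sigma> \<in> ring_iso Fbar Fbar. \<forall>x\<in>K. \<sigma> x = x}, monoid.mult = (\<circ>), one = id\<rparr>"

abbreviation absolute_galois_group :: "('f::field alg_closure \<Rightarrow> 'f alg_closure) monoid" where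
  "absolute_galois_group \<equiv> galois_group base_field"

definition krull_topology :: "('f::field alg_closure \<Rightarrow> 'f alg_closure) topology" where
  "krull_topology = topology_generated_by
     {\<sigma> <#\<^bsub>absolute_galois_group\<^esub> carrier (galois_group E) | \<sigma> E.
        \<sigma> \<in> carrier absolute_galois_group \<and> finite_subextension E}"

definition inertia_group ::
  "nat \<Rightarrow> ((nat \<Rightarrow> rat) set \<Rightarrow> 'f::field) \<Rightarrow> ('f alg_closure \<Rightarrow> 'f alg_closure) monoid" where
  "inertia_group p \<iota> = galois_group (max_unramified p \<iota>)"

definition frobenius_elements ::
  "nat \<Rightarrow> ((nat \<Rightarrow> rat) set \<Rightarrow> 'f::field) \<Rightarrow> ('f alg_closure \<Rightarrow> 'f alg_closure) set" where
  "frobenius_elements p \<iota> =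
     {\<phi> \<in> carrier absolute_galois_group.
        \<forall>x\<in>carrier (valuation_ring p \<iota> (max_unramified p \<iota>)).
          \<phi> x - x ^ residue_card p \<iota> \<in> valuation_ideal p \<iota> (max_unramified p \<iota>)}"

text \<open>
  The Weil group is the inverse image in the absolute Galois group of the cyclic subgroup
  generated by the Frobenius in the Galois group of \<open>F\<^sup>u\<^sup>n\<close> over \<open>F\<close>. Elements of the latter are
  represented by lifts to the algebraic closure, hence the comparison on \<open>F\<^sup>u\<^sup>n\<close>.
\<close>

definition weil_group ::
  "nat \<Rightarrow> ((nat \<Rightarrow> rat) set \<Rightarrow> 'f::field) \<Rightarrow> ('f alg_closure \<Rightarrow> 'f alg_closure) monoid" where
  "weil_group p \<iota> = absolute_galois_group\<lparr>carrier :=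
     {\<sigma> \<in> carrier absolute_galois_group.
        \<exists>\<phi>\<in>generate absolute_galois_group (frobenius_elements p \<iota>).
          \<forall>x\<in>max_unramified p \<iota>. \<sigma> x = \<phi> x}\<rparr>"

text \<open>
  The inertia group, with its Krull topology, is an open subgroup of the Weil group; this is
  finer than the topology induced on the Weil group by the absolute Galois group.
\<close>

definition weil_topology ::
  "nat \<Rightarrow> ((nat \<Rightarrow> rat) set \<Rightarrow> 'f::field) \<Rightarrow> ('f alg_closure \<Rightarrow> 'f alg_closure) topology" where
  "weil_topology p \<iota> = topology_generated_by
     {\<sigma> <#\<^bsub>weil_group p \<iota>\<^esub> U | \<sigma> U.
        \<sigma> \<in> carrier (weil_group p \<iota>) \<and>
        openin (subtopology krull_topology (carrier (inertia_group p \<iota>))) U}"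


section \<open>Inertial types\<close>

definition GL2 :: "(complex^2^2) monoid" where
  "GL2 = \<lparr>carrier = {A. invertible A}, monoid.mult = (**), one = mat 1\<rparr>"

definition weil_representation ::
  "nat \<Rightarrow> ((nat \<Rightarrow> rat) set \<Rightarrow> 'f::field)
     \<Rightarrow> (('f alg_closure \<Rightarrow> 'f alg_closure) \<Rightarrow> complex^2^2) \<Rightarrow> bool" where
  "weil_representation p \<iota> \<rho> \<longleftrightarrow>
     \<rho> \<in> hom (weil_group p \<iota>) GL2 \<and>
     continuous_map (weil_topology p \<iota>) (subtopology euclidean (carrier GL2)) \<rho>"

definition inertial_type ::
  "nat \<Rightarrow> ((nat \<Rightarrow> rat) set \<Rightarrow> 'f::field)
     \<Rightarrow> (('f alg_closure \<Rightarrow> 'f alg_closure) \<Rightarrow> complex^2^2) \<Rightarrow> bool" where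
  "inertial_type p \<iota> \<tau> \<longleftrightarrow>
     (\<exists>\<rho>. weil_representation p \<iota> \<rho> \<and> \<tau> = restrict \<rho> (carrier (inertia_group p \<iota>)))"

definition trivial_determinant ::
  "nat \<Rightarrow> ((nat \<Rightarrow> rat) set \<Rightarrow> 'f::field)
     \<Rightarrow> (('f alg_closure \<Rightarrow> 'f alg_closure) \<Rightarrow> complex^2^2) \<Rightarrow> bool" where
  "trivial_determinant p \<iota> \<tau> \<longleftrightarrow> (\<forall>\<sigma>\<in>carrier (inertia_group p \<iota>). det (\<tau> \<sigma>) = 1)"

definition type_image ::
  "nat \<Rightarrow> ((nat \<Rightarrow> rat) set \<Rightarrow> 'f::field)
     \<Rightarrow> (('f alg_closure \<Rightarrow> 'f alg_closure) \<Rightarrow> complex^2^2) \<Rightarrow> (complex^2^2) monoid" where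
  "type_image p \<iota> \<tau> = GL2\<lparr>carrier := \<tau> ` carrier (inertia_group p \<iota>)\<rparr>"

definition isomorphic_types ::
  "nat \<Rightarrow> ((nat \<Rightarrow> rat) set \<Rightarrow> 'f::field)
     \<Rightarrow> (('f alg_closure \<Rightarrow> 'f alg_closure) \<Rightarrow> complex^2^2)
     \<Rightarrow> (('f alg_closure \<Rightarrow> 'f alg_closure) \<Rightarrow> complex^2^2) \<Rightarrow> bool" where
  "isomorphic_types p \<iota> \<tau>\<^sub>1 \<tau>\<^sub>2 \<longleftrightarrow>
     (\<exists>P. invertible P \<and>
          (\<forall>\<sigma>\<in>carrier (inertia_group p \<iota>). P ** \<tau>\<^sub>1 \<sigma> = \<tau>\<^sub>2 \<sigma> ** P))"

definition kernel_field ::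
  "nat \<Rightarrow> ((nat \<Rightarrow> rat) set \<Rightarrow> 'f::field)
     \<Rightarrow> (('f alg_closure \<Rightarrow> 'f alg_closure) \<Rightarrow> complex^2^2) \<Rightarrow> 'f alg_closure set" where
  "kernel_field p \<iota> \<tau> = {x. \<forall>\<sigma>\<in>kernel (inertia_group p \<iota>) GL2 \<tau>. \<sigma> x = x}"


section \<open>The groups occurring as images\<close>

definition semidirect_product ::
  "'a monoid \<Rightarrow> 'b monoid \<Rightarrow> ('b \<Rightarrow> 'a \<Rightarrow> 'a) \<Rightarrow> ('a \<times> 'b) monoid" where
  "semidirect_product G H \<phi> =
     \<lparr>carrier = carrier G \<times> carrier H,
      monoid.mult = (\<lambda>(g, h) (g', h'). (g \<otimes>\<^bsub>G\<^esub> \<phi> h g', h \<otimes>\<^bsub>H\<^esub> h')),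
      one = (\<one>\<^bsub>G\<^esub>, \<one>\<^bsub>H\<^esub>)\<rparr>"

text \<open>A generator of \<open>C\<^sub>4\<close> acts on \<open>C\<^sub>3\<close> by inversion, the only non-trivial action.\<close>

definition C3_semidirect_C4 :: "(int \<times> int) monoid" where
  "C3_semidirect_C4 =
     semidirect_product (integer_mod_group 3) (integer_mod_group 4)
       (\<lambda>h g. ((- 1) ^ nat h * g) mod 3)"

text \<open>
  The unit quaternions \<open>\<plusminus>1, \<plusminus>i, \<plusminus>j, \<plusminus>k\<close>, where \<open>a + bi + cj + dk\<close> is written \<open>(a, b, c, d)\<close>,
  with Hamilton's multiplication.
\<close>

definition Q8 :: "(int \<times> int \<times> int \<times> int) monoid" where
  "Q8 =
     \<lparr>carrier = {(1, 0, 0, 0), (-1, 0, 0, 0), (0, 1, 0, 0), (0, -1, 0, 0),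
                 (0, 0, 1, 0), (0, 0, -1, 0), (0, 0, 0, 1), (0, 0, 0, -1)},
      monoid.mult = (\<lambda>(a, b, c, d) (a', b', c', d').
        (a * a' - b * b' - c * c' - d * d',
         a * b' + b * a' + c * d' - d * c',
         a * c' - b * d' + c * a' + d * b',
         a * d' + b * c' - c * b' + d * a')),
      one = (1, 0, 0, 0)\<rparr>"

text \<open>The numeral type \<open>3\<close> is the ring of integers modulo 3, that is, the field \<open>\<bbbF>\<^sub>3\<close>.\<close>

definition SL2_F3 :: "(3^2^2) monoid" where
  "SL2_F3 = \<lparr>carrier = {A. det A = 1}, monoid.mult = (**), one = mat 1\<rparr>"

definition admissible_image :: "nat \<Rightarrow> (complex^2^2) monoid \<Rightarrow> bool" where
  "admissible_image p G \<longleftrightarrow>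
     (\<exists>n\<in>{2, 3, 4, 6}. G \<cong> integer_mod_group n) \<or>
     (p = 3 \<and> G \<cong> C3_semidirect_C4) \<or>
     (p = 2 \<and> G \<cong> Q8) \<or>
     (p = 2 \<and> G \<cong> SL2_F3)"

end

theory Submission
  imports Defs "Jordan_Normal_Form.Char_Poly"
begin

text \<open>
  All groups in the list consist of elements of order 1, 2, 3, 4 or 6, and the order of such an
  element of \<open>SL\<^sub>2(\<complex>)\<close> determines its trace. Hence two types with the same kernel have the same
  character. Averaging the matrix units over the finite image then yields a nonzero intertwiner \<open>P\<close>.
  If \<open>P\<close> is singular, its kernel is a common eigenline, so commutators have trace 2 and are trivial;
  in this abelian case every image is a linear combination of 1 and one fixed nonscalar image, with
  coefficients read off from traces.

  That equal kernel fields force equal kernels is the Galois correspondence for closed subgroups of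
  inertia. It needs inertia to fix the base field \<open>F\<close>, that is, \<open>F\<close> must be unramified over itself.
  With the definition of unramifiedness used here, this amounts to the integral closure of \<open>\<int>\<^sub>p\<close>
  in \<open>F\<close> being a local ring, which is proved by lifting idempotents along \<open>\<int>\<^sub>p[x] \<rightarrow> \<int>\<^sub>p[x]/p\<close>.
\<close>

hide_const (open) up_ring.coeff up_ring.monom Polynomials.degree Polynomials.lead_coeff

section \<open>Integral elements over a subring of a field\<close>

text \<open>What singles out the orders 1, 2, 3, 4 and 6 is that each has at most two primitive
  roots of unity. An element of SL_2 of such an order has eigenvalues \<zeta> and \<zeta>^-1, and
  the order leaves no choice of this pair; for order 5 or 8 there would be two pairs. The characters
  are then integer valued, so their pairing is a sum of squares to which the identity contributes 4.
  This is what keeps some average of a matrix unit from vanishing. Inertia is infinite and only the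
  images are finite. The average therefore runs over the finite set of pairs of image matrices,
  which plays the part of the quotient by the common kernel. The Galois correspondence enters
  through finite approximation: an automorphism fixing the fixed field of a subgroup agrees on every
  finite set with a member of that subgroup, and continuity of the type makes its kernel closed
  under such approximation. In the lifting of idempotents every correction is truncated to integer
  digits, so that limits are taken of integer sequences only.\<close>

locale field_subring =
  fixes R :: "'a::field set"
  assumes zero_mem: "0 \<in> R" and one_mem: "1 \<in> R"
    and add_mem: "\<And>x y. x \<in> R \<Longrightarrow> y \<in> R \<Longrightarrow> x + y \<in> R"
    and mult_mem: "\<And>x y. x \<in> R \<Longrightarrow> y \<in> R \<Longrightarrow> x * y \<in> R"
    and uminus_mem: "\<And>x. x \<in> R \<Longrightarrow> - x \<in> R"
begin

text \<open>The condition is the one in \<open>valuation_ring\<close>, so that membership in the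
  valuation ring of F becomes \<open>integral\<close> together with membership in F.\<close>

definition integral :: "'a \<Rightarrow> bool" where
  "integral x \<longleftrightarrow> (\<exists>q. lead_coeff q = 1 \<and> (\<forall>i. coeff q i \<in> R) \<and> poly q x = 0)"

definition lin_span :: "'i set \<Rightarrow> ('i \<Rightarrow> 'a) \<Rightarrow> 'a set" where
  "lin_span S f = {\<Sum>i\<in>S. r i * f i | r. \<forall>i. r i \<in> R}"

lemma diff_mem: "x \<in> R \<Longrightarrow> y \<in> R \<Longrightarrow> x - y \<in> R"
  using add_mem[of x "- y"] uminus_mem[of y] by simp

lemma sum_mem: "(\<And>i. i \<in> S \<Longrightarrow> f i \<in> R) \<Longrightarrow> sum f S \<in> R"
  by (induction S rule: infinite_finite_induct) (auto intro: zero_mem add_mem)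

lemma power_mem: "x \<in> R \<Longrightarrow> x ^ n \<in> R"
  by (induction n) (auto intro: one_mem mult_mem)

lemma of_nat_mem: "of_nat n \<in> R"
  by (induction n) (auto intro: zero_mem one_mem add_mem)

lemma of_int_mem: "of_int n \<in> R"
  by (cases n rule: int_cases) (auto simp del: of_nat_Suc intro!: of_nat_mem uminus_mem)

lemma integral_of_mem: "x \<in> R \<Longrightarrow> integral x"
  unfolding integral_def
  by (rule exI[of _ "[:- x, 1:]"]) (auto simp: coeff_pCons zero_mem one_mem uminus_mem split: nat.split)

section \<open>Spans with coefficients in R\<close>

lemma lin_span_zero: "0 \<in> lin_span S f"
  unfolding lin_span_def by (rule CollectI, rule exI[of _ "\<lambda>_. 0"]) (auto simp: zero_mem)

lemma lin_span_add: "x \<in> lin_span S f \<Longrightarrow> y \<in> lin_span S f \<Longrightarrow> x + y \<in> lin_span S f"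
proof -
  assume "x \<in> lin_span S f" "y \<in> lin_span S f"
  then obtain r s where "\<forall>i. r i \<in> R" "\<forall>i. s i \<in> R"
      "x = (\<Sum>i\<in>S. r i * f i)" "y = (\<Sum>i\<in>S. s i * f i)"
    unfolding lin_span_def by auto
  then show ?thesis unfolding lin_span_def
    by (intro CollectI exI[of _ "\<lambda>i. r i + s i"]) (auto simp: distrib_right sum.distrib add_mem)
qed

lemma lin_span_scale: "c \<in> R \<Longrightarrow> y \<in> lin_span S f \<Longrightarrow> c * y \<in> lin_span S f"
proof -
  assume "c \<in> R" "y \<in> lin_span S f"
  then obtain s where "\<forall>i. s i \<in> R" "y = (\<Sum>i\<in>S. s i * f i)"
    unfolding lin_span_def by auto
  then show ?thesis using \<open>c \<in> R\<close> unfolding lin_span_def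
    by (intro CollectI exI[of _ "\<lambda>i. c * s i"]) (auto simp: sum_distrib_left mult_mem mult.assoc)
qed

lemma lin_span_superset: "finite S \<Longrightarrow> k \<in> S \<Longrightarrow> f k \<in> lin_span S f"
  unfolding lin_span_def
  by (rule CollectI, rule exI[of _ "\<lambda>i. if i = k then 1 else 0"])
    (auto simp: zero_mem one_mem if_distrib[of "\<lambda>a. a * _"] cong: if_cong)

lemma lin_span_sum: "(\<And>j. j \<in> J \<Longrightarrow> g j \<in> lin_span S f) \<Longrightarrow> sum g J \<in> lin_span S f"
  by (induction J rule: infinite_finite_induct) (auto intro: lin_span_zero lin_span_add)

lemma lin_span_stable:
  assumes "\<And>i. i \<in> S \<Longrightarrow> y * f i \<in> lin_span S f" "x \<in> lin_span S f"
  shows "y * x \<in> lin_span S f"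
proof -
  obtain r where r: "\<forall>i. r i \<in> R" "x = (\<Sum>i\<in>S. r i * f i)"
    using assms(2) unfolding lin_span_def by auto
  have "y * x = (\<Sum>i\<in>S. r i * (y * f i))"
    by (simp add: r sum_distrib_left mult_ac)
  also have "\<dots> \<in> lin_span S f"
    by (rule lin_span_sum, rule lin_span_scale) (use r(1) assms(1) in auto)
  finally show ?thesis .
qed

lemma coeff_mult_mem:
  "(\<And>i. coeff p i \<in> R) \<Longrightarrow> (\<And>i. coeff q i \<in> R) \<Longrightarrow> coeff (p * q) i \<in> R"
  by (auto simp: coeff_mult intro!: sum_mem mult_mem)

lemma coeff_prod_mem:
  "(\<And>k i. k \<in> S \<Longrightarrow> coeff (f k) i \<in> R) \<Longrightarrow> coeff (prod f S) i \<in> R"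
proof (induction S arbitrary: i rule: infinite_finite_induct)
  case (insert x F)
  then show ?case by (auto intro!: coeff_mult_mem)
qed (auto simp: zero_mem one_mem)

text \<open>By the Leibniz formula the characteristic polynomial is a signed sum of products of
  entries of \<open>char_poly_matrix A\<close>, and each entry has coefficients in R.\<close>

lemma coeff_char_poly_mem:
  assumes A: "A \<in> carrier_mat n n" and R: "\<And>i j. i < n \<Longrightarrow> j < n \<Longrightarrow> A $$ (i, j) \<in> R"
  shows "coeff (char_poly A) i \<in> R"
proof -
  have entry: "coeff (char_poly_matrix A $$ (i, j)) k \<in> R" if "i < n" "j < n" for i j k
    using that A R[OF that] unfolding char_poly_matrix_def
    by (auto simp: coeff_pCons zero_mem one_mem uminus_mem diff_mem split: nat.split)
  have sign: "coeff (signof \<pi> :: 'a poly) i \<in> R" for \<pi> i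
    by (auto simp: sign_def zero_mem one_mem uminus_mem)
  show ?thesis
    unfolding char_poly_def det_def'[OF char_poly_matrix_closed[OF A]] coeff_sum
    by (intro sum_mem coeff_mult_mem coeff_prod_mem entry sign) (auto simp: permutes_in_image)
qed

text \<open>The determinant trick: \<open>y\<close> is an eigenvalue of a matrix with entries in \<open>R\<close>.\<close>

lemma integral_of_stable_span:
  assumes "finite S" "i\<^sub>0 \<in> S" "f i\<^sub>0 \<noteq> 0" and stable: "\<And>i. i \<in> S \<Longrightarrow> y * f i \<in> lin_span S f"
  shows "integral y"
proof -
  obtain h where h: "bij_betw h {0..<card S} S"
    using ex_bij_betw_nat_finite[OF assms(1)] by blast
  have "\<forall>i\<in>S. \<exists>r. (\<forall>j. r j \<in> R) \<and> y * f i = (\<Sum>j\<in>S. r j * f j)"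
    using stable unfolding lin_span_def by blast
  then obtain r where r: "\<And>i j. i \<in> S \<Longrightarrow> r i j \<in> R"
      "\<And>i. i \<in> S \<Longrightarrow> y * f i = (\<Sum>j\<in>S. r i j * f j)"
    by metis
  define n where "n = card S"
  define A where "A = mat n n (\<lambda>(i, j). r (h i) (h j))"
  define u where "u = vec n (f \<circ> h)"
  have hS: "h i \<in> S" if "i < n" for i
    using h that unfolding n_def by (auto simp: bij_betw_def)
  have A: "A \<in> carrier_mat n n" unfolding A_def by simp
  obtain k where k: "k < n" "h k = i\<^sub>0"
    using h assms(2) unfolding n_def bij_betw_def by (metis atLeastLessThan_iff imageE)
  \<comment> \<open>An eigenvector must be nonzero; the entry at \<open>k\<close>, namely
    \<open>f i\<^sub>0\<close>, guarantees this.\<close>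
  have "vec_index u k \<noteq> vec_index (0\<^sub>v n) k"
    using k assms(3) unfolding u_def by simp
  then have "u \<noteq> 0\<^sub>v n" by metis
  moreover have "A *\<^sub>v u = y \<cdot>\<^sub>v u"
  proof (rule eq_vecI)
    fix i assume "i < dim_vec (y \<cdot>\<^sub>v u)"
    then have i: "i < n" unfolding u_def by simp
    have "vec_index (A *\<^sub>v u) i = (\<Sum>j = 0..<n. r (h i) (h j) * f (h j))"
      using i unfolding A_def u_def by (simp add: scalar_prod_def)
    also have "\<dots> = (\<Sum>j\<in>S. r (h i) j * f j)"
      using h unfolding n_def by (rule sum.reindex_bij_betw)
    also have "\<dots> = y * f (h i)" using r hS[OF i] by simp
    finally show "vec_index (A *\<^sub>v u) i = vec_index (y \<cdot>\<^sub>v u) i"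
      using i unfolding u_def by simp
  qed (simp add: A_def u_def)
  ultimately have "eigenvalue A y"
    unfolding eigenvalue_def eigenvector_def using A
    by (intro exI[of _ u]) (auto simp: u_def)
  then have "poly (char_poly A) y = 0"
    using eigenvalue_root_char_poly[OF A] by simp
  moreover have "coeff (char_poly A) i \<in> R" for i
    by (rule coeff_char_poly_mem[OF A]) (auto simp: A_def hS r)
  ultimately show ?thesis
    unfolding integral_def using degree_monic_char_poly[OF A] by (intro exI[of _ "char_poly A"]) auto
qed

text \<open>Solving the monic equation for its top power turns integrality into a rule that lowers
  exponents. All values of \<open>c\<close> lie in R, also beyond \<open>n\<close>, so no index
  conditions arise later.\<close>

lemma integral_power_expand:
  assumes "integral x"
  obtains n c where "n > 0" "\<And>i. c i \<in> R" "x ^ n = (\<Sum>i<n. c i * x ^ i)"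
proof -
  obtain q where q: "lead_coeff q = 1" "\<And>i. coeff q i \<in> R" "poly q x = 0"
    using assms unfolding integral_def by blast
  \<comment> \<open>A monic constant is 1 and has no root.\<close>
  have "degree q > 0"
    using q(1,3) by (cases "degree q = 0") (auto elim!: degree_eq_zeroE)
  moreover have "x ^ degree q = (\<Sum>i<degree q. - coeff q i * x ^ i)"
  proof -
    have "0 = (\<Sum>i\<le>degree q. coeff q i * x ^ i)" using q(3) by (simp add: poly_altdef)
    also have "{..degree q} = insert (degree q) {..<degree q}" by auto
    also have "(\<Sum>i\<in>\<dots>. coeff q i * x ^ i) = x ^ degree q + (\<Sum>i<degree q. coeff q i * x ^ i)"
      using q(1) by simp
    finally show ?thesis by (simp add: sum_negf eq_neg_iff_add_eq_0)
  qed
  ultimately show ?thesis using q(2) by (intro that[of "degree q" "\<lambda>i. - coeff q i"]) (auto intro: uminus_mem)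
qed

text \<open>The monomials x^i y^j below the degrees of the two equations span a module stable under
  multiplication by x and by y, hence by x + y and by x y, so the determinant trick applies.\<close>

lemma integral_add_mult:
  assumes "integral x" "integral y"
  shows "integral (x + y)" "integral (x * y)"
proof -
  obtain n c where n: "n > 0" "\<And>i. c i \<in> R" "x ^ n = (\<Sum>i<n. c i * x ^ i)"
    using integral_power_expand[OF assms(1)] by metis
  obtain m d where m: "m > 0" "\<And>i. d i \<in> R" "y ^ m = (\<Sum>i<m. d i * y ^ i)"
    using integral_power_expand[OF assms(2)] by metis
  define S where "S = {..<n} \<times> {..<m}"
  define f where "f = (\<lambda>(i, j). x ^ i * y ^ j)"
  have fin: "finite S" unfolding S_def by auto
  have mem: "x ^ i * y ^ j \<in> lin_span S f" if "i < n" "j < m" for i j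
    using lin_span_superset[OF fin, of "(i, j)" f] that unfolding S_def f_def by simp
  have x: "x * f k \<in> lin_span S f" if "k \<in> S" for k
  proof -
    obtain i j where ij: "f k = x ^ i * y ^ j" "i < n" "j < m"
      using \<open>k \<in> S\<close> unfolding S_def f_def by auto
    show ?thesis
    proof (cases "Suc i < n")
      case True
      then show ?thesis using mem[OF True ij(3)] ij by (simp add: mult_ac)
    next
      case False
      then have "n = Suc i" using ij by simp
      then have "x * f k = x ^ n * y ^ j" using ij by (simp add: mult_ac)
      also have "\<dots> = (\<Sum>k<n. c k * (x ^ k * y ^ j))"
        unfolding n(3) by (simp add: sum_distrib_right mult.assoc)
      also have "\<dots> \<in> lin_span S f" using ij n(2) by (intro lin_span_sum lin_span_scale mem) auto
      finally show ?thesis .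
    qed
  qed
  have y: "y * f k \<in> lin_span S f" if "k \<in> S" for k
  proof -
    obtain i j where ij: "f k = x ^ i * y ^ j" "i < n" "j < m"
      using \<open>k \<in> S\<close> unfolding S_def f_def by auto
    show ?thesis
    proof (cases "Suc j < m")
      case True
      then show ?thesis using mem[OF ij(2) True] ij by (simp add: mult_ac)
    next
      case False
      then have "m = Suc j" using ij by simp
      then have "y * f k = x ^ i * y ^ m" using ij by (simp add: mult_ac)
      also have "\<dots> = (\<Sum>k<m. d k * (x ^ i * y ^ k))"
        unfolding m(3) by (simp add: sum_distrib_left mult.left_commute)
      also have "\<dots> \<in> lin_span S f" using ij m(2) by (intro lin_span_sum lin_span_scale mem) auto
      finally show ?thesis .
    qed
  qed
  \<comment> \<open>The monomial x^0 y^0 = 1 is the nonzero generator; it is present because both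
    degrees are positive.\<close>
  have one: "(0, 0) \<in> S" "f (0, 0) \<noteq> 0" using n(1) m(1) unfolding S_def f_def by auto
  show "integral (x + y)"
    by (rule integral_of_stable_span[where f = f, OF fin one])
      (auto simp: distrib_right intro!: lin_span_add x y)
  have "x * y * f k \<in> lin_span S f" if "k \<in> S" for k
    using lin_span_stable[OF x y[OF that]] by (simp add: mult_ac)
  then show "integral (x * y)"
    by (intro integral_of_stable_span[where f = f, OF fin one]) auto
qed

lemma integral_scale: "c \<in> R \<Longrightarrow> integral x \<Longrightarrow> integral (c * x)"
  by (rule integral_add_mult(2)[OF integral_of_mem])

lemma integral_power: "integral x \<Longrightarrow> integral (x ^ n)"
  by (induction n) (auto intro: integral_of_mem one_mem integral_add_mult)

lemma integral_uminus: "integral x \<Longrightarrow> integral (- x)"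
  using integral_add_mult(2)[of "- 1" x] integral_of_mem[of "- 1"] one_mem uminus_mem by simp

lemma integral_sum: "(\<And>i. i \<in> S \<Longrightarrow> integral (f i)) \<Longrightarrow> integral (sum f S)"
  by (induction S rule: infinite_finite_induct)
    (auto intro: integral_of_mem zero_mem integral_add_mult)

end

section \<open>The integral closure of a complete discrete valuation ring is local\<close>

text \<open>
  Completeness is only required of sequences of integers; for \<open>\<int>\<^sub>p\<close> such a sequence is itself a
  representative of its limit.
\<close>

locale complete_dvr = field_subring R for R :: "'a::field set" +
  fixes p :: nat
  assumes p_nonzero: "(of_nat p :: 'a) \<noteq> 0"
    and residue: "\<And>r. r \<in> R \<Longrightarrow> \<exists>a s. s \<in> R \<and> r = of_int a + of_nat p * s"
    and complete: "\<And>a :: nat \<Rightarrow> int. (\<And>k. int p ^ Suc k dvd a (Suc k) - a k) \<Longrightarrow>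
      \<exists>r\<in>R. \<forall>k. \<exists>s\<in>R. r = of_int (a k) + of_nat p ^ Suc k * s"
    and unit_one_plus: "\<And>s. s \<in> R \<Longrightarrow> \<exists>u\<in>R. u * (1 + of_nat p * s) = 1"
    and power_of_p: "\<And>r. r \<in> R \<Longrightarrow> r \<noteq> 0 \<Longrightarrow> \<exists>k. \<exists>u\<in>R. u * r = of_nat p ^ k"
begin

abbreviation P :: 'a where "P \<equiv> of_nat p"

text \<open>P lies in the Jacobson radical of the integral closure. The element b = P a is a root of
  the monic q(T) = T^n - sum c_i P^(n-i) T^i, and 1 - b divides q(1) - q(b) = q(1), which is 1
  modulo P and therefore a unit of R.\<close>

lemma integral_unit_one_minus:
  assumes "integral a"
  obtains w where "integral w" "w * (1 - P * a) = 1"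
proof -
  obtain n c where n: "n > 0" "\<And>i. c i \<in> R" "a ^ n = (\<Sum>i<n. c i * a ^ i)"
    using integral_power_expand[OF assms] by metis
  define b where "b = P * a"
  have b: "integral b"
    unfolding b_def by (rule integral_scale[OF of_nat_mem assms])
  define g where "g i = (\<Sum>j<i. b ^ j)" for i
  \<comment> \<open>\<open>W\<close> is the quotient (q(1) - q(b)) / (1 - b) written out, with
    \<open>g i\<close> standing for (1 - b^i) / (1 - b).\<close>
  define W where "W = g n - (\<Sum>i<n. c i * P ^ (n - i) * g i)"
  have g: "integral (g i)" for i
    unfolding g_def by (intro integral_sum integral_power b)
  have "integral W"
    unfolding W_def diff_conv_add_uminus
    by (intro integral_add_mult(1) integral_uminus integral_sum integral_scale g mult_mem n(2) power_mem of_nat_mem)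
  have bn: "b ^ n = (\<Sum>i<n. c i * P ^ (n - i) * b ^ i)"
  proof -
    have "b ^ n = P ^ n * (\<Sum>i<n. c i * a ^ i)" unfolding b_def power_mult_distrib n(3)[symmetric] ..
    also have "\<dots> = (\<Sum>i<n. c i * (P ^ (n - i) * P ^ i) * a ^ i)"
      by (auto simp: sum_distrib_left power_add[symmetric] intro!: sum.cong)
    finally show ?thesis unfolding b_def by (simp add: power_mult_distrib mult_ac)
  qed
  \<comment> \<open>For i < n the exponent n - i is positive, so one factor P can be split off every
    term; hence \<open>n - i - 1\<close>.\<close>
  define s where "s = - (\<Sum>i<n. c i * P ^ (n - i - 1))"
  have s: "s \<in> R" unfolding s_def by (intro uminus_mem sum_mem mult_mem n(2) power_mem of_nat_mem)
  have "(1 - b) * W = (1 - b ^ n) - (\<Sum>i<n. c i * P ^ (n - i) * (1 - b ^ i))"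
    unfolding W_def g_def one_diff_power_eq right_diff_distrib sum_distrib_left
    by (simp add: mult.left_commute)
  also have "\<dots> = 1 - (\<Sum>i<n. c i * P ^ (n - i))"
    by (subst bn) (simp add: right_diff_distrib sum_subtractf)
  also have "(\<Sum>i<n. c i * P ^ (n - i)) = (\<Sum>i<n. P * (c i * P ^ (n - i - 1)))"
  proof (rule sum.cong)
    fix i assume "i \<in> {..<n}"
    then have "n - i = Suc (n - i - 1)" by simp
    then have "P ^ (n - i) = P * P ^ (n - i - 1)" by (metis power_Suc)
    then show "c i * P ^ (n - i) = P * (c i * P ^ (n - i - 1))" by (simp add: mult_ac)
  qed simp
  finally have W: "(1 - b) * W = 1 + P * s" unfolding s_def by (simp add: sum_distrib_left)
  obtain u where u: "u \<in> R" "u * (1 + P * s) = 1" using unit_one_plus[OF s] by blast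
  show ?thesis
  proof
    show "integral (u * W)" using u(1) \<open>integral W\<close> by (rule integral_scale)
    show "u * W * (1 - P * a) = 1"
      using u(2) unfolding W[symmetric] b_def by (simp only: mult.assoc mult.commute[of W])
  qed
qed

lemma p_not_unit: "integral a \<Longrightarrow> P * a \<noteq> 1"
  using integral_unit_one_minus[of a] by fastforce

text \<open>Powers of y are cancelled from the equation until the constant term is nonzero; that
  term is then a multiple of y. The descent stops in time, since for n = 0 the equation would read 1
  = 0.\<close>

lemma integral_divides_constant:
  assumes "y \<noteq> 0" "integral y" "\<And>i. c i \<in> R" "y ^ n = (\<Sum>i<n. c i * y ^ i)"
  shows "\<exists>r\<in>R. r \<noteq> 0 \<and> (\<exists>w. integral w \<and> r = y * w)"
  using assms(3,4)
proof (induction n arbitrary: c)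
  case (Suc n)
  have split: "y ^ Suc n = c 0 + y * (\<Sum>i<n. c (Suc i) * y ^ i)"
    unfolding Suc.prems(2) sum.lessThan_Suc_shift by (simp add: sum_distrib_left mult_ac)
  show ?case
  proof (cases "c 0 = 0")
    case True
    then have "y ^ n = (\<Sum>i<n. c (Suc i) * y ^ i)" using split assms(1) by simp
    from Suc.IH[OF Suc.prems(1) this] show ?thesis .
  next
    case False
    define w where "w = y ^ n - (\<Sum>i<n. c (Suc i) * y ^ i)"
    have "integral w" unfolding w_def diff_conv_add_uminus
      by (intro integral_add_mult(1) integral_uminus integral_sum integral_scale integral_power assms(2) Suc.prems(1))
    moreover have "c 0 = y * w" unfolding w_def using split by (simp add: algebra_simps)
    ultimately show ?thesis using False Suc.prems(1) by metis
  qed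
qed simp

text \<open>A nonzero y divides a nonzero element of R and hence some P^k. If P^(k+1) divided y,
  then P would be invertible.\<close>

lemma integral_infinitely_divisible:
  assumes "integral y" "\<And>k. \<exists>c. integral c \<and> y = P ^ k * c"
  shows "y = 0"
proof (rule ccontr)
  assume "y \<noteq> 0"
  obtain n c where "\<And>i. c i \<in> R" "y ^ n = (\<Sum>i<n. c i * y ^ i)"
    using integral_power_expand[OF assms(1)] by metis
  from integral_divides_constant[OF \<open>y \<noteq> 0\<close> assms(1) this]
  obtain r w where r: "r \<in> R" "r \<noteq> 0" "integral w" "r = y * w" by metis
  obtain k u where u: "u \<in> R" "u * r = P ^ k" using power_of_p[OF r(1,2)] by blast
  obtain c where c: "integral c" "y = P ^ Suc k * c" using assms(2) by blast
  have "P ^ k * (P * (u * w * c)) = P ^ k"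
    using u(2) unfolding r(4) c(2) by (simp add: mult_ac)
  then have "P * (u * w * c) = 1" using p_nonzero by simp
  moreover have "integral (u * w * c)" using integral_add_mult(2)[OF integral_scale[OF u(1) r(3)] c(1)] .
  ultimately show False using p_not_unit by blast
qed

lemma residue_digit:
  assumes "r \<in> R"
  obtains a s where "a \<in> {0..<int p}" "s \<in> R" "r = of_int a + P * s"
proof -
  obtain a s where as: "s \<in> R" "r = of_int a + P * s" using residue[OF assms] by blast
  have p: "p > 0" using p_nonzero by (cases p) auto
  have "(of_int a :: 'a) = of_int (int p * (a div int p) + a mod int p)" by simp
  also have "\<dots> = P * of_int (a div int p) + of_int (a mod int p)"
    by (simp only: of_int_add of_int_mult of_int_of_nat_eq)
  finally have "r = of_int (a mod int p) + P * (of_int (a div int p) + s)"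
    using as(2) by (simp add: algebra_simps)
  moreover have "a mod int p \<in> {0..<int p}" using p by simp
  ultimately show ?thesis using that as(1) add_mem of_int_mem by blast
qed

text \<open>
  Idempotents of \<open>R[x]/p\<close> lift to \<open>R[x]\<close>, where only 0 and 1 are idempotent. Some power
  \<open>x ^ N\<close> is idempotent modulo \<open>p\<close>, so it is congruent to 0 or to 1.
\<close>

context
  fixes x :: 'a and n :: nat and c :: "nat \<Rightarrow> 'a"
  assumes x: "integral x" and n: "n > 0" and c: "\<And>i. c i \<in> R" and xn: "x ^ n = (\<Sum>i<n. c i * x ^ i)"
begin

abbreviation Rx :: "'a set" where "Rx \<equiv> lin_span {..<n} (\<lambda>i. x ^ i)"

text \<open>Elements of \<open>Rx\<close> presented by integer coefficients, so that completeness,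
  which speaks of integer sequences, applies to each coefficient. The powers of x may be dependent,
  so \<open>g\<close> is not determined by its value.\<close>

definition ev :: "(nat \<Rightarrow> int) \<Rightarrow> 'a" where "ev g = (\<Sum>i<n. of_int (g i) * x ^ i)"

lemma Rx_basis: "i < n \<Longrightarrow> x ^ i \<in> Rx"
  by (rule lin_span_superset) auto

lemma Rx_of_mem: "r \<in> R \<Longrightarrow> r \<in> Rx"
  using lin_span_scale[OF _ Rx_basis[OF n]] by simp

lemma Rx_shift: "a \<in> Rx \<Longrightarrow> x * a \<in> Rx"
proof (rule lin_span_stable)
  fix i assume i: "i \<in> {..<n}"
  show "x * x ^ i \<in> Rx"
  proof (cases "Suc i < n")
    case True
    then show ?thesis using Rx_basis[OF True] by simp
  next
    case False
    then have "n = Suc i" using i by simp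
    then have "x * x ^ i = x ^ n" by simp
    also have "\<dots> \<in> Rx" unfolding xn using c by (intro lin_span_sum lin_span_scale Rx_basis) auto
    finally show ?thesis .
  qed
qed

lemma Rx_power_mult: "a \<in> Rx \<Longrightarrow> x ^ k * a \<in> Rx"
  by (induction k) (auto simp: mult.assoc Rx_shift)

lemma Rx_mult: "a \<in> Rx \<Longrightarrow> b \<in> Rx \<Longrightarrow> a * b \<in> Rx"
proof -
  assume "a \<in> Rx" "b \<in> Rx"
  have "a * x ^ i \<in> Rx" for i
    using Rx_power_mult[OF \<open>a \<in> Rx\<close>, of i] by (simp only: mult.commute)
  then show "a * b \<in> Rx" using \<open>b \<in> Rx\<close> by (rule lin_span_stable)
qed

lemma Rx_diff: "a \<in> Rx \<Longrightarrow> b \<in> Rx \<Longrightarrow> a - b \<in> Rx"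
  using lin_span_add[of a "{..<n}" "\<lambda>i. x ^ i" "- 1 * b"]
    lin_span_scale[of "- 1" b "{..<n}" "\<lambda>i. x ^ i"] uminus_mem[OF one_mem] by simp

lemma Rx_power: "x ^ k \<in> Rx"
  using Rx_power_mult[OF Rx_of_mem[OF one_mem]] by simp

lemma Rx_integral: "a \<in> Rx \<Longrightarrow> integral a"
  unfolding lin_span_def
  by (auto intro!: integral_sum integral_scale integral_power x)

lemma ev_Rx: "ev g \<in> Rx"
  unfolding ev_def by (intro lin_span_sum lin_span_scale of_int_mem Rx_basis) auto

text \<open>This makes \<open>Rx\<close> modulo P finite. Taking \<open>g\<close> from an
  extensional function space is what makes the set of digit tuples finite.\<close>

lemma Rx_digits:
  assumes "a \<in> Rx"
  obtains g b where "g \<in> {..<n} \<rightarrow>\<^sub>E {0..<int p}" "b \<in> Rx" "a = ev g + P * b"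
proof -
  obtain r where r: "\<And>i. r i \<in> R" "a = (\<Sum>i<n. r i * x ^ i)"
    using assms unfolding lin_span_def by auto
  have "\<forall>i. \<exists>d s. d \<in> {0..<int p} \<and> s \<in> R \<and> r i = of_int d + P * s"
    using residue_digit[OF r(1)] by metis
  then obtain d s where ds: "\<And>i. d i \<in> {0..<int p}" "\<And>i. s i \<in> R" "\<And>i. r i = of_int (d i) + P * s i"
    by metis
  show ?thesis
  proof
    show "restrict d {..<n} \<in> {..<n} \<rightarrow>\<^sub>E {0..<int p}" using ds(1) by (auto simp del: atLeastLessThan_iff)
    show "(\<Sum>i<n. s i * x ^ i) \<in> Rx" using ds(2) unfolding lin_span_def by auto
    have "a = (\<Sum>i<n. of_int (d i) * x ^ i + P * (s i * x ^ i))"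
      unfolding r(2) ds(3) by (simp add: algebra_simps)
    then show "a = ev (restrict d {..<n}) + P * (\<Sum>i<n. s i * x ^ i)"
      unfolding ev_def by (simp add: sum.distrib sum_distrib_left)
  qed
qed

text \<open>Finitely many classes modulo P force x^i and x^j to be congruent for some i < j. From
  exponent i on the powers are periodic with period d = j - i, and a multiple N of d with N \<ge> i
  satisfies x^N = x^(2N) modulo P.\<close>

lemma power_idempotent_mod_p:
  obtains N b where "N > 0" "b \<in> Rx" "x ^ N - x ^ (2 * N) = P * b"
proof -
  have "\<forall>k. \<exists>g b. g \<in> {..<n} \<rightarrow>\<^sub>E {0..<int p} \<and> b \<in> Rx \<and> x ^ k = ev g + P * b"
    using Rx_digits[OF Rx_power] by metis
  then obtain G B where G: "\<And>k. G k \<in> {..<n} \<rightarrow>\<^sub>E {0..<int p}" "\<And>k. B k \<in> Rx"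
      "\<And>k. x ^ k = ev (G k) + P * B k"
    by metis
  have "finite ({..<n} \<rightarrow>\<^sub>E {0..<int p})" by (intro finite_PiE) auto
  then have "finite (range G)" using G(1) by (meson finite_subset image_subsetI)
  then have "\<not> inj G" using finite_imageD infinite_UNIV_nat by blast
  then obtain i j where ij: "i < j" "G i = G j"
    unfolding inj_on_def by (metis linorder_neqE_nat)
  define d where "d = j - i"
  have j: "j = i + d" "d > 0" using ij d_def by auto
  have base: "x ^ i - x ^ j = P * (B i - B j)"
    using G(3)[of i] G(3)[of j] ij(2) by (simp add: algebra_simps)
  have step: "x ^ m - x ^ (m + d) = P * (x ^ (m - i) * (B i - B j))" if "m \<ge> i" for m
  proof -
    have "x ^ m - x ^ (m + d) = x ^ (m - i) * (x ^ i - x ^ j)"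
      using that j(1) by (simp add: right_diff_distrib power_add[symmetric])
    then show ?thesis unfolding base by (simp add: mult_ac)
  qed
  have iterate: "\<exists>b\<in>Rx. x ^ m - x ^ (m + t * d) = P * b" if "m \<ge> i" for m t
  proof (induction t)
    case 0
    then show ?case using lin_span_zero by (intro bexI[of _ 0]) auto
  next
    case (Suc t)
    then obtain b where b: "b \<in> Rx" "x ^ m - x ^ (m + t * d) = P * b" by blast
    define b' where "b' = x ^ (m + t * d - i) * (B i - B j)"
    have "x ^ (m + t * d) - x ^ (m + t * d + d) = P * b'"
      unfolding b'_def by (rule step) (use that in simp)
    then have "x ^ m - x ^ (m + Suc t * d) = P * (b + b')"
      using b(2) by (simp add: algebra_simps)
    moreover have "b + b' \<in> Rx" unfolding b'_def
      using b(1) G(2) by (intro lin_span_add Rx_power_mult Rx_diff)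
    ultimately show ?case by blast
  qed
  \<comment> \<open>N = (i + 1) d is a multiple of the period, at least i, and positive even when i
    = 0.\<close>
  have "Suc i * d \<ge> i" using j(2) by (cases d) auto
  from iterate[OF this, of "Suc i"] obtain b where "b \<in> Rx" "x ^ (Suc i * d) - x ^ (Suc i * d + Suc i * d) = P * b"
    by blast
  then show ?thesis using that[of "Suc i * d" b, unfolded mult_2] j(2) by simp
qed

text \<open>One Newton step for T^2 - T. The derivative 2e - 1 squares to 1 + 4(e^2 - e), so it is
  its own inverse modulo P^(k+1), and the correction is P^(k+1) (1 - 2e) b. Only the integer digits
  of (1 - 2e) b are kept, so the step is used to gain a single power of P.\<close>

lemma lift_idempotent_step:
  assumes "b \<in> Rx" "ev g ^ 2 - ev g = P ^ Suc k * b"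
  shows "\<exists>g' b'. b' \<in> Rx \<and> ev g' ^ 2 - ev g' = P ^ Suc (Suc k) * b' \<and> (\<forall>i. int p ^ Suc k dvd g' i - g i)"
proof -
  define e where "e = ev g"
  define y where "y = (1 - 2 * e) * b"
  have two: "(2 :: 'a) \<in> R" "(4 :: 'a) \<in> R" using of_nat_mem[of 2] of_nat_mem[of 4] by simp_all
  have e: "1 - 2 * e \<in> Rx" unfolding e_def by (intro Rx_diff Rx_mult ev_Rx Rx_of_mem one_mem two)
  then have y: "y \<in> Rx" unfolding y_def using assms(1) by (intro Rx_mult)
  obtain h z where hz: "z \<in> Rx" "y = ev h + P * z" using Rx_digits[OF y] by metis
  define g' where "g' i = g i + int p ^ Suc k * h i" for i
  \<comment> \<open>The quotient left after the cancellation: the error terms quadratic in P^(k+1),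
    and the discarded tail \<open>z\<close> of the correction.\<close>
  define b' where "b' = P ^ k * ((ev h) ^ 2 - 4 * b ^ 2) + (1 - 2 * e) * z"
  show ?thesis
  proof (intro exI conjI allI)
    have mem: "P ^ k \<in> Rx" "4 \<in> Rx" by (intro Rx_of_mem power_mem of_nat_mem two)+
    have "P ^ k * (ev h * ev h - 4 * (b * b)) \<in> Rx"
      by (intro Rx_mult Rx_diff mem ev_Rx assms(1))
    then show "b' \<in> Rx" unfolding b'_def power2_eq_square
      using Rx_mult[OF e hz(1)] by (rule lin_span_add)
    define q where "q = P ^ k"
    have g': "ev g' = e + P * q * ev h"
      unfolding ev_def g'_def e_def q_def by (simp add: sum.distrib sum_distrib_left algebra_simps)
    have h: "ev h = (1 - 2 * e) * b - P * z" using hz(2) y_def by simp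
    have e2: "e * e - e = P * q * b" using assms(2) unfolding e_def q_def by (simp add: power2_eq_square)
    have "(1 - 2 * e) * (1 - 2 * e) = 1 + 4 * (e * e - e)" by (simp add: algebra_simps)
    then have sq: "(1 - 2 * e) * (1 - 2 * e) = 1 + 4 * (P * q * b)" unfolding e2 .
    have "(2 * e - 1) * ev h = P * ((1 - 2 * e) * z) - ((1 - 2 * e) * (1 - 2 * e)) * b"
      unfolding h by (simp add: algebra_simps)
    then have eh: "(2 * e - 1) * ev h = P * ((1 - 2 * e) * z) - (1 + 4 * (P * q * b)) * b" unfolding sq .
    have "ev g' ^ 2 - ev g' = (e * e - e) + P * q * ((2 * e - 1) * ev h) + P * q * (P * q) * ev h ^ 2"
      unfolding g' by (simp add: algebra_simps power2_eq_square)
    also have "\<dots> = P * (P * q) * (q * (ev h ^ 2 - 4 * b ^ 2) + (1 - 2 * e) * z)"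
      unfolding eh e2 by (simp add: algebra_simps power2_eq_square)
    finally show "ev g' ^ 2 - ev g' = P ^ Suc (Suc k) * b'" unfolding b'_def q_def by simp
    show "int p ^ Suc k dvd g' i - g i" for i unfolding g'_def by simp
  qed
qed

text \<open>The integer coefficients of the successive lifts converge in R. The limit e satisfies
  e^2 = e because e^2 - e is divisible by every power of P, and the only idempotents of a field are
  0 and 1.\<close>

lemma lift_idempotent:
  assumes "b \<in> Rx" "ev g ^ 2 - ev g = P * b"
  obtains e b' where "e \<in> {0, 1}" "b' \<in> Rx" "e - ev g = P * b'"
proof -
  define Q where "Q k g \<longleftrightarrow> (\<exists>b\<in>Rx. ev g ^ 2 - ev g = P ^ Suc k * b)" for k g
  have "\<exists>G. G 0 = g \<and> (\<forall>k. Q k (G k) \<and> (\<forall>i. int p ^ Suc k dvd G (Suc k) i - G k i))"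
  \<comment> \<open>The clause \<open>k = 0 \<longrightarrow> h = g\<close> pins the start of the
    sequence to the given \<open>g\<close>.\<close>
  proof (rule dependent_nat_choice[where P = "\<lambda>k h. Q k h \<and> (k = 0 \<longrightarrow> h = g)"
        and Q = "\<lambda>k h h'. \<forall>i. int p ^ Suc k dvd h' i - h i", THEN exE])
    show "\<exists>h. Q 0 h \<and> (0 = 0 \<longrightarrow> h = g)" using assms unfolding Q_def by auto
    show "\<exists>h'. (Q (Suc k) h' \<and> (Suc k = 0 \<longrightarrow> h' = g)) \<and> (\<forall>i. int p ^ Suc k dvd h' i - h i)"
      if "Q k h \<and> (k = 0 \<longrightarrow> h = g)" for h k
    proof -
      from that obtain b where b: "b \<in> Rx" "ev h ^ 2 - ev h = P ^ Suc k * b" unfolding Q_def by auto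
      obtain h' b' where "b' \<in> Rx" "ev h' ^ 2 - ev h' = P ^ Suc (Suc k) * b'"
          "\<forall>i. int p ^ Suc k dvd h' i - h i"
        using lift_idempotent_step[OF b] by blast
      then show ?thesis unfolding Q_def by (intro exI[of _ h']) auto
    qed
  qed auto
  then obtain G where G: "G 0 = g" "\<And>k. Q k (G k)" "\<And>k i. int p ^ Suc k dvd G (Suc k) i - G k i"
    by blast
  have "\<exists>r\<in>R. \<forall>k. \<exists>s\<in>R. r = of_int (G k i) + P ^ Suc k * s" for i
    using complete[of "\<lambda>k. G k i"] G(3) by blast
  then obtain r s where rs: "\<And>i. r i \<in> R" "\<And>i k. s i k \<in> R"
      "\<And>i k. r i = of_int (G k i) + P ^ Suc k * s i k"
    by metis
  define e where "e = (\<Sum>i<n. r i * x ^ i)"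
  define t where "t k = (\<Sum>i<n. s i k * x ^ i)" for k
  have e: "e \<in> Rx" unfolding e_def lin_span_def using rs(1) by auto
  have t: "t k \<in> Rx" for k unfolding t_def lin_span_def using rs(2) by auto
  have et: "e = ev (G k) + P ^ Suc k * t k" for k
  proof -
    have "e = (\<Sum>i<n. of_int (G k i) * x ^ i + P ^ Suc k * (s i k * x ^ i))"
      unfolding e_def by (rule sum.cong) (auto simp: rs(3)[of _ k] algebra_simps)
    then show ?thesis unfolding ev_def t_def by (simp add: sum.distrib sum_distrib_left)
  qed
  have "e * e - e = 0"
  proof (rule integral_infinitely_divisible)
    show "integral (e * e - e)" using e by (intro Rx_integral Rx_diff Rx_mult)
    fix k
    obtain b where b: "b \<in> Rx" "ev (G k) ^ 2 - ev (G k) = P ^ Suc k * b"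
      using G(2) unfolding Q_def by blast
    define w where "w = P * (b + (ev (G k) + e) * t k - t k)"
    have "e * e - e = P ^ k * w"
    proof -
      have "e * e - e = (ev (G k) ^ 2 - ev (G k)) + (e - ev (G k)) * (ev (G k) + e - 1)"
        by (simp add: algebra_simps power2_eq_square)
      also have "e - ev (G k) = P ^ Suc k * t k" using et[of k] by simp
      finally show ?thesis unfolding b(2) w_def by (simp add: algebra_simps)
    qed
    moreover have "w \<in> Rx" unfolding w_def
      by (intro Rx_mult Rx_diff lin_span_add ev_Rx Rx_of_mem[OF of_nat_mem] b(1) t e)
    ultimately show "\<exists>c. integral c \<and> e * e - e = P ^ k * c"
      by (intro exI[of _ w] conjI Rx_integral)
  qed
  then have "e * (e - 1) = 0" by (simp add: algebra_simps)
  then have "e \<in> {0, 1}" by auto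
  moreover have "e - ev g = P * t 0" using et[of 0] G(1) by simp
  ultimately show ?thesis by (rule that[OF _ t])
qed

text \<open>If x^N = 1 modulo P, then x^N and hence x is a unit. If x^N = 0 modulo P, then 1 - x^N
  is a unit and a multiple of 1 - x.\<close>

lemma unit_or_one_minus_unit_aux:
  "\<exists>w. integral w \<and> (w * x = 1 \<or> w * (1 - x) = 1)"
proof -
  obtain N b where N: "N > 0" "b \<in> Rx" "x ^ N - x ^ (2 * N) = P * b" using power_idempotent_mod_p .
  obtain g z where gz: "z \<in> Rx" "x ^ N = ev g + P * z" using Rx_digits[OF Rx_power] by metis
  \<comment> \<open>Idempotency modulo P passes from x^N to \<open>ev g\<close>, which differs from
    it by P z; \<open>b'\<close> is the resulting quotient.\<close>
  define b' where "b' = P * z ^ 2 + z - 2 * x ^ N * z - b"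
  have two: "(2 :: 'a) \<in> R" using of_nat_mem[of 2] by simp
  have "ev g ^ 2 - ev g = P * b'"
  proof -
    have "x ^ (2 * N) = (x ^ N) ^ 2" by (simp add: power_mult[symmetric] mult.commute)
    then have b: "x ^ N - (x ^ N) ^ 2 = P * b" using N(3) by simp
    have g: "ev g = x ^ N - P * z" using gz(2) by simp
    have "ev g ^ 2 - ev g = P * (P * z ^ 2 + z - 2 * x ^ N * z) - (x ^ N - (x ^ N) ^ 2)"
      unfolding g by (simp add: algebra_simps power2_eq_square)
    then show ?thesis unfolding b'_def b by (simp add: algebra_simps)
  qed
  moreover have "b' \<in> Rx" unfolding b'_def power2_eq_square
    by (intro lin_span_add Rx_diff Rx_mult Rx_power Rx_of_mem[OF two] Rx_of_mem[OF of_nat_mem] gz(1) N(2))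
  ultimately obtain e y where e: "e \<in> {0, 1}" "y \<in> Rx" "e - ev g = P * y"
    using lift_idempotent by blast
  have "ev g = e - P * y" unfolding e(3)[symmetric] by simp
  then have xN: "x ^ N = e - P * (y - z)" using gz(2) by (simp add: right_diff_distrib)
  show ?thesis
  proof (cases "e = 0")
    case True
    obtain w where w: "integral w" "w * (1 - P * (z - y)) = 1"
      using integral_unit_one_minus[OF Rx_integral[OF Rx_diff[OF gz(1) e(2)]]] .
    have "1 - x ^ N = 1 - P * (z - y)" using xN True by (simp add: right_diff_distrib)
    then have "w * ((1 - x) * (\<Sum>i<N. x ^ i)) = 1"
      using w(2) unfolding one_diff_power_eq by simp
    then have "w * (\<Sum>i<N. x ^ i) * (1 - x) = 1"
      by (simp only: mult.assoc mult.commute[of "1 - x"])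
    moreover have "integral (w * (\<Sum>i<N. x ^ i))"
      by (intro integral_add_mult(2) integral_sum integral_power x w(1))
    ultimately show ?thesis by metis
  next
    case False
    obtain w where w: "integral w" "w * (1 - P * (y - z)) = 1"
      using integral_unit_one_minus[OF Rx_integral[OF Rx_diff[OF e(2) gz(1)]]] .
    have "x ^ N = 1 - P * (y - z)" using e(1) False xN by simp
    then have "w * x ^ N = 1" using w(2) by simp
    then have "w * x ^ (N - 1) * x = 1" using N(1) by (cases N) (auto simp: mult_ac)
    moreover have "integral (w * x ^ (N - 1))"
      by (intro integral_add_mult(2) integral_power x w(1))
    ultimately show ?thesis by metis
  qed
qed

end

text \<open>This is locality in the form that makes the nonunits closed under addition: of two
  elements with sum 1, one is a unit.\<close>

theorem integral_closure_local:
  assumes "integral x"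
  shows "\<exists>w. integral w \<and> (w * x = 1 \<or> w * (1 - x) = 1)"
proof -
  obtain n c where c: "n > 0" "\<And>i. c i \<in> R" "x ^ n = (\<Sum>i<n. c i * x ^ i)"
    using integral_power_expand[OF assms] by metis
  show ?thesis using unit_or_one_minus_unit_aux[OF assms c] .
qed

end

section \<open>The p-adic absolute value\<close>

abbreviation cauchy :: "nat \<Rightarrow> (nat \<Rightarrow> rat) set" where
  "cauchy p \<equiv> carrier (padic_cauchy_ring p)"

context
  fixes p :: nat
  assumes p: "Factorial_Ring.prime p"
begin

lemma p_gt_1: "real p > 1" "p > 1"
  using p prime_gt_1_nat by auto

lemma prime_int_p: "prime_elem (int p)" "Factorial_Ring.prime (int p)"
  using p by auto

lemma padic_abs_zero [simp]: "padic_abs p 0 = 0"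
  by (simp add: padic_abs_def)

lemma padic_abs_nonneg: "padic_abs p x \<ge> 0"
  by (simp add: padic_abs_def)

lemma padic_abs_eq_0_iff [simp]: "padic_abs p x = 0 \<longleftrightarrow> x = 0"
  using p_gt_1 by (auto simp: padic_abs_def)

text \<open>\<open>quotient_of\<close> returns lowest terms. Cross multiplication and additivity of
  the multiplicity show that every other fraction gives the same exponent.\<close>

lemma padic_abs_fraction:
  assumes "a \<noteq> 0" "b \<noteq> 0"
  shows "padic_abs p (of_int a / of_int b) =
    real p powi (int (multiplicity (int p) b) - int (multiplicity (int p) a))"
proof -
  obtain c d where cd: "quotient_of (of_int a / of_int b) = (c, d)" by fastforce
  have eq: "of_int a / of_int b = (of_int c / of_int d :: rat)" by (rule quotient_of_div[OF cd])
  have d: "d \<noteq> 0" using quotient_of_denom_pos[OF cd] by simp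
  have c: "c \<noteq> 0" using eq assms d by auto
  have "of_int (a * d) = (of_int (c * b) :: rat)" using eq assms(2) d by (simp add: field_simps)
  then have "a * d = c * b" by (simp only: of_int_eq_iff)
  then have "multiplicity (int p) a + multiplicity (int p) d = multiplicity (int p) c + multiplicity (int p) b"
    using prime_elem_multiplicity_mult_distrib[OF prime_int_p(1), of a d]
      prime_elem_multiplicity_mult_distrib[OF prime_int_p(1), of c b] assms c d by simp
  then have "int (multiplicity (int p) d) - int (multiplicity (int p) c) =
      int (multiplicity (int p) b) - int (multiplicity (int p) a)"
    by linarith
  then show ?thesis using assms cd unfolding padic_abs_def by simp
qed

lemma padic_abs_mult: "padic_abs p (x * y) = padic_abs p x * padic_abs p y"
proof (cases "x = 0 \<or> y = 0")
  case False
  obtain a b where x: "quotient_of x = (a, b)" by fastforce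
  obtain c d where y: "quotient_of y = (c, d)" by fastforce
  have xy: "x = of_int a / of_int b" "y = of_int c / of_int d"
    using quotient_of_div x y by auto
  have nz: "a \<noteq> 0" "b \<noteq> 0" "c \<noteq> 0" "d \<noteq> 0"
    using xy False by auto
  have "x * y = of_int (a * c) / of_int (b * d)" unfolding xy by simp
  then have "padic_abs p (x * y) = real p powi ((int (multiplicity (int p) b) - int (multiplicity (int p) a)) +
      (int (multiplicity (int p) d) - int (multiplicity (int p) c)))"
    using padic_abs_fraction[of "a * c" "b * d"] nz prime_elem_multiplicity_mult_distrib[OF prime_int_p(1)]
    by (simp add: algebra_simps)
  also have "\<dots> = padic_abs p x * padic_abs p y"
    unfolding xy padic_abs_fraction[OF nz(1,2)] padic_abs_fraction[OF nz(3,4)]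
    using p_gt_1 by (intro power_int_add) auto
  finally show ?thesis .
qed auto

lemma padic_abs_one [simp]: "padic_abs p 1 = 1"
  using padic_abs_fraction[of 1 1] by simp

lemma padic_abs_minus [simp]: "padic_abs p (- x) = padic_abs p x"
proof -
  have "padic_abs p (- 1) = 1" using padic_abs_fraction[of "- 1" 1] by simp
  then show ?thesis using padic_abs_mult[of "- 1" x] by simp
qed

lemma padic_abs_minus_commute: "padic_abs p (x - y) = padic_abs p (y - x)"
  using padic_abs_minus[of "x - y"] by simp

text \<open>Over a common denominator the claim reduces to integers: a power of p that divides both
  summands divides the sum.\<close>

lemma padic_abs_ultrametric: "padic_abs p (x + y) \<le> max (padic_abs p x) (padic_abs p y)"
proof (cases "x = 0 \<or> y = 0 \<or> x + y = 0")
  case True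
  then show ?thesis using padic_abs_nonneg by (auto simp: le_max_iff_disj)
next
  case False
  obtain a b where x: "quotient_of x = (a, b)" by fastforce
  obtain c d where y: "quotient_of y = (c, d)" by fastforce
  have xy: "x = of_int a / of_int b" "y = of_int c / of_int d"
    using quotient_of_div x y by auto
  have nz: "a \<noteq> 0" "b \<noteq> 0" "c \<noteq> 0" "d \<noteq> 0"
    using xy False by auto
  define s t where "s = a * d" and "t = c * b"
  have x': "x = of_int s / of_int (b * d)" and y': "y = of_int t / of_int (b * d)"
    unfolding xy s_def t_def using nz by simp_all
  have xy': "x + y = of_int (s + t) / of_int (b * d)"
    unfolding x' y' by (simp add: add_divide_distrib)
  have "s + t \<noteq> 0"
  proof
    assume "s + t = 0"
    then show False using xy' False by simp
  qed
  then have nz': "s \<noteq> 0" "t \<noteq> 0" "b * d \<noteq> 0" "s + t \<noteq> 0"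
    using nz unfolding s_def t_def by auto
  define m where "m = min (multiplicity (int p) s) (multiplicity (int p) t)"
  have "int p ^ m dvd s" "int p ^ m dvd t" unfolding m_def by (auto intro: multiplicity_dvd')
  then have "int p ^ m dvd s + t" by simp
  then have "m \<le> multiplicity (int p) (s + t)"
    using nz'(4) p_gt_1 by (intro multiplicity_geI) auto
  then have "padic_abs p (x + y) \<le> real p powi (int (multiplicity (int p) (b * d)) - int m)"
    unfolding xy' padic_abs_fraction[OF nz'(4,3)] using p_gt_1 by (intro power_int_increasing) auto
  also have "\<dots> = max (padic_abs p x) (padic_abs p y)"
  proof -
    have "padic_abs p x \<le> real p powi (int (multiplicity (int p) (b * d)) - int m)"
      "padic_abs p y \<le> real p powi (int (multiplicity (int p) (b * d)) - int m)"
      unfolding x' y' padic_abs_fraction[OF nz'(1,3)] padic_abs_fraction[OF nz'(2,3)] m_def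
      using p_gt_1 by (auto intro!: power_int_increasing)
    moreover have "m = multiplicity (int p) s \<or> m = multiplicity (int p) t"
      unfolding m_def by auto
    then have "real p powi (int (multiplicity (int p) (b * d)) - int m) \<in> {padic_abs p x, padic_abs p y}"
      unfolding x' y' padic_abs_fraction[OF nz'(1,3)] padic_abs_fraction[OF nz'(2,3)] by auto
    ultimately show ?thesis by auto
  qed
  finally show ?thesis .
qed

lemma padic_abs_diff_ultrametric: "padic_abs p (x - y) \<le> max (padic_abs p x) (padic_abs p y)"
  using padic_abs_ultrametric[of x "- y"] by simp

lemma padic_abs_of_int_le: "padic_abs p (of_int a) \<le> 1"
proof (cases "a = 0")
  case False
  then have "padic_abs p (of_int a) = real p powi (- int (multiplicity (int p) a))"
    using padic_abs_fraction[of a 1] by simp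
  also have "\<dots> \<le> real p powi 0" using p_gt_1 by (intro power_int_increasing) auto
  finally show ?thesis by simp
qed simp

lemma padic_abs_p: "padic_abs p (of_nat p) = 1 / real p"
  using padic_abs_fraction[of "int p" 1] p_gt_1 p
  by (simp add: multiplicity_prime prime_int_p power_int_minus divide_inverse)

lemma padic_abs_power: "padic_abs p (x ^ n) = padic_abs p x ^ n"
  by (induction n) (auto simp: padic_abs_mult)

lemma padic_abs_divide: "padic_abs p (x / y) = padic_abs p x / padic_abs p y"
proof (cases "y = 0")
  case False
  then show ?thesis using padic_abs_mult[of "x / y" y] by (simp add: eq_divide_eq)
qed simp

text \<open>In an ultrametric triangle the two longest sides are equal.\<close>

lemma padic_abs_eq_of_less:
  assumes "padic_abs p (x - y) < padic_abs p y"
  shows "padic_abs p x = padic_abs p y"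
proof -
  have "padic_abs p x \<le> max (padic_abs p (x - y)) (padic_abs p y)"
    using padic_abs_ultrametric[of "x - y" y] by simp
  moreover have "padic_abs p y \<le> max (padic_abs p (x - y)) (padic_abs p x)"
    using padic_abs_diff_ultrametric[of x "x - y"] by (simp add: max.commute)
  ultimately show ?thesis using assms by linarith
qed

text \<open>A nonzero p-integral fraction m / n in lowest terms has n prime to p. With c an inverse
  of n modulo p, the integer m c is congruent to m / n.\<close>

lemma padic_approx_int:
  assumes "padic_abs p x \<le> 1"
  shows "\<exists>a :: int. padic_abs p (x - of_int a) \<le> 1 / real p"
proof (cases "x = 0")
  case True
  then show ?thesis using p_gt_1 by (intro exI[of _ 0]) simp
next
  case False
  obtain m n where mn: "quotient_of x = (m, n)" by fastforce
  have x: "x = of_int m / of_int n" by (rule quotient_of_div[OF mn])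
  have n: "n \<noteq> 0" "m \<noteq> 0" using x False by auto
  have "\<not> int p dvd n"
  proof
    assume dvd: "int p dvd n"
    then have "\<not> int p dvd m"
      using quotient_of_coprime[OF mn] prime_int_p(2) by (meson coprime_common_divisor not_prime_unit)
    then have "multiplicity (int p) m = 0" by (rule not_dvd_imp_multiplicity_0)
    moreover have "multiplicity (int p) n \<ge> 1"
      using dvd n p_gt_1 by (intro multiplicity_geI) auto
    ultimately have "real p powi 0 < padic_abs p x"
      unfolding x padic_abs_fraction[OF n(2,1)] using p_gt_1 by (intro power_int_strict_increasing) auto
    then show False using assms by simp
  qed
  then have "coprime (int p) n" using prime_int_p(2) by (simp add: prime_imp_coprime)
  then obtain k c where "k * int p + c * n = 1"
    using bezout_int[of "int p" n] by auto
  then have k: "1 - n * c = int p * k" by (simp add: algebra_simps)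
  have "x - of_int (m * c) = of_int m * of_int (1 - n * c) / of_int n"
    unfolding x using n by (simp add: field_simps)
  also have "\<dots> = of_nat p * (of_int (m * k) / of_int n)" unfolding k by simp
  finally have *: "x - of_int (m * c) = of_nat p * (of_int (m * k) / of_int n)" .
  have "padic_abs p (of_int n) = 1"
    using padic_abs_fraction[of n 1] n not_dvd_imp_multiplicity_0[OF \<open>\<not> int p dvd n\<close>] by simp
  then have "padic_abs p (of_int (m * k) / of_int n) \<le> 1"
    unfolding padic_abs_divide using padic_abs_of_int_le[of "m * k"] by simp
  then have "padic_abs p (x - of_int (m * c)) \<le> 1 / real p"
    unfolding * padic_abs_mult padic_abs_p using p_gt_1 by (simp add: field_simps)
  then show ?thesis by blast
qed

section \<open>Cauchy sequences\<close>

lemma cauchy_iff: "f \<in> cauchy p \<longleftrightarrow> (\<forall>e>0. \<exists>M. \<forall>m\<ge>M. \<forall>n\<ge>M. padic_abs p (f m - f n) < e)"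
  by (simp add: padic_cauchy_ring_def)

text \<open>The ultrametric inequality allows comparison with one fixed term in place of all
  pairs.\<close>

lemma cauchyI_one:
  assumes "\<And>e. e > 0 \<Longrightarrow> \<exists>M. \<forall>n\<ge>M. padic_abs p (f n - f M) < e"
  shows "f \<in> cauchy p"
  unfolding cauchy_iff
proof (intro allI impI)
  fix e :: real assume "e > 0"
  then obtain M where M: "\<And>n. n \<ge> M \<Longrightarrow> padic_abs p (f n - f M) < e" using assms by blast
  have "padic_abs p (f m - f n) < e" if "m \<ge> M" "n \<ge> M" for m n
    using padic_abs_diff_ultrametric[of "f m - f M" "f n - f M"] M[OF that(1)] M[OF that(2)] by simp
  then show "\<exists>M. \<forall>m\<ge>M. \<forall>n\<ge>M. padic_abs p (f m - f n) < e" by blast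
qed

lemma cauchy_const: "(\<lambda>_. c) \<in> cauchy p"
  by (simp add: cauchy_iff)

lemma cauchy_eventually_eq:
  assumes "f \<in> cauchy p" "\<And>n. n \<ge> N \<Longrightarrow> g n = f n"
  shows "g \<in> cauchy p"
  unfolding cauchy_iff
proof (intro allI impI)
  fix e :: real assume "e > 0"
  then obtain M where "\<forall>m\<ge>M. \<forall>n\<ge>M. padic_abs p (f m - f n) < e" using assms(1) unfolding cauchy_iff by blast
  then show "\<exists>M. \<forall>m\<ge>M. \<forall>n\<ge>M. padic_abs p (g m - g n) < e"
    using assms(2) by (intro exI[of _ "max M N"]) auto
qed

lemma cauchy_bounded:
  assumes "f \<in> cauchy p"
  obtains C where "C > 0" "\<And>n. padic_abs p (f n) \<le> C"
proof -
  obtain M where M: "\<And>m n. m \<ge> M \<Longrightarrow> n \<ge> M \<Longrightarrow> padic_abs p (f m - f n) < 1"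
    using assms[unfolded cauchy_iff, rule_format, of 1] by auto
  define C where "C = 1 + (\<Sum>n\<le>M. padic_abs p (f n))"
  have C: "C \<ge> 1" unfolding C_def using padic_abs_nonneg by (simp add: sum_nonneg)
  have small: "padic_abs p (f n) \<le> C" if "n \<le> M" for n
    using member_le_sum[of n "{..M}" "\<lambda>n. padic_abs p (f n)"] that padic_abs_nonneg unfolding C_def by simp
  have "padic_abs p (f n) \<le> C" for n
  proof (cases "n \<le> M")
    case False
    have "padic_abs p (f n) \<le> max (padic_abs p (f n - f M)) (padic_abs p (f M))"
      using padic_abs_ultrametric[of "f n - f M" "f M"] by simp
    then show ?thesis using M[of n M] False small[of M] C by linarith
  qed (rule small)
  then show ?thesis using C that[of C] by simp
qed

lemma cauchy_add:
  assumes "f \<in> cauchy p" "g \<in> cauchy p" shows "(\<lambda>n. f n + g n) \<in> cauchy p"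
  unfolding cauchy_iff
proof (intro allI impI)
  fix e :: real assume e: "e > 0"
  obtain M where M: "\<And>m n. m \<ge> M \<Longrightarrow> n \<ge> M \<Longrightarrow> padic_abs p (f m - f n) < e"
    using assms(1) e unfolding cauchy_iff by meson
  obtain N where N: "\<And>m n. m \<ge> N \<Longrightarrow> n \<ge> N \<Longrightarrow> padic_abs p (g m - g n) < e"
    using assms(2) e unfolding cauchy_iff by meson
  have "padic_abs p (f m + g m - (f n + g n)) < e" if "m \<ge> max M N" "n \<ge> max M N" for m n
    using padic_abs_ultrametric[of "f m - f n" "g m - g n"] M[of m n] N[of m n] that
    by (simp add: algebra_simps)
  then show "\<exists>M. \<forall>m\<ge>M. \<forall>n\<ge>M. padic_abs p (f m + g m - (f n + g n)) < e" by blast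
qed

lemma cauchy_mult:
  assumes "f \<in> cauchy p" "g \<in> cauchy p" shows "(\<lambda>n. f n * g n) \<in> cauchy p"
  unfolding cauchy_iff
proof (intro allI impI)
  fix e :: real assume e: "e > 0"
  obtain C where C: "C > 0" "\<And>n. padic_abs p (f n) \<le> C" using cauchy_bounded[OF assms(1)] by blast
  obtain D where D: "D > 0" "\<And>n. padic_abs p (g n) \<le> D" using cauchy_bounded[OF assms(2)] by blast
  obtain M where M: "\<And>m n. m \<ge> M \<Longrightarrow> n \<ge> M \<Longrightarrow> padic_abs p (f m - f n) < e / D"
    using assms(1) e D(1) unfolding cauchy_iff by (meson divide_pos_pos)
  obtain N where N: "\<And>m n. m \<ge> N \<Longrightarrow> n \<ge> N \<Longrightarrow> padic_abs p (g m - g n) < e / C"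
    using assms(2) e C(1) unfolding cauchy_iff by (meson divide_pos_pos)
  have "padic_abs p (f m * g m - f n * g n) < e" if mn: "m \<ge> max M N" "n \<ge> max M N" for m n
  proof -
    have "f m * g m - f n * g n = f m * (g m - g n) + g n * (f m - f n)" by (simp add: algebra_simps)
    then have "padic_abs p (f m * g m - f n * g n) \<le>
        max (padic_abs p (f m) * padic_abs p (g m - g n)) (padic_abs p (g n) * padic_abs p (f m - f n))"
      using padic_abs_ultrametric[of "f m * (g m - g n)" "g n * (f m - f n)"] by (simp add: padic_abs_mult)
    moreover have "padic_abs p (f m) * padic_abs p (g m - g n) < e"
    proof -
      have "padic_abs p (f m) * padic_abs p (g m - g n) \<le> C * padic_abs p (g m - g n)"
        using C(2) padic_abs_nonneg by (intro mult_right_mono)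
      also have "\<dots> < e" using N[of m n] mn C(1) by (simp add: field_simps)
      finally show ?thesis .
    qed
    moreover have "padic_abs p (g n) * padic_abs p (f m - f n) < e"
    proof -
      have "padic_abs p (g n) * padic_abs p (f m - f n) \<le> D * padic_abs p (f m - f n)"
        using D(2) padic_abs_nonneg by (intro mult_right_mono)
      also have "\<dots> < e" using M[of m n] mn D(1) by (simp add: field_simps)
      finally show ?thesis .
    qed
    ultimately show ?thesis by linarith
  qed
  then show "\<exists>M. \<forall>m\<ge>M. \<forall>n\<ge>M. padic_abs p (f m * g m - f n * g n) < e" by blast
qed

text \<open>Inversion is an isometry on numbers of absolute value 1.\<close>

lemma cauchy_inverse_of_unit:
  assumes "f \<in> cauchy p" "\<And>n. padic_abs p (f n) = 1"
  shows "(\<lambda>n. 1 / f n) \<in> cauchy p"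
proof -
  have "f n \<noteq> 0" for n using assms(2)[of n] by auto
  then have "1 / f m - 1 / f n = (f n - f m) / (f m * f n)" for m n by (simp add: diff_frac_eq)
  then have "padic_abs p (1 / f m - 1 / f n) = padic_abs p (f m - f n)" for m n
    by (simp add: padic_abs_divide padic_abs_mult assms(2) padic_abs_minus_commute)
  then show ?thesis using assms(1) unfolding cauchy_iff by simp
qed

lemma null_seqs_iff: "f \<in> padic_null_seqs p \<longleftrightarrow> (\<forall>e>0. \<exists>M. \<forall>n\<ge>M. padic_abs p (f n) < e)"
  unfolding padic_null_seqs_def using padic_abs_nonneg by (simp add: LIMSEQ_iff)

lemma null_seqs_subset: "padic_null_seqs p \<subseteq> cauchy p"
proof
  fix f assume f: "f \<in> padic_null_seqs p"
  show "f \<in> cauchy p" unfolding cauchy_iff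
  proof (intro allI impI)
    fix e :: real assume "e > 0"
    then obtain M where M: "\<And>n. n \<ge> M \<Longrightarrow> padic_abs p (f n) < e" using f unfolding null_seqs_iff by meson
    have "padic_abs p (f m - f n) < e" if "m \<ge> M" "n \<ge> M" for m n
      using padic_abs_diff_ultrametric[of "f m" "f n"] M[OF that(1)] M[OF that(2)] by simp
    then show "\<exists>M. \<forall>m\<ge>M. \<forall>n\<ge>M. padic_abs p (f m - f n) < e" by blast
  qed
qed

lemma null_seqs_eventually_zero: "(\<And>n. n \<ge> N \<Longrightarrow> f n = 0) \<Longrightarrow> f \<in> padic_null_seqs p"
  unfolding null_seqs_iff by (intro allI impI exI[of _ N]) auto

lemma null_seqs_mult:
  assumes "f \<in> padic_null_seqs p" "g \<in> cauchy p"
  shows "(\<lambda>n. g n * f n) \<in> padic_null_seqs p"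
  unfolding null_seqs_iff
proof (intro allI impI)
  fix e :: real assume e: "e > 0"
  obtain C where C: "C > 0" "\<And>n. padic_abs p (g n) \<le> C" using cauchy_bounded[OF assms(2)] by blast
  obtain M where M: "\<And>n. n \<ge> M \<Longrightarrow> padic_abs p (f n) < e / C"
    using assms(1) e C(1) unfolding null_seqs_iff by (meson divide_pos_pos)
  have "padic_abs p (g n * f n) < e" if "n \<ge> M" for n
  proof -
    have "padic_abs p (g n * f n) \<le> C * padic_abs p (f n)"
      unfolding padic_abs_mult using C(2) padic_abs_nonneg by (intro mult_right_mono)
    also have "\<dots> < e" using M[OF that] C(1) by (simp add: field_simps)
    finally show ?thesis .
  qed
  then show "\<exists>M. \<forall>n\<ge>M. padic_abs p (g n * f n) < e" by blast
qed

lemma null_seqs_add: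
  assumes "f \<in> padic_null_seqs p" "g \<in> padic_null_seqs p"
  shows "(\<lambda>n. f n + g n) \<in> padic_null_seqs p"
  unfolding null_seqs_iff
proof (intro allI impI)
  fix e :: real assume e: "e > 0"
  obtain M where M: "\<And>n. n \<ge> M \<Longrightarrow> padic_abs p (f n) < e" using assms(1) e unfolding null_seqs_iff by meson
  obtain N where N: "\<And>n. n \<ge> N \<Longrightarrow> padic_abs p (g n) < e" using assms(2) e unfolding null_seqs_iff by meson
  have "padic_abs p (f n + g n) < e" if "n \<ge> max M N" for n
    using padic_abs_ultrametric[of "f n" "g n"] M[of n] N[of n] that by simp
  then show "\<exists>M. \<forall>n\<ge>M. padic_abs p (f n + g n) < e" by blast
qed

section \<open>The ring of Cauchy sequences and its ideal of null sequences\<close>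

lemma cauchy_ring_simps [simp]:
  "f \<oplus>\<^bsub>padic_cauchy_ring p\<^esub> g = (\<lambda>n. f n + g n)" "f \<otimes>\<^bsub>padic_cauchy_ring p\<^esub> g = (\<lambda>n. f n * g n)"
  "\<zero>\<^bsub>padic_cauchy_ring p\<^esub> = (\<lambda>_. 0)" "\<one>\<^bsub>padic_cauchy_ring p\<^esub> = (\<lambda>_. 1)"
  by (simp_all add: padic_cauchy_ring_def)

lemma cauchy_uminus: "f \<in> cauchy p \<Longrightarrow> (\<lambda>n. - f n) \<in> cauchy p"
  using cauchy_mult[OF cauchy_const[of "- 1"], of f] by simp

lemma cring_cauchy: "cring (padic_cauchy_ring p)"
proof (rule cringI)
  show "abelian_group (padic_cauchy_ring p)"
  proof (rule abelian_groupI)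
    fix f assume "f \<in> cauchy p"
    then show "\<exists>g\<in>cauchy p. g \<oplus>\<^bsub>padic_cauchy_ring p\<^esub> f = \<zero>\<^bsub>padic_cauchy_ring p\<^esub>"
      by (intro bexI[OF _ cauchy_uminus]) auto
  qed (auto simp: cauchy_add cauchy_const algebra_simps)
  show "comm_monoid (padic_cauchy_ring p)"
    by (rule comm_monoidI) (auto simp: cauchy_mult cauchy_const algebra_simps)
qed (auto simp: algebra_simps)

lemma ideal_null_seqs: "ideal (padic_null_seqs p) (padic_cauchy_ring p)"
proof -
  interpret cring "padic_cauchy_ring p" by (rule cring_cauchy)
  have minus: "\<ominus>\<^bsub>padic_cauchy_ring p\<^esub> f = (\<lambda>n. - f n)" if "f \<in> cauchy p" for f
    using that by (intro minus_equality cauchy_uminus) auto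
  show ?thesis
  proof (rule idealI)
    show "subgroup (padic_null_seqs p) (add_monoid (padic_cauchy_ring p))"
    proof
      fix f assume f: "f \<in> padic_null_seqs p"
      then have "inv\<^bsub>add_monoid (padic_cauchy_ring p)\<^esub> f = (\<lambda>n. - f n)"
        using minus null_seqs_subset unfolding a_inv_def by auto
      then show "inv\<^bsub>add_monoid (padic_cauchy_ring p)\<^esub> f \<in> padic_null_seqs p"
        using null_seqs_mult[OF f cauchy_const[of "- 1"]] by simp
    qed (use null_seqs_subset null_seqs_add null_seqs_eventually_zero[of 0] in auto)
    fix f g assume f: "f \<in> padic_null_seqs p" "g \<in> cauchy p"
    then show "g \<otimes>\<^bsub>padic_cauchy_ring p\<^esub> f \<in> padic_null_seqs p"
      using null_seqs_mult by simp
    then show "f \<otimes>\<^bsub>padic_cauchy_ring p\<^esub> g \<in> padic_null_seqs p" by (simp add: mult.commute)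
  qed (rule ring_axioms)
qed

end

section \<open>The p-adic integers\<close>

text \<open>Integrality is demanded of every term, to match the representatives in
  \<open>Zp\<close>. Where an estimate holds only eventually, the proofs overwrite an initial
  segment by 0 or 1.\<close>

definition padic_unit_ball :: "nat \<Rightarrow> (nat \<Rightarrow> rat) set" where
  "padic_unit_ball p = {f \<in> cauchy p. \<forall>n. padic_abs p (f n) \<le> 1}"

context
  fixes p :: nat and \<theta> :: "(nat \<Rightarrow> rat) \<Rightarrow> 'a::field"
  assumes p: "Factorial_Ring.prime p"
    and theta_add: "\<And>f g. f \<in> cauchy p \<Longrightarrow> g \<in> cauchy p \<Longrightarrow>
      \<theta> (\<lambda>n. f n + g n) = \<theta> f + \<theta> g"
    and theta_mult: "\<And>f g. f \<in> cauchy p \<Longrightarrow> g \<in> cauchy p \<Longrightarrow>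
      \<theta> (\<lambda>n. f n * g n) = \<theta> f * \<theta> g"
    and theta_one: "\<theta> (\<lambda>_. 1) = 1"
    and theta_null: "\<And>f. f \<in> padic_null_seqs p \<Longrightarrow> \<theta> f = 0"
begin

lemmas const = cauchy_const[OF p]

text \<open>\<open>\<theta>\<close> is a ring homomorphism on Cauchy sequences that kills null
  sequences. Arguing with it instead of with cosets allows identities to be checked term by term,
  and only from some index on.\<close>

lemma theta_eventually_eq:
  assumes "f \<in> cauchy p" "g \<in> cauchy p" "\<And>n. n \<ge> N \<Longrightarrow> f n = g n"
  shows "\<theta> f = \<theta> g"
proof -
  have null: "(\<lambda>n. f n - g n) \<in> padic_null_seqs p"
    by (rule null_seqs_eventually_zero[OF p, of N]) (simp add: assms(3))
  have "\<theta> f = \<theta> (\<lambda>n. g n + (f n - g n))" by simp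
  also have "\<dots> = \<theta> g + \<theta> (\<lambda>n. f n - g n)"
    by (rule theta_add[OF assms(2)]) (use null null_seqs_subset[OF p] in auto)
  finally show ?thesis using theta_null[OF null] by simp
qed

lemma theta_uminus: "f \<in> cauchy p \<Longrightarrow> \<theta> (\<lambda>n. - f n) = - \<theta> f"
  using theta_add[OF _ cauchy_uminus[OF p], of f f] theta_null[OF null_seqs_eventually_zero[OF p, of 0 "\<lambda>_. 0"]]
  by (simp add: add_eq_0_iff)

lemma theta_of_nat: "\<theta> (\<lambda>_. of_nat n) = of_nat n"
proof (induction n)
  case 0
  then show ?case using theta_null[OF null_seqs_eventually_zero[OF p, of 0 "\<lambda>_. 0"]] by simp
next
  case (Suc n)
  then show ?case using theta_add[OF const const, of 1 "of_nat n"] theta_one by simp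
qed

lemma theta_of_int: "\<theta> (\<lambda>_. of_int a) = of_int a"
proof (cases a rule: int_cases)
  case (neg n)
  then show ?thesis using theta_uminus[OF const, of "of_nat (Suc n)"] theta_of_nat[of "Suc n"] by simp
qed (simp add: theta_of_nat)

lemma theta_p_power: "\<theta> (\<lambda>_. of_nat p ^ k) = of_nat p ^ k"
  using theta_of_nat[of "p ^ k"] by simp

lemma theta_congruent_int:
  assumes f: "f \<in> cauchy p" and close: "\<And>n. n \<ge> N \<Longrightarrow> padic_abs p (f n - of_int a) \<le> (1 / real p) ^ k"
  shows "\<exists>s\<in>\<theta> ` padic_unit_ball p. \<theta> f = of_int a + of_nat p ^ k * s"
proof -
  \<comment> \<open>This is (f - a) / p^k, p-integral from \<open>N\<close> on; the default 0 keeps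
    the earlier terms in the unit ball.\<close>
  define g where "g n = (if n \<ge> N then (f n + (- of_int a)) * (1 / of_nat p ^ k) else 0)" for n
  have p0: "p > 0" using p_gt_1[OF p] by simp
  have pk: "padic_abs p (1 / of_nat p ^ k) = real p ^ k"
    by (simp add: padic_abs_divide[OF p] padic_abs_power[OF p] padic_abs_p[OF p] padic_abs_one[OF p] power_one_over)
  have "padic_abs p (g n) \<le> 1" for n
  proof (cases "n \<ge> N")
    case True
    then have "padic_abs p (g n) = padic_abs p (f n - of_int a) * real p ^ k"
      unfolding g_def by (simp only: padic_abs_mult[OF p] pk if_True add_uminus_conv_diff)
    also have "\<dots> \<le> (1 / real p) ^ k * real p ^ k" using close[OF True] by (intro mult_right_mono) auto
    also have "\<dots> = 1" using p0 by (simp add: power_one_over)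
    finally show ?thesis .
  qed (simp add: g_def padic_abs_zero[OF p])
  moreover have g: "g \<in> cauchy p"
  proof (rule cauchy_eventually_eq[OF p])
    show "(\<lambda>n. (f n + (- of_int a)) * (1 / of_nat p ^ k)) \<in> cauchy p"
      by (intro cauchy_mult[OF p] cauchy_add[OF p] f const)
    show "g n = (f n + (- of_int a)) * (1 / of_nat p ^ k)" if "n \<ge> N" for n
      using that unfolding g_def by simp
  qed
  ultimately have "g \<in> padic_unit_ball p" unfolding padic_unit_ball_def by blast
  moreover have "\<theta> f = of_int a + of_nat p ^ k * \<theta> g"
  proof -
    have pg: "(\<lambda>n. of_nat p ^ k * g n) \<in> cauchy p" by (intro cauchy_mult[OF p] const g)
    have "\<theta> f = \<theta> (\<lambda>n. of_int a + of_nat p ^ k * g n)"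
    proof (rule theta_eventually_eq[OF f])
      show "(\<lambda>n. of_int a + of_nat p ^ k * g n) \<in> cauchy p" by (intro cauchy_add[OF p] const pg)
      show "f n = of_int a + of_nat p ^ k * g n" if "n \<ge> N" for n
        using that p0 unfolding g_def by simp
    qed
    also have "\<dots> = \<theta> (\<lambda>_. of_int a) + \<theta> (\<lambda>_. of_nat p ^ k) * \<theta> g"
      by (simp only: theta_add[OF const pg] theta_mult[OF const g])
    finally show ?thesis unfolding theta_of_int theta_p_power .
  qed
  ultimately show ?thesis by blast
qed

lemma theta_unit_inverse:
  assumes "f \<in> cauchy p" "\<And>n. padic_abs p (f n) = 1"
  shows "\<exists>u\<in>\<theta> ` padic_unit_ball p. u * \<theta> f = 1"
proof -
  define h where "h n = 1 / f n" for n
  have f0: "f n \<noteq> 0" for n using assms(2)[of n] padic_abs_zero[OF p] by auto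
  have h: "h \<in> cauchy p" unfolding h_def by (rule cauchy_inverse_of_unit[OF p assms])
  moreover have "padic_abs p (h n) \<le> 1" for n
    unfolding h_def by (simp add: padic_abs_divide[OF p] assms(2) padic_abs_one[OF p])
  ultimately have "h \<in> padic_unit_ball p" unfolding padic_unit_ball_def by blast
  moreover have "\<theta> h * \<theta> f = 1"
    unfolding theta_mult[OF h assms(1), symmetric] by (simp add: h_def f0 theta_one)
  ultimately show ?thesis by blast
qed

text \<open>A Cauchy sequence that is not null has eventually constant absolute value, here p^-k
  with k \<ge> 0, and dividing it by p^k leaves a unit.\<close>

lemma theta_power_of_p:
  assumes f: "f \<in> padic_unit_ball p" and "\<theta> f \<noteq> 0"
  shows "\<exists>k. \<exists>u\<in>\<theta> ` padic_unit_ball p. u * \<theta> f = of_nat p ^ k"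
proof -
  have fC: "f \<in> cauchy p" and f1: "\<And>n. padic_abs p (f n) \<le> 1" using f unfolding padic_unit_ball_def by auto
  have p0: "p > 0" using p_gt_1[OF p] by simp
  have "f \<notin> padic_null_seqs p" using theta_null assms(2) by blast
  then obtain e where e: "e > 0" "\<And>M. \<exists>n\<ge>M. padic_abs p (f n) \<ge> e"
    unfolding null_seqs_iff[OF p] by (meson not_le)
  obtain M where M: "\<forall>m\<ge>M. \<forall>n\<ge>M. padic_abs p (f m - f n) < e"
    using fC e(1) unfolding cauchy_iff[OF p] by blast
  obtain N where N: "N \<ge> M" "padic_abs p (f N) \<ge> e" using e(2) by blast
  have eq: "padic_abs p (f n) = padic_abs p (f N)" if "n \<ge> M" for n
    by (rule padic_abs_eq_of_less[OF p]) (use M that N in \<open>meson less_le_trans\<close>)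
  have fN: "f N \<noteq> 0" using N e(1) padic_abs_zero[OF p] by auto
  then obtain j :: int where j: "padic_abs p (f N) = real p powi j"
    unfolding padic_abs_def by auto
  have "j \<le> 0"
  proof (rule ccontr)
    assume "\<not> j \<le> 0"
    then have "real p powi 0 < real p powi j"
      using p_gt_1[OF p] by (intro power_int_strict_increasing) auto
    then show False using f1[of N] j by simp
  qed
  then have "padic_abs p (f N) = (1 / real p) ^ nat (- j)"
    unfolding j by (auto simp: power_int_def divide_inverse)
  then obtain k where k: "padic_abs p (f N) = (1 / real p) ^ k" ..
  \<comment> \<open>The default is 1 and not 0, since termwise inversion requires absolute value 1
    at every index.\<close>
  define h where "h n = (if n \<ge> M then 1 / of_nat p ^ k * f n else 1)" for n
  have pk: "padic_abs p (1 / of_nat p ^ k) = real p ^ k"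
    by (simp add: padic_abs_divide[OF p] padic_abs_power[OF p] padic_abs_p[OF p] padic_abs_one[OF p] power_one_over)
  have h1: "padic_abs p (h n) = 1" for n
  proof (cases "n \<ge> M")
    case True
    then have "padic_abs p (h n) = real p ^ k * padic_abs p (f n)"
      unfolding h_def by (simp only: padic_abs_mult[OF p] pk if_True)
    then show ?thesis using eq[OF True] k p0 by (simp add: power_one_over)
  qed (simp add: h_def padic_abs_one[OF p])
  have hC: "h \<in> cauchy p"
  proof (rule cauchy_eventually_eq[OF p])
    show "(\<lambda>n. 1 / of_nat p ^ k * f n) \<in> cauchy p" by (intro cauchy_mult[OF p] const fC)
    show "h n = 1 / of_nat p ^ k * f n" if "n \<ge> M" for n using that unfolding h_def by simp
  qed
  obtain u where u: "u \<in> \<theta> ` padic_unit_ball p" "u * \<theta> h = 1" using theta_unit_inverse[OF hC h1] by blast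
  have "\<theta> f = \<theta> (\<lambda>n. of_nat p ^ k * h n)"
  proof (rule theta_eventually_eq[OF fC])
    show "(\<lambda>n. of_nat p ^ k * h n) \<in> cauchy p" by (intro cauchy_mult[OF p] const hC)
    show "f n = of_nat p ^ k * h n" if "n \<ge> M" for n using that p0 unfolding h_def by simp
  qed
  also have "\<dots> = of_nat p ^ k * \<theta> h" using theta_mult[OF const hC] theta_p_power by simp
  finally have "u * \<theta> f = of_nat p ^ k" using u(2) by (simp add: mult.left_commute)
  then show ?thesis using u(1) by blast
qed

lemma integer_sequence_congruent:
  fixes a :: "nat \<Rightarrow> int"
  assumes "\<And>k. int p ^ Suc k dvd a (Suc k) - a k" "n \<ge> k"
  shows "int p ^ Suc k dvd a n - a k"
  using assms(2)
proof (induction n rule: dec_induct)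
  case (step n)
  have "int p ^ Suc k dvd int p ^ Suc n" using step(1) by (intro le_imp_power_dvd) simp
  then have "int p ^ Suc k dvd a (Suc n) - a n" using assms(1)[of n] by (rule dvd_trans)
  then have "int p ^ Suc k dvd (a (Suc n) - a n) + (a n - a k)" using step.IH by (rule dvd_add)
  then show ?case by simp
qed simp

lemma padic_abs_of_int_dvd:
  assumes "int p ^ k dvd a"
  shows "padic_abs p (of_int a) \<le> (1 / real p) ^ k"
proof -
  obtain b where "a = int p ^ k * b" using assms by blast
  then have "padic_abs p (of_int a) = (1 / real p) ^ k * padic_abs p (of_int b)"
    by (simp add: padic_abs_mult[OF p] padic_abs_power[OF p] padic_abs_p[OF p])
  also have "\<dots> \<le> (1 / real p) ^ k"
    using padic_abs_of_int_le[OF p, of b] by (intro mult_left_le) auto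
  finally show ?thesis .
qed

theorem complete_dvr_theta: "complete_dvr (\<theta> ` padic_unit_ball p) p"
proof
  have p1: "real p > 1" using p_gt_1[OF p] by simp
  show "0 \<in> \<theta> ` padic_unit_ball p"
    using theta_of_int[of 0] const padic_abs_zero[OF p] unfolding padic_unit_ball_def
    by (intro image_eqI[of _ _ "\<lambda>_. 0"]) auto
  show "1 \<in> \<theta> ` padic_unit_ball p"
    using theta_one const padic_abs_one[OF p] unfolding padic_unit_ball_def
    by (intro image_eqI[of _ _ "\<lambda>_. 1"]) auto
  fix x assume "x \<in> \<theta> ` padic_unit_ball p"
  then obtain f where f: "x = \<theta> f" "f \<in> cauchy p" "\<And>n. padic_abs p (f n) \<le> 1" unfolding padic_unit_ball_def by auto
  show "- x \<in> \<theta> ` padic_unit_ball p"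
    using f theta_uminus[OF f(2)] cauchy_uminus[OF p f(2)] padic_abs_minus[OF p] unfolding padic_unit_ball_def
    by (intro image_eqI[of _ _ "\<lambda>n. - f n"]) auto
  show "\<exists>u\<in>\<theta> ` padic_unit_ball p. u * (1 + of_nat p * x) = 1"
  proof -
    have pf: "(\<lambda>n. of_nat p * f n) \<in> cauchy p" by (intro cauchy_mult[OF p] const f(2))
    have "padic_abs p (1 + of_nat p * f n) = 1" for n
    proof -
      have "padic_abs p (of_nat p * f n) \<le> 1 / real p"
        unfolding padic_abs_mult[OF p] padic_abs_p[OF p] using f(3)[of n] p1 by (simp add: field_simps)
      also have "\<dots> < padic_abs p 1" using p1 padic_abs_one[OF p] by simp
      finally show ?thesis
        using padic_abs_eq_of_less[OF p, of "1 + of_nat p * f n" 1] padic_abs_one[OF p] by simp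
    qed
    moreover have "(\<lambda>n. 1 + of_nat p * f n) \<in> cauchy p" by (intro cauchy_add[OF p] const pf)
    moreover have "\<theta> (\<lambda>n. 1 + of_nat p * f n) = 1 + of_nat p * x"
      using theta_add[OF const pf] theta_mult[OF const f(2), of "of_nat p"] theta_one theta_of_nat f(1) by simp
    ultimately show ?thesis using theta_unit_inverse by metis
  qed
  show "\<exists>a s. s \<in> \<theta> ` padic_unit_ball p \<and> x = of_int a + of_nat p * s"
  proof -
    \<comment> \<open>Beyond \<open>M\<close> the sequence moves by less than 1/p, so an integer
      close to \<open>f M\<close> is close to the whole tail.\<close>
    obtain M where M: "\<forall>m\<ge>M. \<forall>n\<ge>M. padic_abs p (f m - f n) < 1 / real p"
      using f(2)[unfolded cauchy_iff[OF p], rule_format, of "1 / real p"] p1 by auto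
    obtain a where a: "padic_abs p (f M - of_int a) \<le> 1 / real p"
      using padic_approx_int[OF p f(3)] by blast
    have "padic_abs p (f n - of_int a) \<le> (1 / real p) ^ 1" if "n \<ge> M" for n
      using padic_abs_ultrametric[OF p, of "f n - f M" "f M - of_int a"] M[rule_format, OF that order_refl] a
      by simp
    then show ?thesis using theta_congruent_int[OF f(2), of M a 1] f(1) by auto
  qed
  show "\<exists>k. \<exists>u\<in>\<theta> ` padic_unit_ball p. u * x = of_nat p ^ k" if "x \<noteq> 0"
    using theta_power_of_p[of f] that f unfolding padic_unit_ball_def by auto
  fix y assume "y \<in> \<theta> ` padic_unit_ball p"
  then obtain g where g: "y = \<theta> g" "g \<in> cauchy p" "\<And>n. padic_abs p (g n) \<le> 1" unfolding padic_unit_ball_def by auto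
  have "padic_abs p (f n + g n) \<le> 1" for n
    using padic_abs_ultrametric[OF p, of "f n" "g n"] f(3)[of n] g(3)[of n] by simp
  then show "x + y \<in> \<theta> ` padic_unit_ball p"
    using f g theta_add[OF f(2) g(2)] cauchy_add[OF p f(2) g(2)] unfolding padic_unit_ball_def
    by (intro image_eqI[of _ _ "\<lambda>n. f n + g n"]) auto
  have "padic_abs p (f n * g n) \<le> 1" for n
    unfolding padic_abs_mult[OF p] using f(3)[of n] g(3)[of n] padic_abs_nonneg[OF p]
    by (simp add: mult_le_one)
  then show "x * y \<in> \<theta> ` padic_unit_ball p"
    using f g theta_mult[OF f(2) g(2)] cauchy_mult[OF p f(2) g(2)] unfolding padic_unit_ball_def
    by (intro image_eqI[of _ _ "\<lambda>n. f n * g n"]) auto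
next
  have "\<theta> (\<lambda>_. 1 / of_nat p) * \<theta> (\<lambda>_. of_nat p) = 1"
    using theta_mult[OF const const, of "1 / of_nat p" "of_nat p"] theta_one p_gt_1[OF p] by simp
  then show "(of_nat p :: 'a) \<noteq> 0" unfolding theta_of_nat by auto
next
  fix a :: "nat \<Rightarrow> int"
  assume step: "\<And>k. int p ^ Suc k dvd a (Suc k) - a k"
  define f :: "nat \<Rightarrow> rat" where "f n = of_int (a n)" for n
  have close: "padic_abs p (f n - of_int (a k)) \<le> (1 / real p) ^ Suc k" if "n \<ge> k" for n k
    using padic_abs_of_int_dvd[OF integer_sequence_congruent[OF step that]] unfolding f_def by simp
  have f: "f \<in> cauchy p"
  proof (rule cauchyI_one[OF p])
    fix e :: real assume "e > 0"
    then obtain M where M: "(1 / real p) ^ M < e"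
      using real_arch_pow_inv[of e "1 / real p"] p_gt_1[OF p] by auto
    have "padic_abs p (f n - f M) < e" if "n \<ge> M" for n
    proof -
      have "padic_abs p (f n - f M) \<le> (1 / real p) ^ Suc M" using close[OF that] unfolding f_def .
      also have "\<dots> \<le> (1 / real p) ^ M" using p_gt_1[OF p] by (intro power_decreasing) auto
      finally show ?thesis using M by simp
    qed
    then show "\<exists>M. \<forall>n\<ge>M. padic_abs p (f n - f M) < e" by blast
  qed
  then have "f \<in> padic_unit_ball p" unfolding padic_unit_ball_def f_def using padic_abs_of_int_le[OF p] by simp
  moreover have "\<exists>s\<in>\<theta> ` padic_unit_ball p. \<theta> f = of_int (a k) + of_nat p ^ Suc k * s" for k
    by (rule theta_congruent_int[OF f, of k]) (rule close)
  ultimately show "\<exists>r\<in>\<theta> ` padic_unit_ball p. \<forall>k. \<exists>s\<in>\<theta> ` padic_unit_ball p. r = of_int (a k) + of_nat p ^ Suc k * s" by blast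
qed

end

text \<open>A coset that contains a p-integral sequence is represented by that sequence.\<close>

lemma Zp_image_eq:
  assumes p: "Factorial_Ring.prime p"
  shows "Zp p = (\<lambda>f. padic_null_seqs p +>\<^bsub>padic_cauchy_ring p\<^esub> f) `
    padic_unit_ball p"
proof -
  interpret ideal "padic_null_seqs p" "padic_cauchy_ring p" by (rule ideal_null_seqs[OF p])
  have carr: "carrier (Qp p) = (\<lambda>f. padic_null_seqs p +>\<^bsub>padic_cauchy_ring p\<^esub> f) ` cauchy p"
    unfolding Qp_def FactRing_def A_RCOSETS_def' by auto
  show ?thesis
  proof (intro equalityI subsetI)
    fix x assume "x \<in> Zp p"
    then obtain f g where fg: "f \<in> cauchy p" "x = padic_null_seqs p +>\<^bsub>padic_cauchy_ring p\<^esub> f"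
        "g \<in> x" "\<forall>n. padic_abs p (g n) \<le> 1"
      unfolding Zp_def carr by auto
    have "g \<in> cauchy p" using fg a_r_coset_subset_G[OF a_subset fg(1)] by auto
    moreover have "x = padic_null_seqs p +>\<^bsub>padic_cauchy_ring p\<^esub> g"
      unfolding fg(2) by (rule a_repr_independence[OF _ fg(1)]) (use fg a_subgroup in auto)
    ultimately show "x \<in> (\<lambda>f. padic_null_seqs p +>\<^bsub>padic_cauchy_ring p\<^esub> f) `
        padic_unit_ball p"
      using fg(4) unfolding padic_unit_ball_def by auto
  next
    fix x assume "x \<in> (\<lambda>f. padic_null_seqs p +>\<^bsub>padic_cauchy_ring p\<^esub> f) `
        padic_unit_ball p"
    then show "x \<in> Zp p" unfolding Zp_def carr padic_unit_ball_def using a_rcos_self by auto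
  qed
qed

text \<open>The quotient map followed by \<open>to_ac \<circ> \<iota>\<close> is a homomorphism on
  Cauchy sequences that vanishes on null sequences, so it can serve as
  \<open>\<theta>\<close>.\<close>

theorem complete_dvr_Zp:
  fixes \<iota> :: "(nat \<Rightarrow> rat) set \<Rightarrow> 'f::field"
  assumes p: "Factorial_Ring.prime p" and \<iota>: "finite_extension_of_Qp p \<iota>"
  shows "complete_dvr ((to_ac \<circ> \<iota>) ` Zp p) p"
proof -
  define \<theta> where "\<theta> f = to_ac (\<iota> (padic_null_seqs p +>\<^bsub>padic_cauchy_ring p\<^esub> f))" for f
  interpret ideal "padic_null_seqs p" "padic_cauchy_ring p" by (rule ideal_null_seqs[OF p])
  have "\<iota> \<in> Ring.ring_hom (Qp p) ring_of_type_algebra" using \<iota> unfolding finite_extension_of_Qp_def by simp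
  then have "\<iota> \<circ> (\<lambda>f. padic_null_seqs p +>\<^bsub>padic_cauchy_ring p\<^esub> f) \<in> Ring.ring_hom (padic_cauchy_ring p) ring_of_type_algebra"
    using Ring.ring_hom_trans[OF rcos_ring_hom] unfolding Qp_def by blast
  note hom = this
  have "\<theta> (\<lambda>n. f n + g n) = \<theta> f + \<theta> g"
    if "f \<in> cauchy p" "g \<in> cauchy p" for f g
    using Ring.ring_hom_add[OF hom that] unfolding \<theta>_def
    by (simp add: cauchy_ring_simps[OF p] ring_of_type_algebra_def)
  moreover have "\<theta> (\<lambda>n. f n * g n) = \<theta> f * \<theta> g"
    if "f \<in> cauchy p" "g \<in> cauchy p" for f g
    using Ring.ring_hom_mult[OF hom that] unfolding \<theta>_def
    by (simp add: cauchy_ring_simps[OF p] ring_of_type_algebra_def)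
  moreover have "\<theta> (\<lambda>_. 1) = 1"
    using Ring.ring_hom_one[OF hom] unfolding \<theta>_def
    by (simp add: cauchy_ring_simps[OF p] ring_of_type_algebra_def)
  moreover have "\<theta> f = 0" if f: "f \<in> padic_null_seqs p" for f
  proof -
    have "\<theta> f = \<theta> (\<lambda>_. 0)"
      unfolding \<theta>_def a_rcos_const[OF f] a_rcos_const[OF null_seqs_eventually_zero[OF p, of 0 "\<lambda>_. 0", OF refl]] ..
    also have "\<dots> = 0"
      using Ring.ring_hom_zero[OF hom ring_axioms ring_from_type_algebra] unfolding \<theta>_def
      by (simp add: cauchy_ring_simps[OF p] ring_of_type_algebra_def)
    finally show ?thesis .
  qed
  ultimately have "complete_dvr (\<theta> ` padic_unit_ball p) p" using complete_dvr_theta[OF p] by blast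
  moreover have "\<theta> ` padic_unit_ball p = (to_ac \<circ> \<iota>) ` Zp p"
    unfolding Zp_image_eq[OF p] \<theta>_def image_image comp_def ..
  ultimately show ?thesis by simp
qed

hide_const (open) Determinant.det Matrix.mat Matrix.vec
no_notation vec_index (infixl "$" 100)
no_notation fps_nth (infixl "$" 75)

section \<open>Automorphisms of the algebraic closure\<close>

lemma Fbar_simps [simp]:
  "carrier (ring_of_type_algebra :: 'a::field ring) = UNIV"
  "x \<oplus>\<^bsub>(ring_of_type_algebra :: 'a ring)\<^esub> y = x + y" "x \<otimes>\<^bsub>(ring_of_type_algebra :: 'a ring)\<^esub> y = x * y"
  "\<one>\<^bsub>(ring_of_type_algebra :: 'a ring)\<^esub> = 1" "\<zero>\<^bsub>(ring_of_type_algebra :: 'a ring)\<^esub> = 0"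
  by (simp_all add: ring_of_type_algebra_def)

lemma Fbar_a_inv: "\<ominus>\<^bsub>(ring_of_type_algebra :: 'a::field ring)\<^esub> x = - x"
proof -
  interpret ring "ring_of_type_algebra :: 'a ring" by (rule ring_from_type_algebra)
  show ?thesis by (rule minus_equality) auto
qed

lemma Fbar_m_inv: "x \<noteq> 0 \<Longrightarrow> inv\<^bsub>(ring_of_type_algebra :: 'a::field ring)\<^esub> x = inverse x"
proof -
  assume "x \<noteq> 0"
  interpret ring "ring_of_type_algebra :: 'a ring" by (rule ring_from_type_algebra)
  show ?thesis by (rule inv_char) (use \<open>x \<noteq> 0\<close> in auto)
qed

lemma subfield_base_field: "subfield (base_field :: 'f::field alg_closure set) Fbar"
proof -
  interpret field "Fbar :: 'f alg_closure ring" by (rule field_from_type_algebra)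
  show ?thesis
  proof (rule subfieldI')
    show "subring (base_field :: 'f alg_closure set) Fbar"
    proof (rule subringI)
      fix x y :: "'f alg_closure" assume "x \<in> base_field" "y \<in> base_field"
      then obtain a b :: 'f where ab: "x = to_ac a" "y = to_ac b" unfolding base_field_def by blast
      show "\<ominus>\<^bsub>Fbar\<^esub> x \<in> base_field"
        unfolding Fbar_a_inv ab base_field_def by (metis rangeI to_ac_minus)
      show "x \<otimes>\<^bsub>Fbar\<^esub> y \<in> base_field"
        unfolding ab base_field_def by (simp flip: to_ac_mult)
      show "x \<oplus>\<^bsub>Fbar\<^esub> y \<in> base_field"
        unfolding ab base_field_def by (simp flip: to_ac_add)
    qed (auto simp: base_field_def intro: range_eqI[of _ _ 1])
    fix x :: "'f alg_closure" assume "x \<in> base_field - {\<zero>\<^bsub>Fbar\<^esub>}"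
    then obtain a where "x = to_ac a" "x \<noteq> 0" unfolding base_field_def by auto
    then show "inv\<^bsub>Fbar\<^esub> x \<in> base_field"
      unfolding base_field_def by (simp add: Fbar_m_inv flip: to_ac_inverse)
  qed
qed

lemma finite_subextension_base_field: "finite_subextension (base_field :: 'f::field alg_closure set)"
proof -
  interpret field "Fbar :: 'f alg_closure ring" by (rule field_from_type_algebra)
  show ?thesis
    unfolding finite_subextension_def
    using subfield_base_field finite_dimensionI[OF dimension_one[OF subfield_base_field]] by blast
qed

lemma galois_group_simps [simp]:
  "x \<otimes>\<^bsub>galois_group K\<^esub> y = x \<circ> y" "\<one>\<^bsub>galois_group K\<^esub> = id"
  by (simp_all add: galois_group_def)

lemma mem_galois_group_iff:
  "\<sigma> \<in> carrier (galois_group K) \<longleftrightarrow> bij \<sigma> \<and> (\<forall>x y. \<sigma> (x + y) = \<sigma> x + \<sigma> y) \<and>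
     (\<forall>x y. \<sigma> (x * y) = \<sigma> x * \<sigma> y) \<and> \<sigma> 1 = 1 \<and> (\<forall>x\<in>K. \<sigma> x = x)"
  by (auto simp: galois_group_def ring_iso_def Ring.ring_hom_def)

lemma galois_group_inv_mem:
  assumes "\<sigma> \<in> carrier (galois_group K)"
  shows "Hilbert_Choice.inv \<sigma> \<in> carrier (galois_group K)"
proof -
  note s = assms[unfolded mem_galois_group_iff]
  have b: "bij \<sigma>" using s by simp
  have eqI: "Hilbert_Choice.inv \<sigma> y = x" if "\<sigma> x = y" for x y
    using that b by (metis bij_inv_eq_iff)
  have si: "\<sigma> (Hilbert_Choice.inv \<sigma> y) = y" for y using b by (simp add: bij_is_surj surj_f_inv_f)
  have "Hilbert_Choice.inv \<sigma> (x + y) = Hilbert_Choice.inv \<sigma> x + Hilbert_Choice.inv \<sigma> y" for x y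
    by (rule eqI) (simp add: s si)
  moreover have "Hilbert_Choice.inv \<sigma> (x * y) = Hilbert_Choice.inv \<sigma> x * Hilbert_Choice.inv \<sigma> y" for x y
    by (rule eqI) (simp add: s si)
  moreover have "Hilbert_Choice.inv \<sigma> 1 = 1" by (rule eqI) (simp add: s)
  moreover have "Hilbert_Choice.inv \<sigma> x = x" if "x \<in> K" for x by (rule eqI) (simp add: s that)
  ultimately show ?thesis unfolding mem_galois_group_iff using bij_imp_bij_inv[OF b] by blast
qed

lemma group_galois_group: "group (galois_group K)"
proof (rule groupI)
  fix \<sigma> assume "\<sigma> \<in> carrier (galois_group K)"
  then show "\<exists>\<tau>\<in>carrier (galois_group K). \<tau> \<otimes>\<^bsub>galois_group K\<^esub> \<sigma> = \<one>\<^bsub>galois_group K\<^esub>"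
    using galois_group_inv_mem[of \<sigma> K]
    by (intro bexI[of _ "Hilbert_Choice.inv \<sigma>"]) (auto simp: mem_galois_group_iff bij_is_inj)
qed (auto simp: mem_galois_group_iff bij_comp o_assoc)

lemma galois_group_mono: "K \<subseteq> L \<Longrightarrow> carrier (galois_group L) \<subseteq> carrier (galois_group K)"
  unfolding mem_galois_group_iff subset_iff by blast

lemma galois_group_zero: "\<sigma> \<in> carrier (galois_group K) \<Longrightarrow> \<sigma> 0 = 0"
  unfolding mem_galois_group_iff by (metis add_cancel_right_right)

lemma galois_group_hom: "\<sigma> \<in> carrier (galois_group K) \<Longrightarrow> comm_ring_hom \<sigma>"
  using galois_group_zero[of \<sigma> K] by unfold_locales (auto simp: mem_galois_group_iff)

text \<open>An automorphism over F sends x to a root of a fixed nonzero polynomial over F.\<close>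

lemma finite_galois_orbit:
  "finite {\<sigma> x | \<sigma>. \<sigma> \<in> carrier (absolute_galois_group :: ('f::field alg_closure \<Rightarrow> 'f alg_closure) monoid)}"
proof -
  obtain q :: "'f poly" where q: "q \<noteq> 0" "poly (map_poly to_ac q) x = 0"
    using alg_closure_algebraic by blast
  have "poly (map_poly to_ac q) (\<sigma> x) = 0" if "\<sigma> \<in> carrier absolute_galois_group" for \<sigma>
  proof -
    interpret comm_ring_hom \<sigma> by (rule galois_group_hom[OF that])
    have "map_poly \<sigma> (map_poly to_ac q) = map_poly to_ac q"
      using that by (intro poly_eqI) (auto simp: coeff_map_poly mem_galois_group_iff base_field_def)
    then have "poly (map_poly to_ac q) (\<sigma> x) = \<sigma> (poly (map_poly to_ac q) x)"
      using poly_map_poly[of "map_poly to_ac q" x] by simp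
    then show ?thesis by (simp add: q(2))
  qed
  then have "{\<sigma> x | \<sigma>. \<sigma> \<in> carrier absolute_galois_group} \<subseteq> {y. poly (map_poly to_ac q) y = 0}"
    by blast
  moreover have "map_poly to_ac q \<noteq> 0" using q(1) by (simp add: map_poly_eq_0_iff)
  ultimately show ?thesis using poly_roots_finite finite_subset by blast
qed

lemma map_poly_Poly: "f 0 = 0 \<Longrightarrow> map_poly f (Poly xs) = Poly (map f xs)"
  by (intro poly_eqI) (simp add: coeff_map_poly coeff_Poly_eq nth_default_def)

text \<open>
  The tuple \<open>xs\<close> is encoded as a polynomial, so that the elements of its orbit under \<open>H\<close> are the roots
  of a polynomial with coefficients in \<open>Fbar[T]\<close> that \<open>H\<close> fixes, hence also \<open>\<sigma>\<close>.
\<close>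

lemma agrees_with_subgroup_on_finite:
  fixes H :: "('f::field alg_closure \<Rightarrow> 'f alg_closure) set"
  assumes H: "H \<subseteq> carrier absolute_galois_group" "id \<in> H" "\<And>g h. g \<in> H \<Longrightarrow> h \<in> H \<Longrightarrow> g \<circ> h \<in> H"
    and \<sigma>: "\<sigma> \<in> carrier absolute_galois_group" "\<And>x. (\<forall>h\<in>H. h x = x) \<Longrightarrow> \<sigma> x = x"
    and "finite T"
  shows "\<exists>h\<in>H. \<forall>x\<in>T. h x = \<sigma> x"
proof -
  obtain xs where xs: "set xs = T" using finite_list[OF \<open>finite T\<close>] by blast
  define q where "q = Poly xs"
  define Orb where "Orb = (\<lambda>h. map_poly h q) ` H"
  have zero: "h 0 = 0" if "h \<in> carrier absolute_galois_group" for h :: "'f alg_closure \<Rightarrow> 'f alg_closure"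
    using galois_group_zero[OF that] .
  have fin: "finite Orb"
  proof -
    define Y where "Y = (\<Union>x\<in>T. {\<sigma> x | \<sigma>. \<sigma> \<in> carrier (absolute_galois_group :: ('f alg_closure \<Rightarrow> 'f alg_closure) monoid)})"
    have "finite Y" unfolding Y_def using \<open>finite T\<close> finite_galois_orbit by blast
    have "Orb \<subseteq> Poly ` {ys. set ys \<subseteq> Y \<and> length ys = length xs}"
    proof
      fix r assume "r \<in> Orb"
      then obtain h where h: "h \<in> H" "r = map_poly h q" unfolding Orb_def by blast
      then have "r = Poly (map h xs)" using zero H(1) unfolding q_def by (simp add: map_poly_Poly subsetD)
      moreover have "set (map h xs) \<subseteq> Y" unfolding Y_def using h(1) H(1) xs by auto
      ultimately show "r \<in> Poly ` {ys. set ys \<subseteq> Y \<and> length ys = length xs}" by auto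
    qed
    then show ?thesis using finite_lists_length_eq[OF \<open>finite Y\<close>] finite_surj by blast
  qed
  define P where "P = (\<Prod>r\<in>Orb. [:- r, 1:])"
  have invariant: "map_poly (map_poly h) P = P" if h: "h \<in> H" for h
  proof -
    have hG: "h \<in> carrier absolute_galois_group" using h H(1) by blast
    interpret h: comm_ring_hom h by (rule galois_group_hom[OF hG])
    interpret mh: map_poly_comm_ring_hom h ..
    interpret mmh: map_poly_comm_ring_hom "map_poly h" ..
    have maps: "map_poly h ` Orb \<subseteq> Orb"
    proof
      fix r assume "r \<in> map_poly h ` Orb"
      then obtain g where g: "g \<in> H" "r = map_poly h (map_poly g q)" unfolding Orb_def by blast
      have "h 0 = 0" "g 0 = 0" using zero H(1) h g(1) by auto
      then have "r = map_poly (h \<circ> g) q" unfolding g(2) by (simp add: map_poly_map_poly)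
      then show "r \<in> Orb" unfolding Orb_def using H(3)[OF h g(1)] by blast
    qed
    have inj: "inj_on (map_poly h) Orb"
    proof (rule inj_onI)
      fix r s assume "map_poly h r = map_poly h s"
      then have "h (coeff r i) = h (coeff s i)" for i by (metis h.coeff_map_poly_hom)
      moreover have "inj h" using hG by (simp add: mem_galois_group_iff bij_is_inj)
      ultimately show "r = s" by (intro poly_eqI) (auto dest: injD)
    qed
    \<comment> \<open>Closure under composition gives only an inclusion; an injective self-map of a
      finite set is a permutation.\<close>
    have im: "map_poly h ` Orb = Orb" by (rule endo_inj_surj[OF fin maps inj])
    have "map_poly (map_poly h) P = (\<Prod>r\<in>Orb. [:- map_poly h r, 1:])"
      unfolding P_def mmh.hom_prod by (simp add: hom_distribs)
    also have "\<dots> = (\<Prod>r\<in>map_poly h ` Orb. [:- r, 1:])"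
      by (simp add: prod.reindex[OF inj])
    also have "\<dots> = P" unfolding im P_def ..
    finally show ?thesis .
  qed
  have coeffs: "\<sigma> (coeff (coeff P i) j) = coeff (coeff P i) j" for i j
  proof (rule \<sigma>(2), intro ballI)
    fix h assume h: "h \<in> H"
    then have z: "h 0 = 0" using zero H(1) by blast
    have "coeff (coeff (map_poly (map_poly h) P) i) j = h (coeff (coeff P i) j)"
      using z by (simp add: coeff_map_poly)
    then show "h (coeff (coeff P i) j) = coeff (coeff P i) j" unfolding invariant[OF h] ..
  qed
  interpret s: comm_ring_hom \<sigma> by (rule galois_group_hom[OF \<sigma>(1)])
  interpret ms: map_poly_comm_ring_hom \<sigma> ..
  have "map_poly (map_poly \<sigma>) P = P"
    by (intro poly_eqI) (simp add: coeff_map_poly coeffs)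
  moreover have "poly P q = 0"
  proof -
    have "q \<in> Orb" unfolding Orb_def using H(2) by (intro image_eqI[of _ _ id]) (auto simp: map_poly_id)
    then show ?thesis unfolding P_def using fin by (auto simp: poly_prod)
  qed
  ultimately have "poly P (map_poly \<sigma> q) = 0"
    using ms.poly_map_poly[of P q] by simp
  then obtain r where "r \<in> Orb" "map_poly \<sigma> q = r"
    unfolding P_def using fin by (auto simp: poly_prod)
  then obtain h where h: "h \<in> H" "map_poly \<sigma> q = map_poly h q" unfolding Orb_def by blast
  have "h x = \<sigma> x" if y: "x \<in> T" for x
  proof -
    obtain i where i: "i < length xs" "xs ! i = x" using y unfolding xs[symmetric] in_set_conv_nth by blast
    \<comment> \<open>\<open>Poly\<close> drops trailing zeros, but reading coefficients with
      default 0 still recovers every entry of \<open>xs\<close>.\<close>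
    have "coeff (map_poly \<sigma> q) i = \<sigma> x" "coeff (map_poly h q) i = h x"
      using i zero h(1) H(1) \<sigma>(1) unfolding q_def
      by (auto simp: coeff_map_poly coeff_Poly_eq nth_default_def)
    then show ?thesis using h(2) by simp
  qed
  then show ?thesis using h(1) by blast
qed

section \<open>Neighbourhoods in the Krull topology\<close>

text \<open>
  Neighbourhoods of \<open>\<sigma>\<close> in \<open>I\<close> for pointwise convergence on a discrete space, which induces the Krull
  topology.
\<close>

definition pointwise_nbhd ::
  "('a \<Rightarrow> 'a) set \<Rightarrow> ('a \<Rightarrow> 'a) \<Rightarrow> ('a \<Rightarrow> 'a) set \<Rightarrow> bool" where
  "pointwise_nbhd I \<sigma> V \<longleftrightarrow>
     (\<exists>T. finite T \<and> (\<forall>\<sigma>'\<in>I. (\<forall>x\<in>T. \<sigma>' x = \<sigma> x) \<longrightarrow> \<sigma>' \<in> V))"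

text \<open>Testing a subbasis is enough: an intersection of two sets needs the union of their
  finite test sets, and a union of sets keeps the test set of one member.\<close>

lemma pointwise_nbhd_generated:
  assumes "openin (topology_generated_by S) U" "\<sigma> \<in> U"
    and basis: "\<And>s. s \<in> S \<Longrightarrow> \<sigma> \<in> s \<Longrightarrow> pointwise_nbhd I \<sigma> s"
  shows "pointwise_nbhd I \<sigma> U"
proof -
  have "generate_topology_on S U" using assms(1) by (simp add: openin_topology_generated_by)
  then show ?thesis using assms(2)
  proof (induction rule: generate_topology_on.induct)
    case (Int a b)
    then have "pointwise_nbhd I \<sigma> a" "pointwise_nbhd I \<sigma> b" by auto
    then obtain T Y where "finite T" "\<forall>\<sigma>'\<in>I. (\<forall>x\<in>T. \<sigma>' x = \<sigma> x) \<longrightarrow> \<sigma>' \<in> a"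
        "finite Y" "\<forall>\<sigma>'\<in>I. (\<forall>x\<in>Y. \<sigma>' x = \<sigma> x) \<longrightarrow> \<sigma>' \<in> b"
      unfolding pointwise_nbhd_def by blast
    then show ?case unfolding pointwise_nbhd_def by (intro exI[of _ "T \<union> Y"]) auto
  next
    case (UN K)
    then obtain k where k: "k \<in> K" "\<sigma> \<in> k" by blast
    then have "pointwise_nbhd I \<sigma> k" using UN.IH by blast
    then show ?case unfolding pointwise_nbhd_def using k(1) by blast
  next
    case (Basis s)
    then show ?case using basis by blast
  qed simp
qed

lemma agree_on_Span:
  assumes "\<sigma> \<in> carrier absolute_galois_group" "\<sigma>' \<in> carrier absolute_galois_group"
    and "\<forall>u\<in>set us. \<sigma>' u = \<sigma> u" "y \<in> ring.Span Fbar base_field us"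
  shows "\<sigma>' y = \<sigma> y"
proof -
  interpret ring "Fbar :: 'a alg_closure ring" by (rule ring_from_type_algebra)
  show ?thesis using assms(3,4)
  proof (induction us arbitrary: y)
    case Nil
    then have "y = 0" by simp
    then show ?case using galois_group_zero[OF assms(1)] galois_group_zero[OF assms(2)] by simp
  next
    case (Cons u us)
    from Cons.prems(2) have "y \<in> line_extension base_field u (Span base_field us)" by simp
    then obtain k v where y: "k \<in> base_field" "v \<in> Span base_field us" "y = k * u + v"
      unfolding line_extension_mem_iff by auto
    have "\<sigma>' v = \<sigma> v" using Cons.IH[OF _ y(2)] Cons.prems(1) by simp
    then show ?case using Cons.prems(1) y(1) assms(1,2) unfolding mem_galois_group_iff y(3) by simp
  qed
qed

text \<open>A finite subextension E is spanned over F by a finite list. Agreeing with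
  \<open>\<sigma>\<close> on this list means agreeing on E, that is, lying in the same left coset of
  the group fixing E.\<close>

lemma pointwise_nbhd_krull:
  assumes "openin krull_topology U" "\<sigma> \<in> U" and I: "I \<subseteq> carrier absolute_galois_group"
  shows "pointwise_nbhd I \<sigma> U"
  using assms(1,2) unfolding krull_topology_def
proof (rule pointwise_nbhd_generated)
  fix s assume "s \<in> {\<sigma> <#\<^bsub>absolute_galois_group\<^esub> carrier (galois_group E) | \<sigma> E.
        \<sigma> \<in> carrier absolute_galois_group \<and> finite_subextension E}" and "\<sigma> \<in> s"
  then obtain \<sigma>0 E g where s: "s = \<sigma>0 <#\<^bsub>absolute_galois_group\<^esub> carrier (galois_group E)"
      "\<sigma>0 \<in> carrier absolute_galois_group" "finite_subextension E"
      and g: "g \<in> carrier (galois_group E)" "\<sigma> = \<sigma>0 \<circ> g"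
    unfolding l_coset_def by auto
  interpret ring "Fbar :: 'a alg_closure ring" by (rule ring_from_type_algebra)
  obtain n where "dimension n base_field E"
    using s(3) unfolding finite_subextension_def finite_dimension_def by blast
  from exists_base[OF subfield_base_field this] obtain us where us: "Span base_field us = E" by blast
  have gG: "g \<in> carrier absolute_galois_group"
    using g(1) galois_group_mono[of base_field E] s(3) unfolding finite_subextension_def by blast
  have \<sigma>: "\<sigma> \<in> carrier absolute_galois_group"
    using s(2) gG unfolding g(2) by (auto simp: mem_galois_group_iff bij_comp)
  have b0: "bij \<sigma>0" using s(2) by (simp add: mem_galois_group_iff)
  have "\<sigma>' \<in> s" if \<sigma>': "\<sigma>' \<in> I" "\<forall>x\<in>set us. \<sigma>' x = \<sigma> x" for \<sigma>'
  proof -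
    have \<sigma>'G: "\<sigma>' \<in> carrier absolute_galois_group" using \<sigma>'(1) I by blast
    define k where "k = Hilbert_Choice.inv \<sigma>0 \<circ> \<sigma>'"
    have "k \<in> carrier absolute_galois_group"
      using galois_group_inv_mem[OF s(2)] \<sigma>'G unfolding k_def by (auto simp: mem_galois_group_iff bij_comp)
    moreover have "k y = y" if "y \<in> E" for y
    proof -
      have "\<sigma>' y = \<sigma> y" using agree_on_Span[OF \<sigma> \<sigma>'G \<sigma>'(2)] that us by simp
      also have "\<dots> = \<sigma>0 y" using g that by (simp add: mem_galois_group_iff)
      finally show ?thesis unfolding k_def using b0 by (simp add: bij_is_inj inv_f_f)
    qed
    ultimately have "k \<in> carrier (galois_group E)" by (simp add: mem_galois_group_iff)
    moreover have "\<sigma>' = \<sigma>0 \<circ> k" unfolding k_def using b0 by (auto simp: bij_is_surj surj_f_inv_f)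
    ultimately show ?thesis unfolding s(1) l_coset_def by auto
  qed
  then show "pointwise_nbhd I \<sigma> s" unfolding pointwise_nbhd_def by blast
qed

section \<open>Two-dimensional representations of determinant one\<close>

lemma mat2_eq_iff: "(A :: 'a^2^2) = B \<longleftrightarrow>
    A $ 1 $ 1 = B $ 1 $ 1 \<and> A $ 1 $ 2 = B $ 1 $ 2 \<and> A $ 2 $ 1 = B $ 2 $ 1 \<and> A $ 2 $ 2 = B $ 2 $ 2"
  by (auto simp: Finite_Cartesian_Product.vec_eq_iff forall_2)

lemma mat2_mult: "((A :: 'a::comm_ring_1^2^2) ** B) $ i $ j = A $ i $ 1 * B $ 1 $ j + A $ i $ 2 * B $ 2 $ j"
  by (simp add: matrix_matrix_mult_def sum_2)

lemma mat2_entries: "(mat c :: 'a::comm_ring_1^2^2) $ 1 $ 1 = c" "(mat c :: 'a^2^2) $ 1 $ 2 = 0"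
    "(mat c :: 'a^2^2) $ 2 $ 1 = 0" "(mat c :: 'a^2^2) $ 2 $ 2 = c"
  by (simp_all add: Finite_Cartesian_Product.mat_def)

lemma trace_2: "trace (A :: 'a::comm_ring_1^2^2) = A $ 1 $ 1 + A $ 2 $ 2"
  by (simp add: trace_def sum_2)

section \<open>Cayley-Hamilton and the trace of an element of given order\<close>

lemmas mat2_simps = mat2_eq_iff mat2_mult mat2_entries trace_2 det_2

text \<open>Determinant one turns Cayley-Hamilton into A^2 = (tr A) A - 1, so the combinations of A
  and 1 are closed under products.\<close>

lemma mult_lin_comb_mat2:
  fixes A :: "'a::comm_ring_1^2^2"
  assumes "det A = 1"
  shows "(mat a ** A + mat b) ** (mat c ** A + mat d) =
    mat (a * c * trace A + a * d + b * c) ** A + mat (b * d - a * c)"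
proof -
  have "b * d - a * c = b * d - a * c * (A $ 1 $ 1 * A $ 2 $ 2 - A $ 1 $ 2 * A $ 2 $ 1)"
    using assms by (simp add: det_2)
  then show ?thesis by (simp only:) (simp add: mat2_simps algebra_simps)
qed

lemma scalar_mat2_det_one:
  fixes A :: "'a::field^2^2"
  assumes "det A = 1" "A $ 1 $ 2 = 0" "A $ 2 $ 1 = 0" "A $ 1 $ 1 = A $ 2 $ 2"
  shows "A = mat 1 \<or> A = mat (- 1)"
proof -
  have "(A $ 1 $ 1 - 1) * (A $ 1 $ 1 + 1) = 0" using assms by (simp add: det_2 algebra_simps)
  then have "A $ 1 $ 1 = 1 \<or> A $ 1 $ 1 = - 1" by (auto simp: eq_neg_iff_add_eq_0)
  then show ?thesis using assms by (auto simp: mat2_simps)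
qed

text \<open>The two excluded values are the only scalar matrices of determinant one, so A and 1 are
  linearly independent.\<close>

lemma lin_comb_mat2_eq_scalar:
  fixes A :: "'a::field^2^2"
  assumes "det A = 1" "A \<noteq> mat 1" "A \<noteq> mat (- 1)" "mat a ** A + mat b = mat c"
  shows "a = 0" "b = c"
proof -
  show "a = 0"
  proof (rule ccontr)
    assume "a \<noteq> 0"
    have e: "a * A $ 1 $ 1 + b = c" "a * A $ 1 $ 2 = 0" "a * A $ 2 $ 1 = 0" "a * A $ 2 $ 2 + b = c"
      using assms(4) by (simp_all add: mat2_simps)
    have "a * A $ 1 $ 1 = a * A $ 2 $ 2" by (rule add_right_imp_eq[of _ b]) (simp only: e)
    then have "A $ 1 $ 2 = 0" "A $ 2 $ 1 = 0" "A $ 1 $ 1 = A $ 2 $ 2"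
      using e(2,3) \<open>a \<noteq> 0\<close> by simp_all
    then show False using scalar_mat2_det_one[OF assms(1)] assms(2,3) by blast
  qed
  then show "b = c" using assms(4) by (simp add: mat2_simps)
qed

text \<open>The coefficients are Chebyshev polynomials of the second kind: A^n = U_(n-1)(t/2) A -
  U_(n-2)(t/2) with t = tr A. A general commutative ring is taken so as to cover the complex numbers
  and the field with three elements.\<close>

lemma SL2_powers:
  fixes A :: "'a::comm_ring_1^2^2"
  assumes det: "det A = 1"
  shows "A ** A = mat (trace A) ** A + mat (- 1)"
    and "A ** A ** A = mat (trace A ^ 2 - 1) ** A + mat (- trace A)"
    and "(A ** A) ** (A ** A) = mat (trace A ^ 3 - 2 * trace A) ** A + mat (1 - trace A ^ 2)"
    and "(A ** A ** A) ** (A ** A ** A) =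
      mat ((trace A ^ 2 - 1) * trace A * (trace A ^ 2 - 3)) ** A + mat (trace A ^ 2 - (trace A ^ 2 - 1) ^ 2)"
proof -
  define t where "t = trace A"
  have A1: "A = mat 1 ** A + mat 0" by (simp add: mat2_simps)
  have A2: "A ** A = mat t ** A + mat (- 1)"
    using mult_lin_comb_mat2[OF det, of 1 0 1 0] unfolding t_def A1[symmetric] by simp
  have A3: "A ** A ** A = mat (t ^ 2 - 1) ** A + mat (- t)"
    using mult_lin_comb_mat2[OF det, of t "- 1" 1 0] unfolding A2[symmetric] A1[symmetric] t_def[symmetric]
    by (simp add: power2_eq_square)
  have A4: "(A ** A) ** (A ** A) = mat (t ^ 3 - 2 * t) ** A + mat (1 - t ^ 2)"
    using mult_lin_comb_mat2[OF det, of t "- 1" t "- 1"] unfolding A2[symmetric] t_def[symmetric]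
    by (simp add: power2_eq_square power3_eq_cube)
  have A6: "(A ** A ** A) ** (A ** A ** A) =
      mat ((t ^ 2 - 1) * t * (t ^ 2 - 3)) ** A + mat (t ^ 2 - (t ^ 2 - 1) ^ 2)"
  proof -
    have "(t ^ 2 - 1) * t * (t ^ 2 - 3) =
        (t ^ 2 - 1) * (t ^ 2 - 1) * t + (t ^ 2 - 1) * (- t) + - t * (t ^ 2 - 1)"
      by (simp add: algebra_simps power2_eq_square)
    moreover have "t ^ 2 - (t ^ 2 - 1) ^ 2 = (- t) * (- t) - (t ^ 2 - 1) * (t ^ 2 - 1)"
      by (simp add: power2_eq_square)
    ultimately show ?thesis
      using mult_lin_comb_mat2[OF det, of "t ^ 2 - 1" "- t" "t ^ 2 - 1" "- t"]
      unfolding A3[symmetric] t_def[symmetric] by simp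
  qed
  show "A ** A = mat (trace A) ** A + mat (- 1)"
    and "A ** A ** A = mat (trace A ^ 2 - 1) ** A + mat (- trace A)"
    and "(A ** A) ** (A ** A) = mat (trace A ^ 3 - 2 * trace A) ** A + mat (1 - trace A ^ 2)"
    and "(A ** A ** A) ** (A ** A ** A) =
      mat ((trace A ^ 2 - 1) * trace A * (trace A ^ 2 - 3)) ** A + mat (trace A ^ 2 - (trace A ^ 2 - 1) ^ 2)"
    using A2 A3 A4 A6 unfolding t_def .
qed

text \<open>If A is neither 1 nor -1, an equation A^n = 1 makes the coefficient of A vanish and the
  constant equal to 1, which leaves one trace for each order. The nested conditions detect the exact
  orders 1, 2, 4, 3 and 6, in this sequence.\<close>

lemma SL2_trace_by_order:
  fixes A :: "complex^2^2"
  assumes det: "det A = 1"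
    and ord: "(A ** A) ** (A ** A) = mat 1 \<or> (A ** A ** A) ** (A ** A ** A) = mat 1"
  shows "trace A = (if A = mat 1 then 2 else if A ** A = mat 1 then - 2
    else if (A ** A) ** (A ** A) = mat 1 then 0 else if A ** A ** A = mat 1 then - 1 else 1)"
proof (cases "A = mat 1 \<or> A = mat (- 1)")
  case True
  then show ?thesis
  proof
    assume "A = mat 1"
    then show ?thesis by (simp add: trace_2 mat2_entries)
  next
    assume A: "A = mat (- 1)"
    have "A \<noteq> mat 1" "A ** A = mat 1" "trace A = - 2" unfolding A by (simp_all add: mat2_simps)
    then show ?thesis by simp
  qed
next
  case False
  define t where "t = trace A"
  note A2 = SL2_powers(1)[OF det, folded t_def] and A3 = SL2_powers(2)[OF det, folded t_def]
    and A4 = SL2_powers(3)[OF det, folded t_def] and A6 = SL2_powers(4)[OF det, folded t_def]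
  note scalar = lin_comb_mat2_eq_scalar[OF det, of _ _ 1]
  have n2: "A ** A \<noteq> mat 1"
    using scalar(2)[of t "- 1"] False A2 by auto
  have t4: "t = 0" if "(A ** A) ** (A ** A) = mat 1"
    using scalar(2)[of "t ^ 3 - 2 * t" "1 - t ^ 2"] False that A4 by auto
  have t3: "t = - 1" if "A ** A ** A = mat 1"
  proof -
    have "- t = 1" using scalar(2)[of "t ^ 2 - 1" "- t"] False that A3 by auto
    then show ?thesis by (simp add: minus_equation_iff)
  qed
  have t6: "t = 1" if n: "A ** A ** A \<noteq> mat 1" and "(A ** A ** A) ** (A ** A ** A) = mat 1"
  proof -
    have s: "(t ^ 2 - 1) * t * (t ^ 2 - 3) = 0" "t ^ 2 - (t ^ 2 - 1) ^ 2 = 1"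
      using scalar[of "(t ^ 2 - 1) * t * (t ^ 2 - 3)" "t ^ 2 - (t ^ 2 - 1) ^ 2"] False that(2) A6 by auto
    \<comment> \<open>Both t = 0 and t^2 = 3 would give A^6 = -1, which the second equation
      excludes.\<close>
    have "t \<noteq> 0" using s(2) by auto
    moreover have "t ^ 2 \<noteq> 3" using s(2) by (auto simp: power2_eq_square)
    ultimately have "t ^ 2 = 1" using s(1) by simp
    moreover have "t \<noteq> - 1" using n A3 by (auto simp: mat2_simps)
    ultimately show ?thesis by (simp add: power2_eq_1_iff)
  qed
  show ?thesis using False n2 t3 t4 t6 ord unfolding t_def[symmetric] by auto
qed

lemma SL2_involution:
  fixes A :: "complex^2^2"
  assumes "det A = 1" "A ** A = mat 1" "A \<noteq> mat 1"
  shows "A = mat (- 1)"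
proof (rule ccontr)
  assume n: "A \<noteq> mat (- 1)"
  have A1: "A = mat 1 ** A + mat 0" by (simp add: mat2_simps)
  have "mat (trace A) ** A + mat (- 1) = mat 1"
    using mult_lin_comb_mat2[OF assms(1), of 1 0 1 0] assms(2) unfolding A1[symmetric] by simp
  from lin_comb_mat2_eq_scalar(2)[OF assms(1,3) n this] show False by simp
qed

text \<open>For determinant one the inverse is the adjugate, whose diagonal is that of A with the
  two entries exchanged.\<close>

lemma trace_inverse_SL2:
  fixes A :: "'a::field^2^2"
  assumes "A ** B = mat 1" "det A = 1"
  shows "trace B = trace A"
proof -
  have e: "A $ 1 $ 1 * A $ 2 $ 2 - A $ 1 $ 2 * A $ 2 $ 1 = 1"
    "A $ 1 $ 1 * B $ 1 $ 1 + A $ 1 $ 2 * B $ 2 $ 1 = 1"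
    "A $ 1 $ 1 * B $ 1 $ 2 + A $ 1 $ 2 * B $ 2 $ 2 = 0"
    "A $ 2 $ 1 * B $ 1 $ 1 + A $ 2 $ 2 * B $ 2 $ 1 = 0"
    "A $ 2 $ 1 * B $ 1 $ 2 + A $ 2 $ 2 * B $ 2 $ 2 = 1"
    using assms by (simp_all add: mat2_simps)
  have "B $ 1 $ 1 = A $ 2 $ 2" using e(1,2,4) by Groebner_Basis.algebra
  moreover have "B $ 2 $ 2 = A $ 1 $ 1" using e(1,3,5) by Groebner_Basis.algebra
  ultimately show ?thesis by (simp add: trace_2)
qed

section \<open>Centralizers and conjugacy of nonscalar matrices\<close>

lemma commute_nonscalar_mat2:
  fixes A Y :: "'a::field^2^2"
  assumes "A ** Y = Y ** A" and nonscalar: "A $ 1 $ 2 \<noteq> 0 \<or> A $ 2 $ 1 \<noteq> 0 \<or> A $ 1 $ 1 \<noteq> A $ 2 $ 2"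
  shows "\<exists>a b. Y = mat a ** A + mat b"
proof -
  have eqs: "A $ 1 $ 1 * Y $ 1 $ 1 + A $ 1 $ 2 * Y $ 2 $ 1 = Y $ 1 $ 1 * A $ 1 $ 1 + Y $ 1 $ 2 * A $ 2 $ 1"
    "A $ 1 $ 1 * Y $ 1 $ 2 + A $ 1 $ 2 * Y $ 2 $ 2 = Y $ 1 $ 1 * A $ 1 $ 2 + Y $ 1 $ 2 * A $ 2 $ 2"
    "A $ 2 $ 1 * Y $ 1 $ 1 + A $ 2 $ 2 * Y $ 2 $ 1 = Y $ 2 $ 1 * A $ 1 $ 1 + Y $ 2 $ 2 * A $ 2 $ 1"
    using assms(1) unfolding mat2_eq_iff mat2_mult by blast+
  have "A $ 1 $ 2 * Y $ 2 $ 1 = Y $ 1 $ 2 * A $ 2 $ 1" using eqs(1) by Groebner_Basis.algebra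
  note e = this eqs(2,3)
  \<comment> \<open>In each case \<open>a\<close> is the ratio forced by a place where A differs
    from a scalar matrix; \<open>b\<close> is then chosen to match the upper left entry.\<close>
  consider "A $ 1 $ 2 \<noteq> 0" | "A $ 2 $ 1 \<noteq> 0" | "A $ 1 $ 2 = 0" "A $ 2 $ 1 = 0" "A $ 1 $ 1 \<noteq> A $ 2 $ 2"
    using nonscalar by blast
  then show ?thesis
  proof cases
    case 1
    define a where "a = Y $ 1 $ 2 / A $ 1 $ 2"
    have a: "a * A $ 1 $ 2 = Y $ 1 $ 2" using 1 a_def by simp
    have "a * A $ 2 $ 1 = Y $ 2 $ 1" using 1 a e(1) by Groebner_Basis.algebra
    moreover have "a * A $ 2 $ 2 + (Y $ 1 $ 1 - a * A $ 1 $ 1) = Y $ 2 $ 2" using 1 a e(2) by Groebner_Basis.algebra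
    ultimately show ?thesis using a
      by (intro exI[of _ a] exI[of _ "Y $ 1 $ 1 - a * A $ 1 $ 1"]) (simp add: mat2_simps)
  next
    case 2
    define a where "a = Y $ 2 $ 1 / A $ 2 $ 1"
    have a: "a * A $ 2 $ 1 = Y $ 2 $ 1" using 2 a_def by simp
    have "a * A $ 1 $ 2 = Y $ 1 $ 2" using 2 a e(1) by Groebner_Basis.algebra
    moreover have "a * A $ 2 $ 2 + (Y $ 1 $ 1 - a * A $ 1 $ 1) = Y $ 2 $ 2" using 2 a e(3) by Groebner_Basis.algebra
    ultimately show ?thesis using a
      by (intro exI[of _ a] exI[of _ "Y $ 1 $ 1 - a * A $ 1 $ 1"]) (simp add: mat2_simps)
  next
    case 3
    define a where "a = (Y $ 1 $ 1 - Y $ 2 $ 2) / (A $ 1 $ 1 - A $ 2 $ 2)"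
    have a: "a * (A $ 1 $ 1 - A $ 2 $ 2) = Y $ 1 $ 1 - Y $ 2 $ 2" using 3 a_def by simp
    have "Y $ 1 $ 2 = 0" "Y $ 2 $ 1 = 0" using e(2,3) 3 by (auto simp: mult.commute)
    moreover have "a * A $ 2 $ 2 + (Y $ 1 $ 1 - a * A $ 1 $ 1) = Y $ 2 $ 2" using a by (simp add: algebra_simps)
    ultimately show ?thesis using 3
      by (intro exI[of _ a] exI[of _ "Y $ 1 $ 1 - a * A $ 1 $ 1"]) (simp add: mat2_simps)
  qed
qed

text \<open>A nonscalar matrix has a vector v that is not an eigenvector, and in the basis v, A v it
  becomes the companion matrix of T^2 - (tr A) T + 1.\<close>

lemma companion_mat2:
  fixes A :: "'a::field^2^2"
  assumes "det A = 1" and nonscalar: "A $ 1 $ 2 \<noteq> 0 \<or> A $ 2 $ 1 \<noteq> 0 \<or> A $ 1 $ 1 \<noteq> A $ 2 $ 2"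
  shows "\<exists>Q :: 'a^2^2. invertible Q \<and> A ** Q = Q ** (vector [vector [0, - 1], vector [1, trace A]] :: 'a^2^2)"
proof -
  have det: "A $ 1 $ 1 * A $ 2 $ 2 - A $ 1 $ 2 * A $ 2 $ 1 = 1" using assms(1) by (simp add: det_2)
  \<comment> \<open>The quadratic form is det(v, A v) for v = (u, w). If it vanishes at (1, 0), (0,
    1) and (1, 1), then A is scalar.\<close>
  have "\<exists>u w. u * (A $ 2 $ 1 * u + A $ 2 $ 2 * w) - w * (A $ 1 $ 1 * u + A $ 1 $ 2 * w) \<noteq> 0"
  proof (rule ccontr)
    assume "\<not> ?thesis"
    then have h: "u * (A $ 2 $ 1 * u + A $ 2 $ 2 * w) - w * (A $ 1 $ 1 * u + A $ 1 $ 2 * w) = 0" for u w by blast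
    have "A $ 2 $ 1 = 0" using h[of 1 0] by simp
    moreover have "A $ 1 $ 2 = 0" using h[of 0 1] by simp
    ultimately show False using h[of 1 1] nonscalar by simp
  qed
  then obtain u w where uw: "u * (A $ 2 $ 1 * u + A $ 2 $ 2 * w) - w * (A $ 1 $ 1 * u + A $ 1 $ 2 * w) \<noteq> 0"
    by blast
  define Q :: "'a^2^2" where "Q = vector [vector [u, A $ 1 $ 1 * u + A $ 1 $ 2 * w], vector [w, A $ 2 $ 1 * u + A $ 2 $ 2 * w]]"
  have "det Q \<noteq> 0" using uw unfolding Q_def det_2 vector_2 by (simp add: mult.commute)
  moreover have "A ** Q = Q ** (vector [vector [0, - 1], vector [1, trace A]] :: 'a^2^2)"
  proof -
    have "A $ 1 $ 1 * (A $ 1 $ 1 * u + A $ 1 $ 2 * w) + A $ 1 $ 2 * (A $ 2 $ 1 * u + A $ 2 $ 2 * w) =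
        (A $ 1 $ 1 * u + A $ 1 $ 2 * w) * (A $ 1 $ 1 + A $ 2 $ 2) - u"
      using det by Groebner_Basis.algebra
    moreover have "A $ 2 $ 1 * (A $ 1 $ 1 * u + A $ 1 $ 2 * w) + A $ 2 $ 2 * (A $ 2 $ 1 * u + A $ 2 $ 2 * w) =
        (A $ 2 $ 1 * u + A $ 2 $ 2 * w) * (A $ 1 $ 1 + A $ 2 $ 2) - w"
      using det by Groebner_Basis.algebra
    ultimately show ?thesis unfolding Q_def by (simp add: mat2_simps)
  qed
  ultimately show ?thesis using invertible_det_nz[of Q] by blast
qed

lemma SL2_conjugate_of_trace_eq:
  fixes A B :: "'a::field^2^2"
  assumes "det A = 1" "A $ 1 $ 2 \<noteq> 0 \<or> A $ 2 $ 1 \<noteq> 0 \<or> A $ 1 $ 1 \<noteq> A $ 2 $ 2"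
    and "det B = 1" "B $ 1 $ 2 \<noteq> 0 \<or> B $ 2 $ 1 \<noteq> 0 \<or> B $ 1 $ 1 \<noteq> B $ 2 $ 2"
    and "trace A = trace B"
  shows "\<exists>Q. invertible Q \<and> Q ** A = B ** Q"
proof -
  define C :: "'a^2^2" where "C = vector [vector [0, - 1], vector [1, trace A]]"
  obtain Q1 where Q1: "invertible Q1" "A ** Q1 = Q1 ** C"
    using companion_mat2[OF assms(1,2)] unfolding C_def by blast
  obtain Q2 where Q2: "invertible Q2" "B ** Q2 = Q2 ** C"
    using companion_mat2[OF assms(3,4)] unfolding C_def assms(5) by blast
  obtain R where R: "Q1 ** R = mat 1" "R ** Q1 = mat 1" using Q1(1) unfolding invertible_def by blast
  have "invertible (Q2 ** R)"
    using Q2(1) R by (intro invertible_mult) (auto simp: invertible_def)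
  moreover have "Q2 ** R ** A = B ** (Q2 ** R)"
  proof -
    have "Q2 ** R ** A = Q2 ** R ** (A ** Q1) ** R"
      using R(1) by (simp add: matrix_mul_assoc[symmetric])
    also have "\<dots> = Q2 ** (R ** Q1) ** C ** R" unfolding Q1(2) by (simp add: matrix_mul_assoc)
    also have "\<dots> = B ** Q2 ** R" unfolding R(2) by (simp add: Q2(2))
    finally show ?thesis by (simp add: matrix_mul_assoc)
  qed
  ultimately show ?thesis by blast
qed


text \<open>A nonzero singular matrix has rank one, so its kernel is the line annihilated by any
  nonzero row.\<close>

lemma singular_mat2_kernel:
  fixes A :: "'a::field^2^2"
  assumes "A \<noteq> 0" "det A = 0"
  shows "\<exists>v. v \<noteq> 0 \<and> A *v v = 0 \<and> (\<forall>w. A *v w = 0 \<longrightarrow> (\<exists>c. w = c *s v))"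
proof -
  have det: "A $ 1 $ 1 * A $ 2 $ 2 = A $ 1 $ 2 * A $ 2 $ 1" using assms(2) by (simp add: det_2)
  obtain i where i: "A $ i $ 1 \<noteq> 0 \<or> A $ i $ 2 \<noteq> 0"
    using assms(1) by (auto simp: mat2_eq_iff)
  define v :: "'a^2" where "v = vector [- A $ i $ 2, A $ i $ 1]"
  have v12: "v $ 1 = - A $ i $ 2" "v $ 2 = A $ i $ 1" unfolding v_def by simp_all
  have "v \<noteq> 0" using i by (auto simp: Finite_Cartesian_Product.vec_eq_iff forall_2 v12)
  moreover have "A *v v = 0"
    using det exhaust_2[of i]
    by (auto simp: Finite_Cartesian_Product.vec_eq_iff forall_2 v12 matrix_vector_mult_def sum_2 mult.commute)
  moreover have "\<exists>c. w = c *s v" if "A *v w = 0" for w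
  proof -
    have w: "A $ i $ 1 * w $ 1 + A $ i $ 2 * w $ 2 = 0"
      using that by (simp add: Finite_Cartesian_Product.vec_eq_iff matrix_vector_mult_def sum_2)
    show ?thesis
    proof (cases "A $ i $ 1 = 0")
      case True
      then have "A $ i $ 2 \<noteq> 0" "w $ 2 = 0" using i w by auto
      then show ?thesis using True
        by (intro exI[of _ "- w $ 1 / A $ i $ 2"])
          (simp add: Finite_Cartesian_Product.vec_eq_iff forall_2 v12)
    next
      case False
      have "w $ 1 = - (w $ 2 / A $ i $ 1) * A $ i $ 2"
        using w False by (simp add: field_simps eq_neg_iff_add_eq_0)
      then show ?thesis using False
        by (intro exI[of _ "w $ 2 / A $ i $ 1"])
          (simp add: Finite_Cartesian_Product.vec_eq_iff forall_2 v12)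
    qed
  qed
  ultimately show ?thesis by blast
qed

lemma trace_SL2_fixed_vector:
  fixes A :: "'a::field^2^2"
  assumes "det A = 1" "A *v v = v" "v \<noteq> 0"
  shows "trace A = 2"
proof -
  have e: "A $ 1 $ 1 * v $ 1 + A $ 1 $ 2 * v $ 2 = v $ 1" "A $ 2 $ 1 * v $ 1 + A $ 2 $ 2 * v $ 2 = v $ 2"
    using assms(2) by (auto simp: Finite_Cartesian_Product.vec_eq_iff forall_2 matrix_vector_mult_def sum_2)
  have d: "A $ 1 $ 1 * A $ 2 $ 2 - A $ 1 $ 2 * A $ 2 $ 1 = 1" using assms(1) by (simp add: det_2)
  \<comment> \<open>This is adj(A - 1) (A - 1) v = det(A - 1) v in coordinates, where det(A - 1) = 2
    - tr A.\<close>
  have aux: "(a + d - 2) * u = 0" "(a + d - 2) * w = 0"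
    if "a * u + b * w = u" "c * u + d * w = w" "a * d - b * c = 1" for a b c d u w :: 'a
  proof -
    have "(a + d - 2) * u =
        (a * d - b * c - 1) * u - (d - 1) * (a * u + b * w - u) + b * (c * u + d * w - w)"
      by (simp add: algebra_simps)
    then show "(a + d - 2) * u = 0" using that by simp
    have "(a + d - 2) * w =
        (a * d - b * c - 1) * w - (a - 1) * (c * u + d * w - w) + c * (a * u + b * w - u)"
      by (simp add: algebra_simps)
    then show "(a + d - 2) * w = 0" using that by simp
  qed
  have "(A $ 1 $ 1 + A $ 2 $ 2 - 2) * v $ 1 = 0" by (rule aux(1)[OF e d])
  moreover have "(A $ 1 $ 1 + A $ 2 $ 2 - 2) * v $ 2 = 0" by (rule aux(2)[OF e d])
  moreover have "v $ 1 \<noteq> 0 \<or> v $ 2 \<noteq> 0"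
    using assms(3) by (auto simp: Finite_Cartesian_Product.vec_eq_iff forall_2)
  ultimately show ?thesis by (auto simp: trace_2)
qed

section \<open>Intertwiners of two representations with the same kernel\<close>

lemma mat2_mult_sum:
  fixes f :: "'b \<Rightarrow> 'a::comm_ring_1^2^2" and B C :: "'a^2^2"
  shows "B ** sum f S ** C = (\<Sum>i\<in>S. B ** f i ** C)"
proof (induction S rule: infinite_finite_induct)
  case (insert i S)
  have "B ** (f i + sum f S) ** C = B ** f i ** C + B ** sum f S ** C"
    by (simp add: mat2_eq_iff mat2_mult algebra_simps)
  then show ?case using insert by simp
qed (simp_all add: mat2_eq_iff mat2_mult)

locale SL2_rep_pair = group G for G :: "('g, 'h) monoid_scheme" (structure) +
  fixes r\<^sub>1 r\<^sub>2 :: "'g \<Rightarrow> complex^2^2"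
  assumes hom1: "\<And>x y. x \<in> carrier G \<Longrightarrow> y \<in> carrier G \<Longrightarrow> r\<^sub>1 (x \<otimes> y) = r\<^sub>1 x ** r\<^sub>1 y"
    and hom2: "\<And>x y. x \<in> carrier G \<Longrightarrow> y \<in> carrier G \<Longrightarrow> r\<^sub>2 (x \<otimes> y) = r\<^sub>2 x ** r\<^sub>2 y"
    and det1: "\<And>x. x \<in> carrier G \<Longrightarrow> det (r\<^sub>1 x) = 1"
    and det2: "\<And>x. x \<in> carrier G \<Longrightarrow> det (r\<^sub>2 x) = 1"
    and kernels: "\<And>x. x \<in> carrier G \<Longrightarrow> r\<^sub>1 x = mat 1 \<longleftrightarrow> r\<^sub>2 x = mat 1"
    and finite1: "finite (r\<^sub>1 ` carrier G)" and finite2: "finite (r\<^sub>2 ` carrier G)"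
    and order1: "\<And>x. x \<in> carrier G \<Longrightarrow>
      (r\<^sub>1 x ** r\<^sub>1 x) ** (r\<^sub>1 x ** r\<^sub>1 x) = mat 1 \<or>
      (r\<^sub>1 x ** r\<^sub>1 x ** r\<^sub>1 x) ** (r\<^sub>1 x ** r\<^sub>1 x ** r\<^sub>1 x) = mat 1"
begin

lemma rep_one: "r\<^sub>1 \<one> = mat 1" "r\<^sub>2 \<one> = mat 1"
proof -
  have "A = mat 1" if "A ** A = A" "det A = 1" for A :: "complex^2^2"
  proof -
    have "invertible A" using that(2) by (simp add: invertible_det_nz)
    then obtain B where "B ** A = mat 1" unfolding invertible_def by blast
    then have "A = B ** (A ** A)" by (simp add: matrix_mul_assoc)
    also have "\<dots> = mat 1" unfolding that(1) by fact
    finally show ?thesis .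
  qed
  then show "r\<^sub>1 \<one> = mat 1" "r\<^sub>2 \<one> = mat 1"
    using hom1[of \<one> \<one>] hom2[of \<one> \<one>] det1[of \<one>] det2[of \<one>] by auto
qed

lemma rep_inv:
  assumes "x \<in> carrier G"
  shows "r\<^sub>1 x ** r\<^sub>1 (inv x) = mat 1" "r\<^sub>1 (inv x) ** r\<^sub>1 x = mat 1"
    "r\<^sub>2 x ** r\<^sub>2 (inv x) = mat 1" "r\<^sub>2 (inv x) ** r\<^sub>2 x = mat 1"
  using assms hom1[of x "inv x"] hom1[of "inv x" x] hom2[of x "inv x"] hom2[of "inv x" x] rep_one by auto

text \<open>Equal kernels carry the condition \<open>order1\<close> over to the second
  representation, so that \<open>SL2_trace_by_order\<close> applies to both and gives the same
  value.\<close>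

lemma words_trivial_iff:
  assumes "x \<in> carrier G"
  shows "r\<^sub>1 x ** r\<^sub>1 x = mat 1 \<longleftrightarrow> r\<^sub>2 x ** r\<^sub>2 x = mat 1"
    "r\<^sub>1 x ** r\<^sub>1 x ** r\<^sub>1 x = mat 1 \<longleftrightarrow> r\<^sub>2 x ** r\<^sub>2 x ** r\<^sub>2 x = mat 1"
    "(r\<^sub>1 x ** r\<^sub>1 x) ** (r\<^sub>1 x ** r\<^sub>1 x) = mat 1 \<longleftrightarrow> (r\<^sub>2 x ** r\<^sub>2 x) ** (r\<^sub>2 x ** r\<^sub>2 x) = mat 1"
    "(r\<^sub>1 x ** r\<^sub>1 x ** r\<^sub>1 x) ** (r\<^sub>1 x ** r\<^sub>1 x ** r\<^sub>1 x) = mat 1 \<longleftrightarrow>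
     (r\<^sub>2 x ** r\<^sub>2 x ** r\<^sub>2 x) ** (r\<^sub>2 x ** r\<^sub>2 x ** r\<^sub>2 x) = mat 1"
  using kernels[of "x \<otimes> x"] kernels[of "x \<otimes> x \<otimes> x"] kernels[of "(x \<otimes> x) \<otimes> (x \<otimes> x)"]
    kernels[of "(x \<otimes> x \<otimes> x) \<otimes> (x \<otimes> x \<otimes> x)"] assms
  by (simp_all add: hom1 hom2)

lemma traces:
  assumes "x \<in> carrier G"
  shows "trace (r\<^sub>1 x) = (if r\<^sub>1 x = mat 1 then 2 else if r\<^sub>1 x ** r\<^sub>1 x = mat 1 then - 2
      else if (r\<^sub>1 x ** r\<^sub>1 x) ** (r\<^sub>1 x ** r\<^sub>1 x) = mat 1 then 0
      else if r\<^sub>1 x ** r\<^sub>1 x ** r\<^sub>1 x = mat 1 then - 1 else 1)"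
    and "trace (r\<^sub>2 x) = trace (r\<^sub>1 x)"
proof -
  note ord = order1[OF assms]
  note w = words_trivial_iff[OF assms]
  show t: "trace (r\<^sub>1 x) = (if r\<^sub>1 x = mat 1 then 2 else if r\<^sub>1 x ** r\<^sub>1 x = mat 1 then - 2
      else if (r\<^sub>1 x ** r\<^sub>1 x) ** (r\<^sub>1 x ** r\<^sub>1 x) = mat 1 then 0
      else if r\<^sub>1 x ** r\<^sub>1 x ** r\<^sub>1 x = mat 1 then - 1 else 1)"
    by (rule SL2_trace_by_order[OF det1[OF assms] ord])
  show "trace (r\<^sub>2 x) = trace (r\<^sub>1 x)"
    unfolding t SL2_trace_by_order[OF det2[OF assms] ord[unfolded w(3,4)]]
    by (simp only: w(1-3)[symmetric] kernels[OF assms, symmetric] w(2)[symmetric])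
qed

lemma trace_eq_2_iff: "x \<in> carrier G \<Longrightarrow> trace (r\<^sub>1 x) = 2 \<longleftrightarrow> r\<^sub>1 x = mat 1"
  unfolding traces(1) by auto

text \<open>This stands for the quotient of G by the common kernel: equal kernels make the pair
  depend on x exactly through its class. It is finite even when G is not.\<close>

definition graph :: "((complex^2^2) \<times> (complex^2^2)) set" where
  "graph = (\<lambda>x. (r\<^sub>1 (inv x), r\<^sub>2 x)) ` carrier G"

text \<open>Up to the factor \<open>card graph\<close>, this is the projection of E onto the
  intertwiners from the first representation to the second.\<close>

definition average :: "complex^2^2 \<Rightarrow> complex^2^2" where
  "average E = (\<Sum>(A, B)\<in>graph. B ** E ** A)"

lemma finite_graph: "finite graph"
proof (rule finite_subset)
  show "graph \<subseteq> r\<^sub>1 ` carrier G \<times> r\<^sub>2 ` carrier G" unfolding graph_def by auto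
  show "finite (r\<^sub>1 ` carrier G \<times> r\<^sub>2 ` carrier G)" using finite1 finite2 by simp
qed

lemma average_intertwines:
  assumes s: "s \<in> carrier G"
  shows "average E ** r\<^sub>1 s = r\<^sub>2 s ** average E"
proof -
  \<comment> \<open>Translation by a group element permutes the pairs; this is what reindexes the
    sum.\<close>
  have closed: "(A ** r\<^sub>1 (inv u), r\<^sub>2 u ** B) \<in> graph" if "(A, B) \<in> graph" "u \<in> carrier G" for A B u
  proof -
    obtain x where "x \<in> carrier G" "A = r\<^sub>1 (inv x)" "B = r\<^sub>2 x" using \<open>(A, B) \<in> graph\<close> unfolding graph_def by auto
    then show ?thesis unfolding graph_def using that(2)
      by (intro image_eqI[of _ _ "u \<otimes> x"]) (simp_all add: hom1 hom2 inv_mult_group)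
  qed
  have "r\<^sub>2 s ** average E ** r\<^sub>1 (inv s) = (\<Sum>(A, B)\<in>graph. (r\<^sub>2 s ** B) ** E ** (A ** r\<^sub>1 (inv s)))"
    unfolding average_def mat2_mult_sum by (simp add: case_prod_unfold matrix_mul_assoc)
  also have "\<dots> = average E"
    unfolding average_def
  proof (rule sum.reindex_bij_witness[where j = "\<lambda>(A, B). (A ** r\<^sub>1 (inv s), r\<^sub>2 s ** B)"
        and i = "\<lambda>(A, B). (A ** r\<^sub>1 s, r\<^sub>2 (inv s) ** B)"], goal_cases)
    case (1 a)
    show ?case
      by (cases a) (simp add: matrix_mul_assoc[symmetric] rep_inv[OF s], simp add: matrix_mul_assoc rep_inv[OF s])
  next
    case (2 a)
    then show ?case using closed[OF _ s] by (cases a) simp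
  next
    case (3 a)
    show ?case
      by (cases a) (simp add: matrix_mul_assoc[symmetric] rep_inv[OF s], simp add: matrix_mul_assoc rep_inv[OF s])
  next
    case (4 a)
    then show ?case using closed[of _ _ "inv s"] s by (cases a) simp
  next
    case (5 a)
    show ?case by (cases a) simp
  qed
  finally have "r\<^sub>2 s ** average E ** (r\<^sub>1 (inv s) ** r\<^sub>1 s) = average E ** r\<^sub>1 s"
    by (simp add: matrix_mul_assoc)
  then show ?thesis unfolding rep_inv[OF s] by simp
qed

definition matrix_unit :: "2 \<Rightarrow> 2 \<Rightarrow> complex^2^2" where
  "matrix_unit k l = (\<chi> i j. if i = k \<and> j = l then 1 else 0)"

lemma sandwich_matrix_unit: "(B ** matrix_unit k l ** A) $ k $ l = B $ k $ k * A $ l $ l"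
  using exhaust_2[of k] exhaust_2[of l]
  by (auto simp: mat2_mult matrix_unit_def)

text \<open>
  The matrix coefficients of the averages add up to the scalar product of the two characters,
  which agree.
\<close>

lemma average_nonzero: "\<exists>k l. average (matrix_unit k l) \<noteq> 0"
proof (rule ccontr)
  assume "\<not> ?thesis"
  then have zero: "average (matrix_unit k l) $ k $ l = 0" for k l by simp
  have coeff: "average (matrix_unit k l) $ k $ l = (\<Sum>(A, B)\<in>graph. B $ k $ k * A $ l $ l)" for k l
    unfolding average_def by (simp add: sum_component case_prod_unfold sandwich_matrix_unit)
  define f :: "(complex^2^2) \<times> (complex^2^2) \<Rightarrow> complex"
    where "f = (\<lambda>(A, B). trace B * trace A)"
  have "0 = average (matrix_unit 1 1) $ 1 $ 1 + average (matrix_unit 1 2) $ 1 $ 2 +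
      average (matrix_unit 2 1) $ 2 $ 1 + average (matrix_unit 2 2) $ 2 $ 2"
    unfolding zero by simp
  also have "\<dots> = sum f graph"
    unfolding coeff f_def sum.distrib[symmetric]
    by (rule sum.cong) (auto simp: trace_2 algebra_simps)
  finally have sum: "sum f graph = 0" by simp
  have f: "f (r\<^sub>1 (inv x), r\<^sub>2 x) = trace (r\<^sub>1 x) * trace (r\<^sub>1 x)" if x: "x \<in> carrier G" for x
    unfolding f_def using trace_inverse_SL2[OF rep_inv(1)[OF x] det1[OF x]] traces(2)[OF x] by simp
  \<comment> \<open>A matrix and its inverse have the same trace, and the two characters agree, so
    each summand is the square of an integer.\<close>
  have pos: "Re (f q) \<ge> 0" if q: "q \<in> graph" for q
  proof -
    obtain x where x: "x \<in> carrier G" "q = (r\<^sub>1 (inv x), r\<^sub>2 x)" using q unfolding graph_def by auto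
    have "trace (r\<^sub>1 x) \<in> {2, - 2, 0, - 1, 1}" unfolding traces(1)[OF x(1)] by auto
    then show ?thesis unfolding x(2) f[OF x(1)] by auto
  qed
  \<comment> \<open>The identity alone contributes 2 * 2 = 4, so the sum cannot vanish.\<close>
  have one: "(r\<^sub>1 (inv \<one>), r\<^sub>2 \<one>) \<in> graph" unfolding graph_def by (intro imageI) simp
  have "Re (f (r\<^sub>1 (inv \<one>), r\<^sub>2 \<one>)) \<le> (\<Sum>q\<in>graph. Re (f q))"
    by (rule member_le_sum[OF one _ finite_graph]) (use pos in auto)
  moreover have "Re (f (r\<^sub>1 (inv \<one>), r\<^sub>2 \<one>)) = 4"
    by (simp only: f[OF one_closed]) (simp add: rep_one trace_2 mat2_entries)
  ultimately have "Re (sum f graph) \<ge> 4" by simp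
  then show False unfolding sum by simp
qed

lemma singular_intertwiner_imp_commute:
  assumes P: "\<And>x. x \<in> carrier G \<Longrightarrow> P ** r\<^sub>1 x = r\<^sub>2 x ** P" "P \<noteq> 0" "det P = 0"
    and x: "x \<in> carrier G" and y: "y \<in> carrier G"
  shows "r\<^sub>1 x ** r\<^sub>1 y = r\<^sub>1 y ** r\<^sub>1 x"
proof -
  obtain v where v: "v \<noteq> 0" "P *v v = 0" "\<And>w. P *v w = 0 \<Longrightarrow> \<exists>c. w = c *s v"
    using singular_mat2_kernel[OF P(2,3)] by blast
  have eigen: "\<exists>c. r\<^sub>1 z *v v = c *s v" if "z \<in> carrier G" for z
  proof (rule v(3))
    have "P *v (r\<^sub>1 z *v v) = r\<^sub>2 z *v (P *v v)"
      unfolding matrix_vector_mul_assoc P(1)[OF that] ..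
    then show "P *v (r\<^sub>1 z *v v) = 0" by (simp add: v(2))
  qed
  obtain a b a' b' where e: "r\<^sub>1 x *v v = a *s v" "r\<^sub>1 y *v v = b *s v"
      "r\<^sub>1 (inv x) *v v = a' *s v" "r\<^sub>1 (inv y) *v v = b' *s v"
    using eigen[OF x] eigen[OF y] eigen[OF inv_closed[OF x]] eigen[OF inv_closed[OF y]] by blast
  define c where "c = x \<otimes> y \<otimes> inv x \<otimes> inv y"
  have c: "c \<in> carrier G" unfolding c_def using x y by simp
  have rc: "r\<^sub>1 c = r\<^sub>1 x ** r\<^sub>1 y ** r\<^sub>1 (inv x) ** r\<^sub>1 (inv y)"
    unfolding c_def using x y by (simp add: hom1)
  \<comment> \<open>The eigenvalues of x and of its inverse on v cancel, and so do those of y; hence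
    the commutator fixes v.\<close>
  have "r\<^sub>1 c *v v = (a * b * a' * b') *s v"
    unfolding rc matrix_vector_mul_assoc[symmetric] e vector_scalar_commute
    by (simp add: vector_smult_assoc mult_ac)
  moreover have "(a * a') *s v = v"
  proof -
    have "v = (r\<^sub>1 x ** r\<^sub>1 (inv x)) *v v" unfolding rep_inv[OF x] by simp
    also have "\<dots> = (a * a') *s v"
      unfolding matrix_vector_mul_assoc[symmetric] e vector_scalar_commute
      by (simp add: vector_smult_assoc mult_ac)
    finally show ?thesis by simp
  qed
  moreover have "(b * b') *s v = v"
  proof -
    have "v = (r\<^sub>1 y ** r\<^sub>1 (inv y)) *v v" unfolding rep_inv[OF y] by simp
    also have "\<dots> = (b * b') *s v"
      unfolding matrix_vector_mul_assoc[symmetric] e vector_scalar_commute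
      by (simp add: vector_smult_assoc mult_ac)
    finally show ?thesis by simp
  qed
  moreover have "(a * b * a' * b') *s v = (a * a') *s ((b * b') *s v)"
    by (simp add: vector_smult_assoc mult_ac)
  ultimately have "r\<^sub>1 c *v v = v" by simp
  then have "r\<^sub>1 c = mat 1"
    using trace_SL2_fixed_vector[OF det1[OF c] _ v(1)] trace_eq_2_iff[OF c] by simp
  moreover have "inv y \<otimes> (y \<otimes> x) = x" using x y by (simp flip: m_assoc)
  then have "c \<otimes> (y \<otimes> x) = x \<otimes> y" unfolding c_def using x y by (simp add: m_assoc)
  then have "r\<^sub>1 (x \<otimes> y) = r\<^sub>1 c ** r\<^sub>1 (y \<otimes> x)" using hom1[OF c, of "y \<otimes> x"] x y by simp
  ultimately show ?thesis using x y by (simp add: hom1)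
qed

lemma intertwiner_of_commute:
  assumes comm: "\<And>x y. x \<in> carrier G \<Longrightarrow> y \<in> carrier G \<Longrightarrow> r\<^sub>1 x ** r\<^sub>1 y = r\<^sub>1 y ** r\<^sub>1 x"
  shows "\<exists>P. invertible P \<and> (\<forall>x\<in>carrier G. P ** r\<^sub>1 x = r\<^sub>2 x ** P)"
proof -
  have comm2: "r\<^sub>2 x ** r\<^sub>2 y = r\<^sub>2 y ** r\<^sub>2 x" if x: "x \<in> carrier G" and y: "y \<in> carrier G" for x y
  proof -
    \<comment> \<open>The commutator lies in the first kernel, hence in the second.\<close>
    define c where "c = x \<otimes> y \<otimes> inv (y \<otimes> x)"
    have c: "c \<in> carrier G" unfolding c_def using x y by simp
    have "r\<^sub>1 c = r\<^sub>1 (y \<otimes> x) ** r\<^sub>1 (inv (y \<otimes> x))"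
      unfolding c_def using x y comm[OF x y] by (simp add: hom1 del: inv_mult_group)
    also have "\<dots> = mat 1" using x y by (intro rep_inv) simp
    finally have "r\<^sub>2 c = mat 1" using kernels[OF c] by simp
    moreover have "x \<otimes> y = c \<otimes> (y \<otimes> x)" unfolding c_def using x y by (simp add: m_assoc)
    then have "r\<^sub>2 (x \<otimes> y) = r\<^sub>2 c ** r\<^sub>2 (y \<otimes> x)" using hom2[OF c, of "y \<otimes> x"] x y by simp
    ultimately show ?thesis using x y by (simp add: hom2)
  qed
  \<comment> \<open>In SL_2 the matrix -1 is the only element of order two, so the kernel of a
    representation also determines which elements map to -1.\<close>
  have minus_one: "r\<^sub>1 x = mat (- 1) \<longleftrightarrow> r\<^sub>2 x = mat (- 1)" if x: "x \<in> carrier G" for x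
  proof -
    have "A = mat (- 1) \<longleftrightarrow> A ** A = mat 1 \<and> A \<noteq> mat 1" if "det A = 1" for A :: "complex^2^2"
      using SL2_involution[OF that] by (auto simp: mat2_simps)
    then show ?thesis using det1[OF x] det2[OF x] kernels[OF x] words_trivial_iff(1)[OF x] by metis
  qed
  show ?thesis
  proof (cases "\<forall>x\<in>carrier G. r\<^sub>1 x = mat 1 \<or> r\<^sub>1 x = mat (- 1)")
    case True
    then have "r\<^sub>1 x = r\<^sub>2 x" if "x \<in> carrier G" for x using that kernels minus_one by metis
    then show ?thesis by (intro exI[of _ "mat 1"]) (auto simp: invertible_def)
  next
    case False
    then obtain z where z: "z \<in> carrier G" "r\<^sub>1 z \<noteq> mat 1" "r\<^sub>1 z \<noteq> mat (- 1)" by blast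
    define A B where "A = r\<^sub>1 z" and "B = r\<^sub>2 z"
    have dA: "det A = 1" and dB: "det B = 1" unfolding A_def B_def using z det1 det2 by auto
    have tr: "trace B = trace A" unfolding A_def B_def using traces(2) z(1) .
    have nA: "A $ 1 $ 2 \<noteq> 0 \<or> A $ 2 $ 1 \<noteq> 0 \<or> A $ 1 $ 1 \<noteq> A $ 2 $ 2"
      using scalar_mat2_det_one[OF dA] z unfolding A_def by blast
    have "B \<noteq> mat 1" "B \<noteq> mat (- 1)" using z kernels[OF z(1)] minus_one[OF z(1)] unfolding B_def by auto
    then have nB: "B $ 1 $ 2 \<noteq> 0 \<or> B $ 2 $ 1 \<noteq> 0 \<or> B $ 1 $ 1 \<noteq> B $ 2 $ 2"
      using scalar_mat2_det_one[OF dB] by blast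
    \<comment> \<open>A nonscalar image has order 3, 4 or 6, so its trace is neither 2 nor -2; the
      linear system for the coefficients is then nonsingular.\<close>
    have "A ** A \<noteq> mat 1" using SL2_involution[OF dA] z unfolding A_def by blast
    then have "trace A \<in> {0, - 1, 1}" using traces(1)[OF z(1)] z(2) unfolding A_def by auto
    then have disc: "trace A ^ 2 \<noteq> 4" by auto
    obtain Q where Q: "invertible Q" "Q ** A = B ** Q"
      using SL2_conjugate_of_trace_eq[OF dA nA dB nB tr[symmetric]] by blast
    have "Q ** r\<^sub>1 x = r\<^sub>2 x ** Q" if x: "x \<in> carrier G" for x
    proof -
      obtain a b where ab: "r\<^sub>1 x = mat a ** A + mat b"
        using commute_nonscalar_mat2[OF _ nA, of "r\<^sub>1 x"] comm[OF z(1) x] unfolding A_def by blast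
      obtain a' b' where ab': "r\<^sub>2 x = mat a' ** B + mat b'"
        using commute_nonscalar_mat2[OF _ nB, of "r\<^sub>2 x"] comm2[OF z(1) x] unfolding B_def by blast
      have t: "trace (mat c ** C + mat d) = c * trace C + 2 * d" for C :: "complex^2^2" and c d
        by (simp add: trace_2 mat2_mult mat2_entries algebra_simps)
      have t2: "trace ((mat c ** C + mat d) ** C) = c * (trace C ^ 2 - 2) + d * trace C"
        if "det C = 1" for C :: "complex^2^2" and c d
      proof -
        have "(mat c ** C + mat d) ** C = mat (c * trace C + d) ** C + mat (- c)"
          using mult_lin_comb_mat2[OF that, of c d 1 0] by (simp add: mat2_simps)
        then show ?thesis by (simp only: t) (simp add: algebra_simps power2_eq_square)
      qed
      have e1: "a * trace A + 2 * b = a' * trace A + 2 * b'"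
        using traces(2)[OF x] unfolding ab ab' t tr by simp
      have "trace (r\<^sub>2 x ** B) = trace (r\<^sub>1 x ** A)"
        using traces(2)[of "x \<otimes> z"] x z(1) unfolding A_def B_def by (simp add: hom1 hom2)
      then have e2: "a * (trace A ^ 2 - 2) + b * trace A = a' * (trace A ^ 2 - 2) + b' * trace A"
        unfolding ab ab' t2[OF dA] t2[OF dB] tr by simp
      \<comment> \<open>The traces at x and at x z give two linear equations in the coefficients,
        with determinant 4 - t^2 for t = tr A. Eliminating b leaves this equation.\<close>
      have "(a - a') * (trace A ^ 2 - 4) = 0"
        using e1 e2 by Groebner_Basis.algebra
      then have a: "a = a'" using disc by simp
      then have b: "b = b'" using e1 by simp
      have "Q ** (mat a ** A + mat b) = mat a ** (Q ** A) + mat b ** Q"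
        by (simp add: mat2_simps algebra_simps)
      also have "\<dots> = (mat a ** B + mat b) ** Q"
        unfolding Q(2) by (simp add: mat2_simps algebra_simps)
      finally show ?thesis unfolding ab ab' a b .
    qed
    then show ?thesis using Q(1) by blast
  qed
qed

theorem equivalent: "\<exists>P. invertible P \<and> (\<forall>x\<in>carrier G. P ** r\<^sub>1 x = r\<^sub>2 x ** P)"
proof -
  obtain k l where kl: "average (matrix_unit k l) \<noteq> 0" using average_nonzero by blast
  define P where "P = average (matrix_unit k l)"
  have P: "P ** r\<^sub>1 x = r\<^sub>2 x ** P" if "x \<in> carrier G" for x
    unfolding P_def using that by (rule average_intertwines)
  show ?thesis
  proof (cases "det P = 0")
    case True
    show ?thesis
      by (rule intertwiner_of_commute, rule singular_intertwiner_imp_commute[OF P])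
        (use kl True P_def in auto)
  next
    case False
    then show ?thesis using P by (intro exI[of _ P]) (simp add: invertible_det_nz)
  qed
qed

end

section \<open>The base field is unramified over itself\<close>

context
  fixes p :: nat and \<iota> :: "(nat \<Rightarrow> rat) set \<Rightarrow> 'f::field"
  assumes p: "Factorial_Ring.prime p" and \<iota>: "finite_extension_of_Qp p \<iota>"
begin

interpretation Zp: complete_dvr "(to_ac \<circ> \<iota>) ` Zp p" p
  by (rule complete_dvr_Zp[OF p \<iota>])

interpretation Fbar: field "Fbar :: 'f alg_closure ring"
  by (rule field_from_type_algebra)

abbreviation (input) "OF \<equiv> valuation_ring p \<iota> base_field"

lemma OF_simps:
  "x \<otimes>\<^bsub>OF\<^esub> y = x * y" "x \<oplus>\<^bsub>OF\<^esub> y = x + y" "\<one>\<^bsub>OF\<^esub> = 1" "\<zero>\<^bsub>OF\<^esub> = 0"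
  by (simp_all add: valuation_ring_def)

lemma base_field_closed:
  fixes x y :: "'f alg_closure"
  assumes "x \<in> base_field" "y \<in> base_field"
  shows "x + y \<in> base_field" "x * y \<in> base_field" "- x \<in> base_field"
proof -
  obtain a b where ab: "x = to_ac a" "y = to_ac b" using assms unfolding base_field_def by blast
  show "x + y \<in> base_field" "x * y \<in> base_field" "- x \<in> base_field"
    unfolding ab base_field_def by (simp_all flip: to_ac_add to_ac_mult to_ac_minus)
qed

lemma base_field_inverse: "x \<in> base_field \<Longrightarrow> inverse x \<in> (base_field :: 'f alg_closure set)"
  unfolding base_field_def by (auto simp flip: to_ac_inverse)

lemma base_field_one: "1 \<in> (base_field :: 'f alg_closure set)"
  unfolding base_field_def by (auto intro: range_eqI[of _ _ 1])

lemma mem_OF_iff: "x \<in> carrier OF \<longleftrightarrow> x \<in> base_field \<and> Zp.integral x"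
  unfolding valuation_ring_def Zp.integral_def by simp

lemma OF_closed:
  assumes "x \<in> carrier OF" "y \<in> carrier OF"
  shows "x + y \<in> carrier OF" "x * y \<in> carrier OF" "- x \<in> carrier OF"
  using assms base_field_closed Zp.integral_add_mult Zp.integral_uminus unfolding mem_OF_iff by auto

lemma one_mem_OF: "1 \<in> carrier OF"
  unfolding mem_OF_iff using base_field_one Zp.integral_of_mem[OF Zp.one_mem] by blast

lemma ring_OF: "ring OF"
proof -
  have "subring (carrier OF) Fbar"
    by (rule Fbar.subringI) (auto simp: Fbar_a_inv OF_closed one_mem_OF)
  then have "ring (Fbar\<lparr>carrier := carrier OF\<rparr>)" by (rule Fbar.subring_is_ring)
  then show ?thesis by (simp add: valuation_ring_def)
qed

text \<open>The inverse of an element of F lies in F, so only its integrality remains to be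
  tested.\<close>

lemma Units_OF_iff: "x \<in> Units OF \<longleftrightarrow> x \<in> carrier OF \<and> (\<exists>w. Zp.integral w \<and> w * x = 1)"
proof
  assume "x \<in> Units OF"
  then show "x \<in> carrier OF \<and> (\<exists>w. Zp.integral w \<and> w * x = 1)"
    unfolding Units_def OF_simps by (auto simp: mem_OF_iff)
next
  assume x: "x \<in> carrier OF \<and> (\<exists>w. Zp.integral w \<and> w * x = 1)"
  then obtain w where w: "Zp.integral w" "w * x = 1" by blast
  have "x \<noteq> 0" using w(2) by auto
  then have "w = inverse x" using w(2) by (simp add: field_simps)
  then have "w \<in> carrier OF" using w(1) x base_field_inverse unfolding mem_OF_iff by blast
  then show "x \<in> Units OF" using x w(2) unfolding Units_def OF_simps by (auto simp: mult.commute)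
qed

text \<open>Nonunits absorb multiplication in any commutative ring; closure under addition is where
  locality enters.\<close>

lemma ideal_valuation_ideal: "ideal (valuation_ideal p \<iota> base_field) OF"
proof -
  interpret OF: ring OF by (rule ring_OF)
  have inv: "\<ominus>\<^bsub>OF\<^esub> x = - x" if "x \<in> carrier OF" for x
    using that by (intro OF.minus_equality) (auto simp: OF_simps OF_closed)
  have mult: "a * x \<in> valuation_ideal p \<iota> base_field"
    if "x \<in> valuation_ideal p \<iota> base_field" "a \<in> carrier OF" for a x
  proof -
    have "a * x \<notin> Units OF"
    proof
      assume "a * x \<in> Units OF"
      then obtain w where "Zp.integral w" "w * (a * x) = 1" unfolding Units_OF_iff by blast
      then have "Zp.integral (w * a)" "w * a * x = 1"
        using that(2) Zp.integral_add_mult(2) by (auto simp: mem_OF_iff mult.assoc)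
      then have "x \<in> Units OF" using that(1) unfolding Units_OF_iff valuation_ideal_def by blast
      then show False using that(1) unfolding valuation_ideal_def by simp
    qed
    then show ?thesis using that OF_closed(2) unfolding valuation_ideal_def by auto
  qed
  have add: "x + y \<in> valuation_ideal p \<iota> base_field"
    if xy: "x \<in> valuation_ideal p \<iota> base_field" "y \<in> valuation_ideal p \<iota> base_field" for x y
  proof -
    have "x + y \<notin> Units OF"
    proof
      assume "x + y \<in> Units OF"
      then obtain w where w: "Zp.integral w" "w * (x + y) = 1" unfolding Units_OF_iff by blast
      \<comment> \<open>After scaling the sum to 1 the summands are w x and w y = 1 - w x, and one
        of them is a unit.\<close>
      have "Zp.integral (w * x)" using w(1) xy(1) Zp.integral_add_mult(2)
        unfolding valuation_ideal_def by (auto simp: mem_OF_iff)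
      from Zp.integral_closure_local[OF this] obtain v where
        v: "Zp.integral v" "v * (w * x) = 1 \<or> v * (1 - w * x) = 1" by blast
      have "1 - w * x = w * y" using w(2) by (simp add: algebra_simps)
      then have "v * w * x = 1 \<or> v * w * y = 1" using v(2) by (simp add: mult.assoc)
      moreover have "Zp.integral (v * w)" using v(1) w(1) by (rule Zp.integral_add_mult(2))
      ultimately have "x \<in> Units OF \<or> y \<in> Units OF"
        using xy unfolding Units_OF_iff valuation_ideal_def by blast
      then show False using xy unfolding valuation_ideal_def by simp
    qed
    then show ?thesis using xy OF_closed(1) unfolding valuation_ideal_def by auto
  qed
  have zero: "0 \<in> valuation_ideal p \<iota> base_field"
    using OF.zero_closed unfolding valuation_ideal_def by (auto simp: OF_simps Units_OF_iff)
  show ?thesis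
  proof (rule idealI)
    show "subgroup (valuation_ideal p \<iota> base_field) (add_monoid OF)"
    proof
      fix x assume x: "x \<in> valuation_ideal p \<iota> base_field"
      then have "inv\<^bsub>add_monoid OF\<^esub> x = (- 1) * x"
        using inv[of x] unfolding a_inv_def valuation_ideal_def by auto
      also have "\<dots> \<in> valuation_ideal p \<iota> base_field"
        by (rule mult[OF x]) (rule OF_closed(3)[OF one_mem_OF one_mem_OF])
      finally show "inv\<^bsub>add_monoid OF\<^esub> x \<in> valuation_ideal p \<iota> base_field" .
    qed (use add zero in \<open>auto simp: OF_simps valuation_ideal_def\<close>)
    fix a x assume ax: "a \<in> valuation_ideal p \<iota> base_field" "x \<in> carrier OF"
    then show "x \<otimes>\<^bsub>OF\<^esub> a \<in> valuation_ideal p \<iota> base_field" by (simp add: OF_simps mult)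
    then show "a \<otimes>\<^bsub>OF\<^esub> x \<in> valuation_ideal p \<iota> base_field" by (simp add: OF_simps mult.commute)
  qed (rule ring_OF)
qed

text \<open>For E = F the condition \<open>unramified\<close> says that the set of nonunits equals
  the ideal it generates.\<close>

lemma base_field_subset_max_unramified: "base_field \<subseteq> max_unramified p \<iota>"
proof -
  interpret OF: ring OF by (rule ring_OF)
  have "unramified p \<iota> base_field"
    unfolding unramified_def
  proof (rule antisym)
    show "Idl\<^bsub>OF\<^esub> valuation_ideal p \<iota> base_field \<subseteq> valuation_ideal p \<iota> base_field"
      by (rule OF.genideal_minimal[OF ideal_valuation_ideal]) simp
    show "valuation_ideal p \<iota> base_field \<subseteq> Idl\<^bsub>OF\<^esub> valuation_ideal p \<iota> base_field"
      by (rule OF.genideal_self) (auto simp: valuation_ideal_def)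
  qed
  then show ?thesis
    using finite_subextension_base_field
    unfolding max_unramified_def by (auto intro: generate_field.incl)
qed

section \<open>Kernels of inertial types\<close>

lemma inertia_subset_galois: "carrier (inertia_group p \<iota>) \<subseteq> carrier absolute_galois_group"
  unfolding inertia_group_def by (rule galois_group_mono[OF base_field_subset_max_unramified])

lemma inertia_subset_weil: "carrier (inertia_group p \<iota>) \<subseteq> carrier (weil_group p \<iota>)"
proof
  fix \<sigma> assume \<sigma>: "\<sigma> \<in> carrier (inertia_group p \<iota>)"
  have "id \<in> generate absolute_galois_group (frobenius_elements p \<iota>)"
    using generate.one[of absolute_galois_group "frobenius_elements p \<iota>"] by simp
  moreover have "\<forall>x\<in>max_unramified p \<iota>. \<sigma> x = id x"
    using \<sigma> unfolding inertia_group_def mem_galois_group_iff by simp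
  ultimately have "\<exists>\<phi>\<in>generate absolute_galois_group (frobenius_elements p \<iota>). \<forall>x\<in>max_unramified p \<iota>. \<sigma> x = \<phi> x"
    by blast
  then show "\<sigma> \<in> carrier (weil_group p \<iota>)"
    using \<sigma> inertia_subset_galois by (auto simp: weil_group_def)
qed

lemma weil_group_simps: "x \<otimes>\<^bsub>weil_group p \<iota>\<^esub> y = x \<circ> y" "\<one>\<^bsub>weil_group p \<iota>\<^esub> = id"
  by (simp_all add: weil_group_def)

lemma inertial_type_mult:
  assumes "inertial_type p \<iota> \<tau>" "x \<in> carrier (inertia_group p \<iota>)" "y \<in> carrier (inertia_group p \<iota>)"
  shows "\<tau> (x \<circ> y) = \<tau> x ** \<tau> y"
proof -
  interpret I: group "inertia_group p \<iota>" unfolding inertia_group_def by (rule group_galois_group)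
  obtain \<rho> where \<rho>: "\<rho> \<in> hom (weil_group p \<iota>) GL2" "\<tau> = restrict \<rho> (carrier (inertia_group p \<iota>))"
    using assms(1) unfolding inertial_type_def weil_representation_def by blast
  have xy: "x \<circ> y \<in> carrier (inertia_group p \<iota>)"
    using I.m_closed[OF assms(2,3)] by (simp add: inertia_group_def)
  have "\<rho> (x \<circ> y) = \<rho> x ** \<rho> y"
    using hom_mult[OF \<rho>(1), of x y] assms(2,3) inertia_subset_weil by (auto simp: weil_group_simps GL2_def)
  then show ?thesis unfolding \<rho>(2) using assms xy by simp
qed

lemma galois_group_subset_topspace_krull:
  "carrier absolute_galois_group \<subseteq> topspace (krull_topology :: ('f alg_closure \<Rightarrow> 'f alg_closure) topology)"
proof
  fix \<sigma> :: "'f alg_closure \<Rightarrow> 'f alg_closure" assume \<sigma>: "\<sigma> \<in> carrier absolute_galois_group"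
  have "id \<in> carrier (absolute_galois_group :: ('f alg_closure \<Rightarrow> 'f alg_closure) monoid)"
    by (simp add: mem_galois_group_iff)
  then have "\<sigma> \<in> \<sigma> <#\<^bsub>absolute_galois_group\<^esub> carrier absolute_galois_group"
    unfolding l_coset_def by (intro UN_I[of id]) simp_all
  then show "\<sigma> \<in> topspace krull_topology"
    unfolding krull_topology_def topology_generated_by_topspace using \<sigma> finite_subextension_base_field by blast
qed

text \<open>Continuity refers to the Weil topology, whose subbasic sets are translates of Krull-open
  subsets of inertia. A translate that meets inertia is a translate by an element of inertia, so a
  finite test set for the Krull topology can be carried along.\<close>

lemma inertial_type_nbhd:
  assumes \<tau>: "inertial_type p \<iota> \<tau>" and \<sigma>: "\<sigma> \<in> carrier (inertia_group p \<iota>)" "\<tau> \<sigma> \<noteq> mat 1"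
  shows "pointwise_nbhd (carrier (inertia_group p \<iota>)) \<sigma> {\<sigma>' \<in> carrier (inertia_group p \<iota>). \<tau> \<sigma>' \<noteq> mat 1}"
proof -
  let ?I = "carrier (inertia_group p \<iota>)"
  interpret I: group "inertia_group p \<iota>" unfolding inertia_group_def by (rule group_galois_group)
  obtain \<rho> where \<rho>: "\<rho> \<in> hom (weil_group p \<iota>) GL2"
      "continuous_map (weil_topology p \<iota>) (subtopology euclidean (carrier GL2)) \<rho>"
      "\<tau> = restrict \<rho> ?I"
    using \<tau> unfolding inertial_type_def weil_representation_def by blast
  define V where "V = {x \<in> topspace (weil_topology p \<iota>). \<rho> x \<in> carrier GL2 \<inter> - {mat 1}}"
  have "openin (subtopology euclidean (carrier GL2)) (carrier GL2 \<inter> - {mat 1})"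
    by (rule openin_open_Int) (rule open_Compl[OF closed_singleton])
  then have V: "openin (weil_topology p \<iota>) V"
    unfolding V_def by (rule openin_continuous_map_preimage[OF \<rho>(2)])
  have Iopen: "openin (subtopology krull_topology ?I) ?I"
    using galois_group_subset_topspace_krull inertia_subset_galois by (auto simp: openin_subtopology_refl)
  have \<sigma>W: "\<sigma> \<in> carrier (weil_group p \<iota>)" using \<sigma>(1) inertia_subset_weil by blast
  have id: "id \<in> ?I" by (simp add: inertia_group_def mem_galois_group_iff)
  have "\<sigma> \<in> \<sigma> <#\<^bsub>weil_group p \<iota>\<^esub> ?I" unfolding l_coset_def weil_group_simps using id by (intro UN_I[of id]) simp_all
  then have "\<sigma> \<in> topspace (weil_topology p \<iota>)"
    unfolding weil_topology_def topology_generated_by_topspace using \<sigma>W Iopen by blast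
  moreover have "\<rho> \<sigma> \<in> carrier GL2" using hom_in_carrier[OF \<rho>(1) \<sigma>W] .
  ultimately have "\<sigma> \<in> V" unfolding V_def using \<sigma> \<rho>(3) by simp
  have "pointwise_nbhd ?I \<sigma> V"
    using V \<open>\<sigma> \<in> V\<close> unfolding weil_topology_def
  proof (rule pointwise_nbhd_generated)
    fix s assume "s \<in> {\<sigma> <#\<^bsub>weil_group p \<iota>\<^esub> U | \<sigma> U. \<sigma> \<in> carrier (weil_group p \<iota>) \<and>
        openin (subtopology krull_topology ?I) U}" "\<sigma> \<in> s"
    then obtain \<sigma>0 U u where s: "s = \<sigma>0 <#\<^bsub>weil_group p \<iota>\<^esub> U" "\<sigma>0 \<in> carrier (weil_group p \<iota>)"
        "openin (subtopology krull_topology ?I) U" and u: "u \<in> U" "\<sigma> = \<sigma>0 \<circ> u"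
      unfolding l_coset_def weil_group_simps by auto
    obtain U' where U': "openin krull_topology U'" "U = U' \<inter> ?I"
      using s(3) unfolding openin_subtopology by blast
    have uI: "u \<in> ?I" using u U' by blast
    have bu: "bij u" using uI unfolding inertia_group_def mem_galois_group_iff by blast
    have invu: "Hilbert_Choice.inv u \<in> ?I"
      using uI unfolding inertia_group_def by (rule galois_group_inv_mem)
    have "\<sigma>0 = \<sigma> \<circ> Hilbert_Choice.inv u"
      unfolding u(2) using bu by (auto simp: bij_is_surj surj_f_inv_f)
    then have \<sigma>0: "\<sigma>0 \<in> ?I"
      using I.m_closed[OF \<sigma>(1) invu] by (simp add: inertia_group_def)
    then have b0: "bij \<sigma>0" and inv0: "Hilbert_Choice.inv \<sigma>0 \<in> ?I"
      unfolding inertia_group_def using galois_group_inv_mem by (auto simp: mem_galois_group_iff)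
    have "pointwise_nbhd ?I u U'"
      using U' u by (intro pointwise_nbhd_krull inertia_subset_galois) auto
    then obtain T where T: "finite T" "\<And>\<sigma>'. \<sigma>' \<in> ?I \<Longrightarrow> \<forall>x\<in>T. \<sigma>' x = u x \<Longrightarrow> \<sigma>' \<in> U'"
      unfolding pointwise_nbhd_def by blast
    have "\<sigma>' \<in> s" if \<sigma>': "\<sigma>' \<in> ?I" "\<forall>x\<in>T. \<sigma>' x = \<sigma> x" for \<sigma>'
    proof -
      define k where "k = Hilbert_Choice.inv \<sigma>0 \<circ> \<sigma>'"
      have kI: "k \<in> ?I" using I.m_closed[OF inv0 \<sigma>'(1)] unfolding k_def by (simp add: inertia_group_def)
      moreover have "\<forall>x\<in>T. k x = u x"
        unfolding k_def using \<sigma>'(2) u(2) b0 by (auto simp: bij_is_inj inv_f_f)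
      ultimately have "k \<in> U" using T(2) U'(2) by blast
      moreover have "\<sigma>' = \<sigma>0 \<circ> k" unfolding k_def using b0 by (auto simp: bij_is_surj surj_f_inv_f)
      ultimately show ?thesis unfolding s(1) l_coset_def weil_group_simps by auto
    qed
    then show "pointwise_nbhd ?I \<sigma> s" unfolding pointwise_nbhd_def using T(1) by blast
  qed
  moreover have "{\<sigma>' \<in> ?I. \<sigma>' \<in> V} \<subseteq> {\<sigma>' \<in> ?I. \<tau> \<sigma>' \<noteq> mat 1}"
    unfolding V_def \<rho>(3) by auto
  ultimately show ?thesis unfolding pointwise_nbhd_def by blast
qed

lemma inertial_type_one:
  assumes "inertial_type p \<iota> \<tau>" "trivial_determinant p \<iota> \<tau>"
  shows "\<tau> id = mat 1"
proof -
  have id: "id \<in> carrier (inertia_group p \<iota>)" by (simp add: inertia_group_def mem_galois_group_iff)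
  have "invertible (\<tau> id)" using assms(2) id unfolding trivial_determinant_def by (simp add: invertible_det_nz)
  then obtain B where "B ** \<tau> id = mat 1" unfolding invertible_def by blast
  moreover have "\<tau> id ** \<tau> id = \<tau> id" using inertial_type_mult[OF assms(1) id id] by simp
  ultimately show ?thesis by (metis matrix_mul_assoc matrix_mul_lid)
qed

text \<open>An element fixing the fixed field of the kernel is approximated by elements of the
  kernel on every finite set, whereas a value different from 1 persists on a whole neighbourhood.
  The two are incompatible.\<close>

lemma kernel_field_fixer:
  assumes \<tau>: "inertial_type p \<iota> \<tau>" "trivial_determinant p \<iota> \<tau>"
    and \<sigma>: "\<sigma> \<in> carrier (inertia_group p \<iota>)" "\<And>x. x \<in> kernel_field p \<iota> \<tau> \<Longrightarrow> \<sigma> x = x"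
  shows "\<tau> \<sigma> = mat 1"
proof (rule ccontr)
  assume "\<tau> \<sigma> \<noteq> mat 1"
  let ?I = "carrier (inertia_group p \<iota>)"
  interpret I: group "inertia_group p \<iota>" unfolding inertia_group_def by (rule group_galois_group)
  obtain T where T: "finite T" "\<And>\<sigma>'. \<sigma>' \<in> ?I \<Longrightarrow> \<forall>x\<in>T. \<sigma>' x = \<sigma> x \<Longrightarrow> \<tau> \<sigma>' \<noteq> mat 1"
    using inertial_type_nbhd[OF \<tau>(1) \<sigma>(1) \<open>\<tau> \<sigma> \<noteq> mat 1\<close>] unfolding pointwise_nbhd_def by auto
  define H where "H = kernel (inertia_group p \<iota>) GL2 \<tau>"
  have H: "h \<in> H \<longleftrightarrow> h \<in> ?I \<and> \<tau> h = mat 1" for h unfolding H_def kernel_def GL2_def by simp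
  have "\<exists>h\<in>H. \<forall>x\<in>T. h x = \<sigma> x"
  proof (rule agrees_with_subgroup_on_finite[OF _ _ _ _ _ T(1)])
    show "H \<subseteq> carrier absolute_galois_group" using H inertia_subset_galois by blast
    show "id \<in> H" unfolding H using inertial_type_one[OF \<tau>] by (simp add: inertia_group_def mem_galois_group_iff)
    show "g \<circ> h \<in> H" if "g \<in> H" "h \<in> H" for g h
      using that I.m_closed[of g h] inertial_type_mult[OF \<tau>(1), of g h] unfolding H
      by (simp add: inertia_group_def)
    show "\<sigma> \<in> carrier absolute_galois_group" using \<sigma>(1) inertia_subset_galois by blast
    show "\<sigma> x = x" if "\<forall>h\<in>H. h x = x" for x
      using that \<sigma>(2)[of x] unfolding kernel_field_def H_def by simp
  qed
  then show False using T(2) H by blast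
qed

text \<open>The kernel is recovered from its field as the set of elements of inertia fixing that
  field pointwise.\<close>

lemma kernel_eq_of_kernel_field_eq:
  assumes \<tau>1: "inertial_type p \<iota> \<tau>\<^sub>1" "trivial_determinant p \<iota> \<tau>\<^sub>1"
    and \<tau>2: "inertial_type p \<iota> \<tau>\<^sub>2" "trivial_determinant p \<iota> \<tau>\<^sub>2"
    and eq: "kernel_field p \<iota> \<tau>\<^sub>1 = kernel_field p \<iota> \<tau>\<^sub>2"
    and \<sigma>: "\<sigma> \<in> carrier (inertia_group p \<iota>)"
  shows "\<tau>\<^sub>1 \<sigma> = mat 1 \<longleftrightarrow> \<tau>\<^sub>2 \<sigma> = mat 1"
proof -
  have fix_iff: "\<tau> \<sigma> = mat 1 \<longleftrightarrow> (\<forall>x\<in>kernel_field p \<iota> \<tau>. \<sigma> x = x)"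
    if \<tau>: "inertial_type p \<iota> \<tau>" "trivial_determinant p \<iota> \<tau>" for \<tau>
    using kernel_field_fixer[OF \<tau> \<sigma>] \<sigma> unfolding kernel_field_def kernel_def GL2_def by auto
  show ?thesis unfolding fix_iff[OF \<tau>1] fix_iff[OF \<tau>2] eq ..
qed

end

section \<open>Orders of elements in the admissible images\<close>

text \<open>In a group these are the orders 1, 2, 3, 4 and 6. The powers are spelled out as products
  to match \<open>order1\<close> and to be evaluated directly in the concrete groups.\<close>

definition elements_of_order_dvd_4_or_6 :: "('a, 'b) monoid_scheme \<Rightarrow> bool" where
  "elements_of_order_dvd_4_or_6 G \<longleftrightarrow>
     (\<forall>x\<in>carrier G. (x \<otimes>\<^bsub>G\<^esub> x) \<otimes>\<^bsub>G\<^esub> (x \<otimes>\<^bsub>G\<^esub> x) = \<one>\<^bsub>G\<^esub> \<or>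
       (x \<otimes>\<^bsub>G\<^esub> x \<otimes>\<^bsub>G\<^esub> x) \<otimes>\<^bsub>G\<^esub> (x \<otimes>\<^bsub>G\<^esub> x \<otimes>\<^bsub>G\<^esub> x) = \<one>\<^bsub>G\<^esub>)"

lemma elements_of_order_dvd_4_or_6_iso:
  fixes G :: "('a, 'b) monoid_scheme" (structure)
  assumes "group G" "G \<cong> H" "elements_of_order_dvd_4_or_6 H"
  shows "elements_of_order_dvd_4_or_6 G"
proof -
  interpret group G by fact
  obtain \<phi> where \<phi>: "\<phi> \<in> hom G H" "bij_betw \<phi> (carrier G) (carrier H)"
    using assms(2) unfolding is_iso_def iso_def by blast
  have inj: "\<phi> x = \<phi> y \<Longrightarrow> x = y" if "x \<in> carrier G" "y \<in> carrier G" for x y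
    using \<phi>(2) that unfolding bij_betw_def inj_on_def by blast
  note mult = hom_mult[OF \<phi>(1)]
  \<comment> \<open>H is only given as a monoid record, so preservation of the unit needs an
    argument: \<phi> \<one> is idempotent, hence equal to its own fourth and sixth powers, and one
    of these is the unit of H by the order condition.\<close>
  have one: "\<phi> \<one> = \<one>\<^bsub>H\<^esub>"
    using mult[of \<one> \<one>] assms(3) hom_in_carrier[OF \<phi>(1) one_closed]
    unfolding elements_of_order_dvd_4_or_6_def by auto
  show ?thesis unfolding elements_of_order_dvd_4_or_6_def
  proof
    fix x assume x: "x \<in> carrier G"
    have "\<phi> ((x \<otimes> x) \<otimes> (x \<otimes> x)) = \<phi> \<one> \<or> \<phi> ((x \<otimes> x \<otimes> x) \<otimes> (x \<otimes> x \<otimes> x)) = \<phi> \<one>"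
      using assms(3) hom_in_carrier[OF \<phi>(1) x] x unfolding elements_of_order_dvd_4_or_6_def
      by (simp add: mult one)
    then show "(x \<otimes> x) \<otimes> (x \<otimes> x) = \<one> \<or> (x \<otimes> x \<otimes> x) \<otimes> (x \<otimes> x \<otimes> x) = \<one>"
      using inj x by (meson m_closed one_closed)
  qed
qed

lemma integer_mod_group_orders:
  assumes "n \<in> {2, 3, 4, 6 :: nat}"
  shows "elements_of_order_dvd_4_or_6 (integer_mod_group n)" "finite (carrier (integer_mod_group n))"
proof -
  have four: "((x + x) mod m + (x + x) mod m) mod m = (4 * x) mod m" for x m :: int
    by (simp add: mod_simps)
  have six: "(((x + x) mod m + x) mod m + ((x + x) mod m + x) mod m) mod m = (6 * x) mod m" for x m :: int
    by (simp add: mod_simps)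
  have "4 * x mod int n = 0 \<or> 6 * x mod int n = 0" for x :: int
    using assms by (auto; presburger)
  then show "elements_of_order_dvd_4_or_6 (integer_mod_group n)"
    unfolding elements_of_order_dvd_4_or_6_def mult_integer_mod_group one_integer_mod_group four six
    by blast
  show "finite (carrier (integer_mod_group n))"
    using assms by (auto simp: carrier_integer_mod_group)
qed

text \<open>Elements over an odd h square to (0, 2) and so have order 4; those over an even h lie in
  a cyclic subgroup of order 6.\<close>

lemma C3_semidirect_C4_orders:
  "elements_of_order_dvd_4_or_6 C3_semidirect_C4" "finite (carrier C3_semidirect_C4)"
proof -
  have c: "{0..<3 :: int} = {0, 1, 2}" "{0..<4 :: int} = {0, 1, 2, 3}" by auto
  have carr: "carrier C3_semidirect_C4 = {0, 1, 2} \<times> {0, 1, 2, 3}"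
    unfolding C3_semidirect_C4_def semidirect_product_def by (simp add: carrier_integer_mod_group c)
  show "finite (carrier C3_semidirect_C4)" unfolding carr by simp
  show "elements_of_order_dvd_4_or_6 C3_semidirect_C4"
    unfolding elements_of_order_dvd_4_or_6_def
  proof
    fix x assume "x \<in> carrier C3_semidirect_C4"
    then obtain g h where x: "x = (g, h)" "g = 0 \<or> g = 1 \<or> g = 2" "h = 0 \<or> h = 1 \<or> h = 2 \<or> h = 3"
      unfolding carr by blast
    have mult: "(a, b) \<otimes>\<^bsub>C3_semidirect_C4\<^esub> (c, d) = ((a + (- 1) ^ nat b * c mod 3) mod 3, (b + d) mod 4)"
      for a b c d :: int
      by (simp add: C3_semidirect_C4_def semidirect_product_def)
    have one: "\<one>\<^bsub>C3_semidirect_C4\<^esub> = (0, 0)" by (simp add: C3_semidirect_C4_def semidirect_product_def)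
    have "nat 3 = 3" "nat 2 = 2" by simp_all
    with x(2,3) show "x \<otimes>\<^bsub>C3_semidirect_C4\<^esub> x \<otimes>\<^bsub>C3_semidirect_C4\<^esub> (x \<otimes>\<^bsub>C3_semidirect_C4\<^esub> x) = \<one>\<^bsub>C3_semidirect_C4\<^esub> \<or>
      x \<otimes>\<^bsub>C3_semidirect_C4\<^esub> x \<otimes>\<^bsub>C3_semidirect_C4\<^esub> x \<otimes>\<^bsub>C3_semidirect_C4\<^esub>
        (x \<otimes>\<^bsub>C3_semidirect_C4\<^esub> x \<otimes>\<^bsub>C3_semidirect_C4\<^esub> x) = \<one>\<^bsub>C3_semidirect_C4\<^esub>"
      unfolding x(1) mult one by (elim disjE) simp_all
  qed
qed

lemma Q8_orders: "elements_of_order_dvd_4_or_6 Q8" "finite (carrier Q8)"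
  by (simp_all add: elements_of_order_dvd_4_or_6_def Q8_def)

text \<open>The trace t decides without listing the group: by \<open>SL2_powers\<close>, t = 0 gives
  A^4 = 1 and t^2 = 1 gives A^6 = 1.\<close>

lemma SL2_F3_orders: "elements_of_order_dvd_4_or_6 SL2_F3" "finite (carrier SL2_F3)"
proof -
  show "elements_of_order_dvd_4_or_6 SL2_F3"
    unfolding elements_of_order_dvd_4_or_6_def
  proof
    fix A assume "A \<in> carrier SL2_F3"
    then have A: "det A = 1" unfolding SL2_F3_def by simp
    have zero: "mat 0 ** A + mat 1 = mat 1" by (simp add: mat2_simps)
    have "(A ** A) ** (A ** A) = mat 1 \<or> (A ** A ** A) ** (A ** A ** A) = mat 1"
    proof -
      have three: "(3 :: 3) = 0" by simp
      \<comment> \<open>For trace 2 the coefficients of A^6 come out as 6 and -5, which have to be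
        reduced modulo 3.\<close>
      have "(6 :: 3) = 3 + 3" "(5 :: 3) = 3 + 3 - 1" by simp_all
      then have arith: "(6 :: 3) = 0" "(5 :: 3) = - 1" unfolding three by simp_all
      consider "trace A = 1" | "trace A = 2" | "trace A = 0" using exhaust_3[of "trace A"] three by auto
      then show ?thesis
        unfolding SL2_powers(3,4)[OF A] by cases (simp_all add: zero arith)
    qed
    then show "A \<otimes>\<^bsub>SL2_F3\<^esub> A \<otimes>\<^bsub>SL2_F3\<^esub> (A \<otimes>\<^bsub>SL2_F3\<^esub> A) = \<one>\<^bsub>SL2_F3\<^esub> \<or>
        A \<otimes>\<^bsub>SL2_F3\<^esub> A \<otimes>\<^bsub>SL2_F3\<^esub> A \<otimes>\<^bsub>SL2_F3\<^esub> (A \<otimes>\<^bsub>SL2_F3\<^esub> A \<otimes>\<^bsub>SL2_F3\<^esub> A) = \<one>\<^bsub>SL2_F3\<^esub>"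
      unfolding SL2_F3_def by simp
  qed
  show "finite (carrier SL2_F3)" by simp
qed

lemma admissible_image_orders:
  assumes "group G" "admissible_image p G"
  shows "elements_of_order_dvd_4_or_6 G" "finite (carrier G)"
proof -
  have "elements_of_order_dvd_4_or_6 G \<and> finite (carrier G)"
    using assms(2) unfolding admissible_image_def
  proof (elim disjE bexE conjE)
    fix n :: nat assume n: "n \<in> {2, 3, 4, 6}" and iso: "G \<cong> integer_mod_group n"
    show ?thesis
      using elements_of_order_dvd_4_or_6_iso[OF assms(1) iso integer_mod_group_orders(1)[OF n]]
        iso_finite[OF iso] integer_mod_group_orders(2)[OF n] by simp
  next
    assume iso: "G \<cong> C3_semidirect_C4"
    show ?thesis
      using elements_of_order_dvd_4_or_6_iso[OF assms(1) iso C3_semidirect_C4_orders(1)]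
        iso_finite[OF iso] C3_semidirect_C4_orders(2) by simp
  next
    assume iso: "G \<cong> Q8"
    show ?thesis
      using elements_of_order_dvd_4_or_6_iso[OF assms(1) iso Q8_orders(1)]
        iso_finite[OF iso] Q8_orders(2) by simp
  next
    assume iso: "G \<cong> SL2_F3"
    show ?thesis
      using elements_of_order_dvd_4_or_6_iso[OF assms(1) iso SL2_F3_orders(1)]
        iso_finite[OF iso] SL2_F3_orders(2) by simp
  qed
  then show "elements_of_order_dvd_4_or_6 G" "finite (carrier G)" by simp_all
qed

context
  fixes p :: nat and \<iota> :: "(nat \<Rightarrow> rat) set \<Rightarrow> 'f::field"
    and \<tau> :: "('f alg_closure \<Rightarrow> 'f alg_closure) \<Rightarrow> complex^2^2"
  assumes p: "Factorial_Ring.prime p" and \<iota>: "finite_extension_of_Qp p \<iota>"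
    and \<tau>: "inertial_type p \<iota> \<tau>" "trivial_determinant p \<iota> \<tau>"
begin

text \<open>Prepares \<open>admissible_image_orders\<close>, which pulls identities back along an
  isomorphism out of a group.\<close>

lemma group_type_image: "group (type_image p \<iota> \<tau>)"
proof -
  interpret I: group "inertia_group p \<iota>" unfolding inertia_group_def by (rule group_galois_group)
  have id: "id \<in> carrier (inertia_group p \<iota>)" by (simp add: inertia_group_def mem_galois_group_iff)
  have closed: "x \<circ> y \<in> carrier (inertia_group p \<iota>)"
    if "x \<in> carrier (inertia_group p \<iota>)" "y \<in> carrier (inertia_group p \<iota>)" for x y
    using I.m_closed[OF that] by (simp add: inertia_group_def)
  note mult = inertial_type_mult[OF p \<iota> \<tau>(1)]
  note one = inertial_type_one[OF p \<iota> \<tau>]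
  show ?thesis
  proof (rule groupI)
    fix A B assume "A \<in> carrier (type_image p \<iota> \<tau>)" "B \<in> carrier (type_image p \<iota> \<tau>)"
    then show "A \<otimes>\<^bsub>type_image p \<iota> \<tau>\<^esub> B \<in> carrier (type_image p \<iota> \<tau>)"
      using closed by (auto simp: type_image_def GL2_def simp flip: mult)
  next
    show "\<one>\<^bsub>type_image p \<iota> \<tau>\<^esub> \<in> carrier (type_image p \<iota> \<tau>)"
      using id one by (auto simp: type_image_def GL2_def image_iff intro!: bexI[of _ id])
  next
    fix A assume "A \<in> carrier (type_image p \<iota> \<tau>)"
    then obtain x where x: "x \<in> carrier (inertia_group p \<iota>)" "A = \<tau> x" by (auto simp: type_image_def)
    have "inv\<^bsub>inertia_group p \<iota>\<^esub> x \<circ> x = id" using I.l_inv[OF x(1)] by (simp add: inertia_group_def)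
    then have "\<tau> (inv\<^bsub>inertia_group p \<iota>\<^esub> x) ** A = mat 1"
      using mult[OF I.inv_closed[OF x(1)] x(1)] one x(2) by simp
    then show "\<exists>B\<in>carrier (type_image p \<iota> \<tau>). B \<otimes>\<^bsub>type_image p \<iota> \<tau>\<^esub> A = \<one>\<^bsub>type_image p \<iota> \<tau>\<^esub>"
      using I.inv_closed[OF x(1)] by (auto simp: type_image_def GL2_def)
  qed (auto simp: type_image_def GL2_def matrix_mul_assoc)
qed

end

theorem theorem3p4:
  fixes p :: nat
    and \<iota> :: "(nat \<Rightarrow> rat) set \<Rightarrow> 'f::field"
    and \<tau>\<^sub>1 \<tau>\<^sub>2 :: "('f alg_closure \<Rightarrow> 'f alg_closure) \<Rightarrow> complex^2^2"
  assumes "Factorial_Ring.prime p"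
    and "finite_extension_of_Qp p \<iota>"
    and "inertial_type p \<iota> \<tau>\<^sub>1" and "inertial_type p \<iota> \<tau>\<^sub>2"
    and "trivial_determinant p \<iota> \<tau>\<^sub>1" and "trivial_determinant p \<iota> \<tau>\<^sub>2"
    and "admissible_image p (type_image p \<iota> \<tau>\<^sub>1)"
    and "admissible_image p (type_image p \<iota> \<tau>\<^sub>2)"
  shows "kernel_field p \<iota> \<tau>\<^sub>1 = kernel_field p \<iota> \<tau>\<^sub>2 \<longleftrightarrow> isomorphic_types p \<iota> \<tau>\<^sub>1 \<tau>\<^sub>2"
proof
  assume eq: "kernel_field p \<iota> \<tau>\<^sub>1 = kernel_field p \<iota> \<tau>\<^sub>2"
  have mult: "x \<otimes>\<^bsub>inertia_group p \<iota>\<^esub> y = x \<circ> y" for x y by (simp add: inertia_group_def)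
  note orders1 = admissible_image_orders[OF group_type_image[OF assms(1,2,3,5)] assms(7)]
  note orders2 = admissible_image_orders[OF group_type_image[OF assms(1,2,4,6)] assms(8)]
  interpret I: group "inertia_group p \<iota>" unfolding inertia_group_def by (rule group_galois_group)
  interpret SL2_rep_pair "inertia_group p \<iota>" \<tau>\<^sub>1 \<tau>\<^sub>2
  proof
    show "\<tau>\<^sub>1 (x \<otimes>\<^bsub>inertia_group p \<iota>\<^esub> y) = \<tau>\<^sub>1 x ** \<tau>\<^sub>1 y" "\<tau>\<^sub>2 (x \<otimes>\<^bsub>inertia_group p \<iota>\<^esub> y) = \<tau>\<^sub>2 x ** \<tau>\<^sub>2 y"
      if "x \<in> carrier (inertia_group p \<iota>)" "y \<in> carrier (inertia_group p \<iota>)" for x y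
      unfolding mult using that assms inertial_type_mult by blast+
    show "det (\<tau>\<^sub>1 x) = 1" "det (\<tau>\<^sub>2 x) = 1" if "x \<in> carrier (inertia_group p \<iota>)" for x
      using that assms unfolding trivial_determinant_def by blast+
    show "\<tau>\<^sub>1 x = mat 1 \<longleftrightarrow> \<tau>\<^sub>2 x = mat 1" if "x \<in> carrier (inertia_group p \<iota>)" for x
      by (rule kernel_eq_of_kernel_field_eq[OF assms(1,2,3,5,4,6) eq that])
    show "finite (\<tau>\<^sub>1 ` carrier (inertia_group p \<iota>))" "finite (\<tau>\<^sub>2 ` carrier (inertia_group p \<iota>))"
      using orders1(2) orders2(2) by (simp_all add: type_image_def)
    show "(\<tau>\<^sub>1 x ** \<tau>\<^sub>1 x) ** (\<tau>\<^sub>1 x ** \<tau>\<^sub>1 x) = mat 1 \<or>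
        (\<tau>\<^sub>1 x ** \<tau>\<^sub>1 x ** \<tau>\<^sub>1 x) ** (\<tau>\<^sub>1 x ** \<tau>\<^sub>1 x ** \<tau>\<^sub>1 x) = mat 1"
      if "x \<in> carrier (inertia_group p \<iota>)" for x
      using orders1(1) that unfolding elements_of_order_dvd_4_or_6_def by (auto simp: type_image_def GL2_def)
  qed
  show "isomorphic_types p \<iota> \<tau>\<^sub>1 \<tau>\<^sub>2"
    using equivalent unfolding isomorphic_types_def .
next
  assume "isomorphic_types p \<iota> \<tau>\<^sub>1 \<tau>\<^sub>2"
  then obtain P Q where P: "P ** Q = mat 1" "Q ** P = mat 1"
      "\<And>\<sigma>. \<sigma> \<in> carrier (inertia_group p \<iota>) \<Longrightarrow> P ** \<tau>\<^sub>1 \<sigma> = \<tau>\<^sub>2 \<sigma> ** P"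
    unfolding isomorphic_types_def invertible_def by blast
  \<comment> \<open>Conjugate types have the same kernel, and the kernel determines the
    field.\<close>
  have "\<tau>\<^sub>1 \<sigma> = mat 1 \<longleftrightarrow> \<tau>\<^sub>2 \<sigma> = mat 1" if \<sigma>: "\<sigma> \<in> carrier (inertia_group p \<iota>)" for \<sigma>
  proof
    assume "\<tau>\<^sub>1 \<sigma> = mat 1"
    then have "\<tau>\<^sub>2 \<sigma> ** P = P" using P(3)[OF \<sigma>] by simp
    then have "\<tau>\<^sub>2 \<sigma> ** (P ** Q) = P ** Q" by (simp add: matrix_mul_assoc)
    then show "\<tau>\<^sub>2 \<sigma> = mat 1" by (simp add: P(1))
  next
    assume "\<tau>\<^sub>2 \<sigma> = mat 1"
    then have "P ** \<tau>\<^sub>1 \<sigma> = P" using P(3)[OF \<sigma>] by simp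
    then have "(Q ** P) ** \<tau>\<^sub>1 \<sigma> = Q ** P" by (simp flip: matrix_mul_assoc)
    then show "\<tau>\<^sub>1 \<sigma> = mat 1" by (simp add: P(2))
  qed
  then have "kernel (inertia_group p \<iota>) GL2 \<tau>\<^sub>1 = kernel (inertia_group p \<iota>) GL2 \<tau>\<^sub>2"
    unfolding kernel_def GL2_def by auto
  then show "kernel_field p \<iota> \<tau>\<^sub>1 = kernel_field p \<iota> \<tau>\<^sub>2" unfolding kernel_field_def by simp
qed

end
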